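(* Let $n\ge3$, let $J\subset(0,\infty)$ be an open interval, and let $c_1,c_2:J\to\mathbb{R}$ be smooth functions with $c_1\neq-1$, $c_2\neq0$ and $c_2^2-4c_1-4\neq0$ everywhere on $J$. Let $F(x,y)=u\,\phi(r,s)$ with $$\phi(r,s)=\sqrt{r^2+c_1s^2+c_2s\sqrt{r^2-s^2}}\;\exp\left(\frac{c_2}{\sqrt{c_2^2-4c_1-4}}\operatorname{arctanh}\left(\frac{c_2s+2\sqrt{r^2-s^2}}{s\sqrt{c_2^2-4c_1-4}}\right)\right),$$ where, if $c_2^2-4c_1-4<0$, the exponent is replaced by $-\frac{c_2}{\sqrt{4c_1+4-c_2^2}}\arctan\left(\frac{c_2s+2\sqrt{r^2-s^2}}{s\sqrt{4c_1+4-c_2^2}}\right)$. Then $F$ is a non-regular Landsberg metric if and only if either (i) $c_1,c_2$ are constants, or (ii) $c_1=b\,c_2^2-1$ for some constant $b\in\mathbb{R}$. In case (ii) the metric takes the form $$\phi(r,s)=\sqrt{r^2+(bc_2^2-1)s^2+c_2s\sqrt{r^2-s^2}}\;\exp\left(\frac{1}{\sqrt{1-4b}}\operatorname{arctanh}\left(\frac{c_2s+2\sqrt{r^2-s^2}}{c_2s\sqrt{1-4b}}\right)\right),$$ where, if $1-4b<0$, the exponent is replaced by $-\frac{1}{\sqrt{4b-1}}\arctan\left(\frac{c_2s+2\sqrt{r^2-s^2}}{c_2s\sqrt{4b-1}}\right)$. Moreover, in this case the geodesic spray is $G^i=uPy^i+u^2Qx^i$ with $$P=\frac{s}{r^2}+\frac{\sqrt{r^2-s^2}}{b\,r^2c_2},\qquad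 Q=\frac{(b\,r\,c_2c_2'-2b\,c_2^2+2)s^2}{2b\,r^4c_2^2}-\frac{s\sqrt{r^2-s^2}}{b\,r^4c_2}+\frac{b\,c_2^2-2}{2b\,r^2c_2^2},$$ where $c_2'=dc_2/dr$, and $F$ is a Landsberg metric which is not Berwaldian.
   Context: $r=|x|$, $u=|y|$, $s=\langle x,y\rangle/|y|$ with the Euclidean inner product and norm on $\mathbb{R}^n$; $c_1=c_1(r)$, $c_2=c_2(r)$. $F$ is considered on the open conic set of $(x,y)$, $y\neq0$, with $r\in J$, $0<|s|<r$ and $r^2+c_1s^2+c_2s\sqrt{r^2-s^2}>0$. For real $z$ with $|z|\neq1$, $\operatorname{arctanh}z$ denotes $\frac12\ln\left|\frac{1+z}{1-z}\right|$. Let $g_{ij}=\frac12\partial^2F^2/\partial y^i\partial y^j$ (nondegenerate here) with inverse $g^{ij}$. The geodesic spray coefficients are $G^i=\frac14g^{ih}\left(y^k\frac{\partial^2F^2}{\partial x^k\partial y^h}-\frac{\partial F^2}{\partial x^h}\right)$, and $G^i_{jkh}=\frac{\partial^3G^i}{\partial y^j\partial y^k\partial y^h}$. $F$ is Berwaldian if $G^i_{jkh}=0$ identically, and Landsberg if $L_{jkh}:=-\frac12F\,G^i_{jkh}\frac{\partial F}{\partial y^i}=0$ identically, on the domain of $F$. "Non-regular" means that $F$ does not extend to a regular Finsler metric (smooth and positive on all nonzero tangent vectors, with $g_{ij}$ positive definite) over the base domain $\{x:|x|\in J\}$. *)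

theory Defs
  imports "HOL-Analysis.Analysis"
begin

text \<open>Functions \<open>f\<close> that are \<open>k\<close> times continuously differentiable, resp. smooth, on an open set
  \<open>S\<close>.\<close>

primrec Ck_on :: "nat \<Rightarrow> ('a::euclidean_space \<Rightarrow> real) \<Rightarrow> 'a set \<Rightarrow> bool" where
  "Ck_on 0 f S \<longleftrightarrow> continuous_on S f"
| "Ck_on (Suc k) f S \<longleftrightarrow>
     (\<forall>z\<in>S. f differentiable (at z)) \<and>
     (\<forall>v\<in>Basis. Ck_on k (\<lambda>z. frechet_derivative f (at z) v) S)"

definition smooth_on :: "('a::euclidean_space \<Rightarrow> real) \<Rightarrow> 'a set \<Rightarrow> bool" where
  "smooth_on f S \<longleftrightarrow> (\<forall>k. Ck_on k f S)"

definition partial_deriv :: "'n::finite \<Rightarrow> (real^'n \<Rightarrow> real) \<Rightarrow> real^'n \<Rightarrow> real" where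
  "partial_deriv i f z = deriv (\<lambda>t. f (z + t *\<^sub>R axis i 1)) 0"

text \<open>A (conic, possibly indefinite) Finsler function is a curried map \<open>F x y\<close> of the position \<open>x\<close>
  and the tangent vector \<open>y\<close>. Everything below is local in \<open>(x, y)\<close>, so on an open domain the
  values of \<open>F\<close> outside that domain play no role.\<close>

definition metric_tensor :: "(real^'n \<Rightarrow> real^'n \<Rightarrow> real) \<Rightarrow> real^'n \<Rightarrow> real^'n \<Rightarrow> real^'n^'n" where
  "metric_tensor F x y =
     (\<chi> i j. 1/2 * partial_deriv i (\<lambda>y'. partial_deriv j (\<lambda>y''. (F x y'')\<^sup>2) y') y)"

definition spray_coeff :: "(real^'n \<Rightarrow> real^'n \<Rightarrow> real) \<Rightarrow> real^'n \<Rightarrow> real^'n \<Rightarrow> real^'n" where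
  "spray_coeff F x y =
     (\<chi> i. 1/4 * (\<Sum>h\<in>UNIV. matrix_inv (metric_tensor F x y) $ i $ h *
        ((\<Sum>k\<in>UNIV. y $ k *
            partial_deriv k (\<lambda>x'. partial_deriv h (\<lambda>y'. (F x' y')\<^sup>2) y) x)
         - partial_deriv h (\<lambda>x'. (F x' y)\<^sup>2) x)))"

definition berwald_curvature ::
  "(real^'n \<Rightarrow> real^'n \<Rightarrow> real) \<Rightarrow> real^'n \<Rightarrow> real^'n \<Rightarrow> 'n \<Rightarrow> 'n \<Rightarrow> 'n \<Rightarrow> 'n \<Rightarrow> real" where
  "berwald_curvature F x y i j k h =
     partial_deriv j (\<lambda>y'. partial_deriv k (\<lambda>y''. partial_deriv h
       (\<lambda>y'''. spray_coeff F x y''' $ i) y'') y') y"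

definition landsberg_tensor ::
  "(real^'n \<Rightarrow> real^'n \<Rightarrow> real) \<Rightarrow> real^'n \<Rightarrow> real^'n \<Rightarrow> 'n \<Rightarrow> 'n \<Rightarrow> 'n \<Rightarrow> real" where
  "landsberg_tensor F x y j k h =
     - 1/2 * F x y * (\<Sum>i\<in>UNIV. berwald_curvature F x y i j k h * partial_deriv i (F x) y)"

definition berwaldian_on ::
  "((real^'n) \<times> (real^'n)) set \<Rightarrow> (real^'n \<Rightarrow> real^'n \<Rightarrow> real) \<Rightarrow> bool" where
  "berwaldian_on D F \<longleftrightarrow> (\<forall>(x, y)\<in>D. \<forall>i j k h. berwald_curvature F x y i j k h = 0)"

definition landsberg_on ::
  "((real^'n) \<times> (real^'n)) set \<Rightarrow> (real^'n \<Rightarrow> real^'n \<Rightarrow> real) \<Rightarrow> bool" where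
  "landsberg_on D F \<longleftrightarrow> (\<forall>(x, y)\<in>D. \<forall>j k h. landsberg_tensor F x y j k h = 0)"

definition regular_finsler_on :: "(real^'n) set \<Rightarrow> (real^'n \<Rightarrow> real^'n \<Rightarrow> real) \<Rightarrow> bool" where
  "regular_finsler_on U F \<longleftrightarrow>
     smooth_on (\<lambda>(x, y). F x y) (U \<times> (UNIV - {0})) \<and>
     (\<forall>x\<in>U. \<forall>y. y \<noteq> 0 \<longrightarrow>
        F x y > 0 \<and>
        (\<forall>t>0. F x (t *\<^sub>R y) = t * F x y) \<and>
        (\<forall>v. v \<noteq> 0 \<longrightarrow> v \<bullet> (metric_tensor F x y *v v) > 0))"

definition non_regular_over ::
  "(real^'n) set \<Rightarrow> ((real^'n) \<times> (real^'n)) set \<Rightarrow> (real^'n \<Rightarrow> real^'n \<Rightarrow> real) \<Rightarrow> bool" where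
  "non_regular_over U D F \<longleftrightarrow>
     \<not> (\<exists>F'. regular_finsler_on U F' \<and> (\<forall>(x, y)\<in>D. F' x y = F x y))"

text \<open>The library's \<^const>\<open>artanh\<close> is only meant for arguments of modulus less than 1; here the
  argument may also have modulus greater than 1.\<close>

definition arctanh :: "real \<Rightarrow> real" where
  "arctanh z = 1/2 * ln \<bar>(1 + z) / (1 - z)\<bar>"

text \<open>In the next four definitions the real numbers \<open>a1\<close>, \<open>a2\<close> are the values of the functions
  \<open>c\<^sub>1\<close>, \<open>c\<^sub>2\<close> at \<open>r\<close>.\<close>

definition phi_radicand :: "real \<Rightarrow> real \<Rightarrow> real \<Rightarrow> real \<Rightarrow> real" where
  "phi_radicand a1 a2 r s = r\<^sup>2 + a1 * s\<^sup>2 + a2 * s * sqrt (r\<^sup>2 - s\<^sup>2)"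

definition phi_exponent :: "real \<Rightarrow> real \<Rightarrow> real \<Rightarrow> real \<Rightarrow> real" where
  "phi_exponent a1 a2 r s =
     (if a2\<^sup>2 - 4 * a1 - 4 < 0
      then - (a2 / sqrt (4 * a1 + 4 - a2\<^sup>2)) *
             arctan ((a2 * s + 2 * sqrt (r\<^sup>2 - s\<^sup>2)) / (s * sqrt (4 * a1 + 4 - a2\<^sup>2)))
      else a2 / sqrt (a2\<^sup>2 - 4 * a1 - 4) *
             arctanh ((a2 * s + 2 * sqrt (r\<^sup>2 - s\<^sup>2)) / (s * sqrt (a2\<^sup>2 - 4 * a1 - 4))))"

definition phi :: "real \<Rightarrow> real \<Rightarrow> real \<Rightarrow> real \<Rightarrow> real" where
  "phi a1 a2 r s = sqrt (phi_radicand a1 a2 r s) * exp (phi_exponent a1 a2 r s)"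

definition phi_special :: "real \<Rightarrow> real \<Rightarrow> real \<Rightarrow> real \<Rightarrow> real" where
  "phi_special b a2 r s =
     sqrt (r\<^sup>2 + (b * a2\<^sup>2 - 1) * s\<^sup>2 + a2 * s * sqrt (r\<^sup>2 - s\<^sup>2)) *
     exp (if 1 - 4 * b < 0
          then - (1 / sqrt (4 * b - 1)) *
                 arctan ((a2 * s + 2 * sqrt (r\<^sup>2 - s\<^sup>2)) / (a2 * s * sqrt (4 * b - 1)))
          else 1 / sqrt (1 - 4 * b) *
                 arctanh ((a2 * s + 2 * sqrt (r\<^sup>2 - s\<^sup>2)) / (a2 * s * sqrt (1 - 4 * b))))"

definition s_var :: "real^'n \<Rightarrow> real^'n \<Rightarrow> real" where
  "s_var x y = (x \<bullet> y) / norm y"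

definition F_metric ::
  "(real \<Rightarrow> real) \<Rightarrow> (real \<Rightarrow> real) \<Rightarrow> real^'n \<Rightarrow> real^'n \<Rightarrow> real" where
  "F_metric c1 c2 x y = norm y * phi (c1 (norm x)) (c2 (norm x)) (norm x) (s_var x y)"

definition admissible_rs ::
  "real set \<Rightarrow> (real \<Rightarrow> real) \<Rightarrow> (real \<Rightarrow> real) \<Rightarrow> real \<Rightarrow> real \<Rightarrow> bool" where
  "admissible_rs J c1 c2 r s \<longleftrightarrow>
     r \<in> J \<and> 0 < \<bar>s\<bar> \<and> \<bar>s\<bar> < r \<and> phi_radicand (c1 r) (c2 r) r s > 0"

definition F_domain ::
  "real set \<Rightarrow> (real \<Rightarrow> real) \<Rightarrow> (real \<Rightarrow> real) \<Rightarrow> ((real^'n) \<times> (real^'n)) set" where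
  "F_domain J c1 c2 = {(x, y). y \<noteq> 0 \<and> admissible_rs J c1 c2 (norm x) (s_var x y)}"

definition spray_P :: "real \<Rightarrow> (real \<Rightarrow> real) \<Rightarrow> real \<Rightarrow> real \<Rightarrow> real" where
  "spray_P b c2 r s = s / r\<^sup>2 + sqrt (r\<^sup>2 - s\<^sup>2) / (b * r\<^sup>2 * c2 r)"

definition spray_Q :: "real \<Rightarrow> (real \<Rightarrow> real) \<Rightarrow> real \<Rightarrow> real \<Rightarrow> real" where
  "spray_Q b c2 r s =
     (b * r * c2 r * deriv c2 r - 2 * b * (c2 r)\<^sup>2 + 2) * s\<^sup>2 / (2 * b * r^4 * (c2 r)\<^sup>2)
     - s * sqrt (r\<^sup>2 - s\<^sup>2) / (b * r^4 * c2 r)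
     + (b * (c2 r)\<^sup>2 - 2) / (2 * b * r\<^sup>2 * (c2 r)\<^sup>2)"

end

(* Write v = <x,y>, w = sqrt(|x|^2 |y|^2 - v^2), A = c1 + 1, B = c2. Then F^2 = q exp(2E) with
   q = w^2 + B v w + A v^2 and an exponent E(A,B,w/v) satisfying dE/dt = -B / (2 (t^2 + B t + A)).
   This makes the y-gradient of F^2 equal to 2 exp(2E) l with l = |x|^2 y + (B w + c1 v) x, and the
   metric tensor maps y to exp(2E) l and x to a combination of x and l; so the spray can be read off
   as G = X y + Y x. All terms that are not of the form "quadratic in y plus a multiple of w times
   the projection of y orthogonal to x" carry the factor delta = A' - 2 A B' / B.
   If delta = 0, the third y-derivatives of G annihilate the gradient of F by Euler's theorem, but
   do not vanish, so F is Landsberg and not Berwaldian. Otherwise some component of the Landsberg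
   tensor is a nonzero multiple of delta. Finally delta = 0 means that A / B^2 is constant, which
   contains the case of constant c1, c2. Non-regularity holds always: F jumps across s = 0 if the
   discriminant is negative, and tends to 0 at a root of the radicand if it is positive. *)

theory Submission
  imports Defs
begin

text \<open>The factor delta has a structural origin. The exponent is unchanged under (A, B, t) ->
  (k^2 A, k B, k t), so Euler's relation 2 A E_A + B E_B + t E_t = 0 eliminates E_B, and the
  derivative of E along a radius becomes delta times E_A plus algebraic terms. The quotient A / B^2
  is the invariant of this scaling. Since E_A again contains E, delta multiplies everything
  transcendental in the spray; the t-derivative of E_A is rational, and this is why the curvature
  components computed for delta \<noteq> 0 come out rational. The dimension bound provides a
  direction orthogonal to both x and y. In dimension 2, w would locally be a linear form in y, its
  product with the projection would be quadratic, and the Berwald curvature would vanish for delta =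
  0. For delta \<noteq> 0 the full Landsberg tensor is avoided: one component at one point over each
  radius decides.\<close>

section \<open>Calculus of the exponent\<close>

text \<open>The common form of the two branches of the exponent: with \<open>d\<close> the discriminant, both satisfy
  the same differential equations in \<open>d\<close> and \<open>z\<close>.\<close>

definition arc_quot :: "real \<Rightarrow> real \<Rightarrow> real" where
  "arc_quot d z = (if d < 0 then - (1 / sqrt (- d)) * arctan (z / sqrt (- d))
     else 1 / sqrt d * arctanh (z / sqrt d))"

text \<open>The absolute value is removed by writing \<open>arctanh z\<close> as a quarter of the
  logarithm of the square of (1 + z) / (1 - z). That square is positive and differentiable on both
  sides of the poles, so |z| < 1 and |z| > 1 need no separate treatment.\<close>

lemma has_real_derivative_arctanh:
  assumes "z\<^sup>2 \<noteq> (1::real)" and "(f has_real_derivative f') (at x)" and "f x = z"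
  shows "((\<lambda>x. arctanh (f x)) has_real_derivative f' / (1 - z\<^sup>2)) (at x)"
proof -
  have ne: "1 + z \<noteq> 0" "1 - z \<noteq> 0" using assms(1) by (auto simp: add_eq_0_iff)
  have eq: "arctanh z = 1/4 * ln (((1 + z) / (1 - z))\<^sup>2)" if "1 + z \<noteq> 0" "1 - z \<noteq> 0" for z
  proof -
    have "ln (((1 + z) / (1 - z))\<^sup>2) = ln (\<bar>(1 + z) / (1 - z)\<bar>\<^sup>2)" by (simp only: power2_abs)
    also have "\<dots> = 2 * ln \<bar>(1 + z) / (1 - z)\<bar>" using that by (subst ln_realpow) auto
    finally show ?thesis by (simp add: arctanh_def)
  qed
  have pos: "((1 + z) / (1 - z))\<^sup>2 > 0" using ne by simp
  have q: "((\<lambda>z. (1 + z) / (1 - z)) has_real_derivative 2 / (1 - z)\<^sup>2) (at z)"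
    using ne by (auto intro!: derivative_eq_intros simp: power2_eq_square)
  have "((\<lambda>z. 1/4 * ln (((1 + z) / (1 - z))\<^sup>2)) has_real_derivative
      1/4 * (2 * ((1 + z) / (1 - z)) * (2 / (1 - z)\<^sup>2) / ((1 + z) / (1 - z))\<^sup>2)) (at z)"
    by (rule derivative_eq_intros q refl pos)+ simp
  moreover have "1/4 * (2 * ((1 + z) / (1 - z)) * (2 / (1 - z)\<^sup>2) / ((1 + z) / (1 - z))\<^sup>2)
      = 1 / ((1 + z) * (1 - z))"
  proof -
    have "1/4 * (2 * (a / b) * (2 / b\<^sup>2) / (a / b)\<^sup>2) = 1 / (a * b)" if "a \<noteq> 0" "b \<noteq> 0" for a b :: real
      using that by (simp add: power2_eq_square)
    then show ?thesis using ne by blast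
  qed
  moreover have "(1 + z) * (1 - z) = 1 - z\<^sup>2" by (simp add: power2_eq_square algebra_simps)
  ultimately have d: "((\<lambda>z. 1/4 * ln (((1 + z) / (1 - z))\<^sup>2)) has_real_derivative 1 / (1 - z\<^sup>2)) (at z)"
    by simp
  have "open {z::real. 1 + z \<noteq> 0 \<and> 1 - z \<noteq> 0}"
    by (intro open_Collect_conj open_Collect_neq continuous_intros)
  then have "(arctanh has_real_derivative 1 / (1 - z\<^sup>2)) (at z)"
    by (rule has_field_derivative_transform_within_open[OF d]) (use ne eq in auto)
  from DERIV_chain2[OF this[folded assms(3)] assms(2)] show ?thesis by (simp add: assms(3))
qed

text \<open>\<open>arc_quot\<close> is homogeneous of degree -1 under (d, z) -> (k^2 d, k z) with k
  > 0. Its z-derivative is 1 / (d - z^2), and Euler's relation then determines the d-derivative,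
  which is why \<open>arc_quot\<close> reappears in it.\<close>

lemma has_real_derivative_arc_quot:
  assumes d: "(d has_real_derivative d') (at x)" and z: "(z has_real_derivative z') (at x)"
    and d0: "d x \<noteq> 0" and ne: "d x \<noteq> (z x)\<^sup>2"
  shows "((\<lambda>x. arc_quot (d x) (z x)) has_real_derivative
     z' / (d x - (z x)\<^sup>2) - d' / (2 * d x) * (arc_quot (d x) (z x) + z x / (d x - (z x)\<^sup>2))) (at x)"
proof (cases "d x < 0")
  case True
  define e where "e = sqrt (- d x)"
  have e: "e > 0" "e\<^sup>2 = - d x" using True by (auto simp: e_def)
  have ez: "e\<^sup>2 + (z x)\<^sup>2 > 0" using e(1) by (intro add_pos_nonneg) auto
  have de: "((\<lambda>x. sqrt (- d x)) has_real_derivative - d' / (2 * e)) (at x)"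
    using d True e by (auto intro!: derivative_eq_intros simp: e_def field_simps)
  have m1: "((\<lambda>x. - (1 / sqrt (- d x)) * arctan (z x / sqrt (- d x))) has_real_derivative
     (- d' / (2 * e)) / e\<^sup>2 * arctan (z x / e) +
     - (1 / e) * (((z' * e - z x * (- d' / (2 * e))) / (e * e)) / (1 + (z x / e)\<^sup>2))) (at x)"
  proof -
    define g where "g = (\<lambda>x. sqrt (- d x))"
    have g: "(g has_real_derivative - d' / (2 * e)) (at x)" "g x = e" "e \<noteq> 0" using de e(1) by (auto simp: g_def e_def)
    have dq: "((\<lambda>x. z x / g x) has_real_derivative (z' * e - z x * (- d' / (2 * e))) / (e * e)) (at x)"
      using g(2,3) by (auto intro!: derivative_eq_intros g(1) z)
    have da: "((\<lambda>x. arctan (z x / g x)) has_real_derivative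
       ((z' * e - z x * (- d' / (2 * e))) / (e * e)) / (1 + (z x / e)\<^sup>2)) (at x)"
    proof -
      have c: "inverse a * b = b / a" for a b :: real by (simp add: divide_inverse)
      show ?thesis using DERIV_chain2[OF DERIV_arctan dq] unfolding g(2) c .
    qed
    define h where "h = (\<lambda>x. arctan (z x / g x))"
    note da = da[folded h_def]
    have "((\<lambda>x. - (1 / g x) * h x) has_real_derivative
     (- d' / (2 * e)) / e\<^sup>2 * h x +
     - (1 / e) * (((z' * e - z x * (- d' / (2 * e))) / (e * e)) / (1 + (z x / e)\<^sup>2))) (at x)"
    proof -
      have "((\<lambda>x. - (1 / g x)) has_real_derivative (- d' / (2 * e)) / e\<^sup>2) (at x)"
        using g(2,3) by (auto intro!: derivative_eq_intros g(1) simp: power2_eq_square)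
      from DERIV_mult[OF this da] show ?thesis by (simp only: g(2) mult.commute add.commute)
    qed
    then show ?thesis by (simp add: g(2) h_def) (simp add: g_def)
  qed
  have m2: "((z' * e - z x * (- d' / (2 * e))) / (e * e)) / (1 + (z x / e)\<^sup>2)
      = (z' * e + z x * d' / (2 * e)) / (e\<^sup>2 + (z x)\<^sup>2)"
  proof -
    have "(e * e) * (1 + (z x / e)\<^sup>2) = e\<^sup>2 + (z x)\<^sup>2" using e(1) by (simp add: field_simps power2_eq_square)
    then show ?thesis by (simp add: divide_divide_eq_left)
  qed
  have m3: "(- d' / (2 * e)) / e\<^sup>2 * arctan (z x / e) +
     - (1 / e) * ((z' * e + z x * d' / (2 * e)) / (e\<^sup>2 + (z x)\<^sup>2))
    = z' / (- e\<^sup>2 - (z x)\<^sup>2) - d' / (2 * (- e\<^sup>2)) * (- (1 / e) * arctan (z x / e) + z x / (- e\<^sup>2 - (z x)\<^sup>2))"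
  proof -
    have "- e\<^sup>2 - (z x)\<^sup>2 = - (e\<^sup>2 + (z x)\<^sup>2)" by simp
    define Q where "Q = e\<^sup>2 + (z x)\<^sup>2"
    show ?thesis unfolding \<open>- e\<^sup>2 - (z x)\<^sup>2 = - (e\<^sup>2 + (z x)\<^sup>2)\<close> using e(1) ez 
      unfolding Q_def[symmetric] by (simp add: divide_simps power2_eq_square) (simp add: algebra_simps)
  qed
  have de2: "d x = - e\<^sup>2" and aq: "arc_quot (d x) (z x) = - (1 / e) * arctan (z x / e)"
    using True e by (simp_all add: arc_quot_def e_def)
  have D: "((\<lambda>x. - (1 / sqrt (- d x)) * arctan (z x / sqrt (- d x))) has_real_derivative
     z' / (d x - (z x)\<^sup>2) - d' / (2 * d x) * (arc_quot (d x) (z x) + z x / (d x - (z x)\<^sup>2))) (at x)"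
    using m1[unfolded m2 m3] unfolding aq unfolding de2 by simp
  have "\<forall>\<^sub>F y in nhds x. d y < 0"
    using DERIV_isCont[OF d] True by (simp add: isCont_def tendsto_at_iff_tendsto_nhds order_tendstoD(2))
  then have "\<forall>\<^sub>F y in nhds x. - (1 / sqrt (- d y)) * arctan (z y / sqrt (- d y)) = arc_quot (d y) (z y)"
    by eventually_elim (simp add: arc_quot_def)
  then show ?thesis using D by (subst (asm) DERIV_cong_ev) auto
next
  case False
  define e where "e = sqrt (d x)"
  have pos: "d x > 0" using False d0 by simp
  have e: "e > 0" "e\<^sup>2 = d x" using pos by (auto simp: e_def)
  have ez: "e\<^sup>2 - (z x)\<^sup>2 \<noteq> 0" using e ne by simp
  have de: "((\<lambda>x. sqrt (d x)) has_real_derivative d' / (2 * e)) (at x)"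
    using d pos e by (auto intro!: derivative_eq_intros simp: e_def field_simps)
  have ne1: "(z x / e)\<^sup>2 \<noteq> 1" using ez e(1) by (auto simp: power_divide)
  have m1: "((\<lambda>x. 1 / sqrt (d x) * arctanh (z x / sqrt (d x))) has_real_derivative
     (- d' / (2 * e)) / e\<^sup>2 * arctanh (z x / e) +
     (1 / e) * (((z' * e - z x * (d' / (2 * e))) / (e * e)) / (1 - (z x / e)\<^sup>2))) (at x)"
  proof -
    define g where "g = (\<lambda>x. sqrt (d x))"
    have g: "(g has_real_derivative d' / (2 * e)) (at x)" "g x = e" "e \<noteq> 0" using de e(1) by (auto simp: g_def e_def)
    have dq: "((\<lambda>x. z x / g x) has_real_derivative (z' * e - z x * (d' / (2 * e))) / (e * e)) (at x)"
      using g(2,3) by (auto intro!: derivative_eq_intros g(1) z)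
    have da: "((\<lambda>x. arctanh (z x / g x)) has_real_derivative
       ((z' * e - z x * (d' / (2 * e))) / (e * e)) / (1 - (z x / e)\<^sup>2)) (at x)"
      by (rule has_real_derivative_arctanh[OF ne1 dq]) (simp add: g(2))
    have "((\<lambda>x. 1 / g x * arctanh (z x / g x)) has_real_derivative
     (- d' / (2 * e)) / e\<^sup>2 * arctanh (z x / e) +
     (1 / e) * (((z' * e - z x * (d' / (2 * e))) / (e * e)) / (1 - (z x / e)\<^sup>2))) (at x)"
    proof -
      have "((\<lambda>x. 1 / g x) has_real_derivative (- d' / (2 * e)) / e\<^sup>2) (at x)"
        using g(2,3) by (auto intro!: derivative_eq_intros g(1) simp: power2_eq_square)
      from DERIV_mult[OF this da] show ?thesis by (simp only: g(2) mult.commute add.commute)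
    qed
    then show ?thesis by (simp add: g_def)
  qed
  have m2: "((z' * e - z x * (d' / (2 * e))) / (e * e)) / (1 - (z x / e)\<^sup>2)
      = (z' * e - z x * d' / (2 * e)) / (e\<^sup>2 - (z x)\<^sup>2)"
  proof -
    have "(e * e) * (1 - (z x / e)\<^sup>2) = e\<^sup>2 - (z x)\<^sup>2" using e(1) by (simp add: field_simps power2_eq_square)
    then show ?thesis by (simp add: divide_divide_eq_left)
  qed
  have m3: "(- d' / (2 * e)) / e\<^sup>2 * arctanh (z x / e) +
     (1 / e) * ((z' * e - z x * d' / (2 * e)) / (e\<^sup>2 - (z x)\<^sup>2))
    = z' / (e\<^sup>2 - (z x)\<^sup>2) - d' / (2 * e\<^sup>2) * ((1 / e) * arctanh (z x / e) + z x / (e\<^sup>2 - (z x)\<^sup>2))"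
    using e(1) ez by (simp add: divide_simps power2_eq_square) (simp add: algebra_simps)
  have de2: "d x = e\<^sup>2" and aq: "arc_quot (d x) (z x) = 1 / e * arctanh (z x / e)"
    using False e by (simp_all add: arc_quot_def e_def)
  have D: "((\<lambda>x. 1 / sqrt (d x) * arctanh (z x / sqrt (d x))) has_real_derivative
     z' / (d x - (z x)\<^sup>2) - d' / (2 * d x) * (arc_quot (d x) (z x) + z x / (d x - (z x)\<^sup>2))) (at x)"
    using m1[unfolded m2 m3] unfolding aq unfolding de2 by simp
  have "\<forall>\<^sub>F y in nhds x. d y > 0"
    using DERIV_isCont[OF d] pos by (simp add: isCont_def tendsto_at_iff_tendsto_nhds order_tendstoD(1))
  then have "\<forall>\<^sub>F y in nhds x. 1 / sqrt (d y) * arctanh (z y / sqrt (d y)) = arc_quot (d y) (z y)"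
    by eventually_elim (simp add: arc_quot_def)
  then show ?thesis using D by (subst (asm) DERIV_cong_ev) auto
qed

text \<open>\<open>B\<^sup>2 - 4 * A\<close> and \<open>B + 2 * t\<close> are the discriminant and
  the derivative of t^2 + B t + A, so this is the classical antiderivative of - B / (2 (t^2 + B t +
  A)) in \<open>t\<close>, for both signs of the discriminant.\<close>

definition expo :: "real \<Rightarrow> real \<Rightarrow> real \<Rightarrow> real" where
  "expo A B t = B * arc_quot (B\<^sup>2 - 4 * A) (B + 2 * t)"

text \<open>The partial derivative of \<open>expo\<close> in its first argument.\<close>

definition expo_A :: "real \<Rightarrow> real \<Rightarrow> real \<Rightarrow> real" where
  "expo_A A B t = 2 / (B\<^sup>2 - 4 * A) * (expo A B t - B * (B + 2 * t) / (4 * (t\<^sup>2 + B * t + A)))"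

text \<open>By the scaling invariance of \<open>expo\<close>, Euler's relation expresses the
  derivative in \<open>B\<close> as - 2 A / B times \<open>expo_A\<close> plus t / (2 p). Grouping
  the terms with \<open>expo_A\<close> produces the factor A' - 2 A B' / B.\<close>

lemma has_real_derivative_expo:
  assumes A: "(A has_real_derivative A') (at x)" and B: "(B has_real_derivative B') (at x)"
    and t: "(t has_real_derivative t') (at x)"
    and d0: "(B x)\<^sup>2 - 4 * A x \<noteq> 0" and B0: "B x \<noteq> 0"
    and p: "p = (t x)\<^sup>2 + B x * t x + A x" "p \<noteq> 0"
  shows "((\<lambda>x. expo (A x) (B x) (t x)) has_real_derivative
     - B x / (2 * p) * t' + expo_A (A x) (B x) (t x) * (A' - 2 * A x * B' / B x) + t x / (2 * p) * B') (at x)"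
proof -
  let ?d = "(B x)\<^sup>2 - 4 * A x" and ?z = "B x + 2 * t x"
  \<comment> \<open>The poles z^2 = d of the closed form are thus exactly the zeros of t^2 + B t +
    A.\<close>
  have dz: "?d - ?z\<^sup>2 = - 4 * p" unfolding p(1) by (simp add: power2_eq_square algebra_simps)
  have ne: "?d \<noteq> ?z\<^sup>2" using dz p(2) by auto
  have "((\<lambda>x. (B x)\<^sup>2 - 4 * A x) has_real_derivative 2 * B x * B' - 4 * A') (at x)"
    using A B by (auto intro!: derivative_eq_intros)
  moreover have "((\<lambda>x. B x + 2 * t x) has_real_derivative B' + 2 * t') (at x)"
    using B t by (auto intro!: derivative_eq_intros)
  ultimately have D: "((\<lambda>x. arc_quot ((B x)\<^sup>2 - 4 * A x) (B x + 2 * t x)) has_real_derivative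
     (B' + 2 * t') / (?d - ?z\<^sup>2) - (2 * B x * B' - 4 * A') / (2 * ?d) * (arc_quot ?d ?z + ?z / (?d - ?z\<^sup>2))) (at x)"
    using d0 ne by (intro has_real_derivative_arc_quot)
  define L where "L = arc_quot ?d ?z"
  have "((\<lambda>x. expo (A x) (B x) (t x)) has_real_derivative
     B x * ((B' + 2 * t') / (?d - ?z\<^sup>2) - (2 * B x * B' - 4 * A') / (2 * ?d) * (L + ?z / (?d - ?z\<^sup>2)))
       + B' * L) (at x)"
    unfolding expo_def L_def by (rule derivative_eq_intros D B refl)+ (simp add: algebra_simps)
  moreover have "B x * ((B' + 2 * t') / (?d - ?z\<^sup>2) - (2 * B x * B' - 4 * A') / (2 * ?d) * (L + ?z / (?d - ?z\<^sup>2)))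
       + B' * L = - B x / (2 * p) * t' + expo_A (A x) (B x) (t x) * (A' - 2 * A x * B' / B x) + t x / (2 * p) * B'"
    unfolding expo_A_def expo_def dz L_def[symmetric] p(1)[symmetric]
  proof -
    define k where "k = 1 / ?d"
    define j where "j = 1 / (4 * p)"
    have k: "k * ((B x)\<^sup>2 - 4 * A x) = 1" using d0 by (simp add: k_def)
    have c: "B x * (A' - 2 * A x * B' / B x) = B x * A' - 2 * A x * B'"
      using B0 by (simp add: algebra_simps)
    have "B x * ((B' + 2 * t') / (- 4 * p) - (2 * B x * B' - 4 * A') / (2 * ?d) * (L + ?z / (- 4 * p))) + B' * L
      = B x * (- (B' + 2 * t') * j - (B x * B' - 2 * A') * k * (L - ?z * j)) + B' * L"
    proof -
      have "2 * B x * B' - 4 * A' = 2 * (B x * B' - 2 * A')" by simp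
      then have "(2 * B x * B' - 4 * A') / (2 * ?d) = (B x * B' - 2 * A') * k"
        unfolding k_def by (simp only: mult_divide_mult_cancel_left_if) simp
      then show ?thesis by (simp add: j_def minus_divide_left)
    qed
    also have "\<dots> = - 2 * B x * j * t' + 2 * k * (L - ?z * j) * (B x * A' - 2 * A x * B') + 2 * t x * j * B'"
      using k by algebra
    also have "\<dots> = - B x / (2 * p) * t' +
      2 / ?d * (B x * L - B x * ?z / (4 * p)) * (A' - 2 * A x * B' / B x) + t x / (2 * p) * B'"
    proof -
      have f: "- B x / (2 * p) = - 2 * B x * j" "2 / ?d = 2 * k" "B x * ?z / (4 * p) = B x * ?z * j"
        "t x / (2 * p) = 2 * t x * j" by (simp_all add: k_def j_def)
      show ?thesis unfolding c[symmetric] f by (simp only: ring_distribs mult_ac)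
    qed
    finally show "B x * ((B' + 2 * t') / (- 4 * p) - (2 * B x * B' - 4 * A') / (2 * ?d) * (L + ?z / (- 4 * p))) + B' * L =
      - B x / (2 * p) * t' +
      2 / ?d * (B x * L - B x * ?z / (4 * p)) * (A' - 2 * A x * B' / B x) + t x / (2 * p) * B'" .
  qed
  ultimately show ?thesis by simp
qed

text \<open>Symmetry of mixed partials predicts the value: it is the \<open>A\<close>-derivative of
  - B / (2 p). Although \<open>expo_A\<close> contains \<open>expo\<close>, one derivative in
  \<open>t\<close> makes it rational.\<close>

lemma has_real_derivative_expo_A:
  assumes t: "(t has_real_derivative t') (at x)"
    and d0: "B\<^sup>2 - 4 * A \<noteq> 0" and B0: "B \<noteq> 0"
    and p: "p = (t x)\<^sup>2 + B * t x + A" "p \<noteq> 0"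
  shows "((\<lambda>x. expo_A A B (t x)) has_real_derivative B / (2 * p\<^sup>2) * t') (at x)"
proof -
  have D: "((\<lambda>x. expo A B (t x)) has_real_derivative - B / (2 * p) * t') (at x)"
    using has_real_derivative_expo[of "\<lambda>_. A" 0 x "\<lambda>_. B" 0 t t' p] assms by simp
  define d where "d = B\<^sup>2 - 4 * A"
  have "((\<lambda>x. expo_A A B (t x)) has_real_derivative
     2 / d * (- B / (2 * p) * t' - (B * (2 * t') * (4 * p) - B * (B + 2 * t x) * (4 * (2 * t x * t' + B * t'))) / ((4 * p) * (4 * p)))) (at x)"
  proof -
    define P where "P = (\<lambda>x. (t x)\<^sup>2 + B * t x + A)"
    have P: "(P has_real_derivative 2 * t x * t' + B * t') (at x)" "P x = p"
      unfolding P_def using t by (auto intro!: derivative_eq_intros simp: p(1))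
    have "((\<lambda>x. 2 / d * (expo A B (t x) - B * (B + 2 * t x) / (4 * P x))) has_real_derivative
     2 / d * (- B / (2 * p) * t' - (B * (2 * t') * (4 * p) - B * (B + 2 * t x) * (4 * (2 * t x * t' + B * t'))) / ((4 * p) * (4 * p)))) (at x)"
    proof -
      define p' where "p' = 2 * t x * t' + B * t'"
      have "((\<lambda>x. B * (B + 2 * t x) / (4 * P x)) has_real_derivative
         (B * (2 * t') * (4 * p) - B * (B + 2 * t x) * (4 * p')) / ((4 * p) * (4 * p))) (at x)"
        using p(2) by (auto intro!: derivative_eq_intros t P(1)[folded p'_def] simp: P(2) algebra_simps)
      from DERIV_cmult[OF DERIV_diff[OF D this], of "2 / d"] show ?thesis by (simp only: p'_def)
    qed
    then show ?thesis by (simp add: P_def expo_A_def d_def)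
  qed
  moreover have "2 / d * (- B / (2 * p) * t' - (B * (2 * t') * (4 * p) - B * (B + 2 * t x) * (4 * (2 * t x * t' + B * t'))) / ((4 * p) * (4 * p)))
      = B / (2 * p\<^sup>2) * t'"
  proof -
    have de: "(B + 2 * t x)\<^sup>2 = d + 4 * p" unfolding d_def p(1) by (simp add: power2_eq_square algebra_simps)
    have "B * (B + 2 * t x) * (4 * (2 * t x * t' + B * t')) = 4 * B * t' * (B + 2 * t x)\<^sup>2"
      by (simp add: power2_eq_square algebra_simps)
    also have "\<dots> = 4 * B * t' * (d + 4 * p)" unfolding de ..
    finally have e: "B * (B + 2 * t x) * (4 * (2 * t x * t' + B * t')) = 4 * B * t' * (d + 4 * p)" .
    show ?thesis unfolding e using p(2) d0[folded d_def] 
      by (simp add: divide_simps power2_eq_square) (simp add: algebra_simps)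
  qed
  ultimately show ?thesis by simp
qed

section \<open>The square of the metric as radicand times conformal factor\<close>

text \<open>With \<open>A = c1 + 1\<close>, \<open>B = c2\<close>, \<open>v = \<langle>x, y\<rangle>\<close> and \<open>w = area x y\<close> (defined below), the metric is
  \<open>F\<^sup>2 = quad A B v w * conf A B v w\<close>.\<close>

definition quad :: "real \<Rightarrow> real \<Rightarrow> real \<Rightarrow> real \<Rightarrow> real" where
  "quad A B v w = w\<^sup>2 + B * v * w + A * v\<^sup>2"

definition conf :: "real \<Rightarrow> real \<Rightarrow> real \<Rightarrow> real \<Rightarrow> real" where
  "conf A B v w = exp (2 * expo A B (w / v))"

lemma quad_div: "v \<noteq> 0 \<Longrightarrow> (w / v)\<^sup>2 + B * (w / v) + A = quad A B v w / v\<^sup>2"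
  by (simp add: quad_def add_divide_distrib power2_eq_square)

lemma has_real_derivative_quad:
  assumes "(A has_real_derivative A') (at x)" "(B has_real_derivative B') (at x)"
    "(v has_real_derivative v') (at x)" "(w has_real_derivative w') (at x)"
  shows "((\<lambda>x. quad (A x) (B x) (v x) (w x)) has_real_derivative
    2 * w x * w' + B' * v x * w x + B x * v' * w x + B x * v x * w' + A' * (v x)\<^sup>2 + 2 * A x * v x * v') (at x)"
  unfolding quad_def using assms by (auto intro!: derivative_eq_intros simp: algebra_simps)

lemma has_real_derivative_conf:
  assumes A: "(A has_real_derivative A') (at x)" and B: "(B has_real_derivative B') (at x)"
    and v: "(v has_real_derivative v') (at x)" and w: "(w has_real_derivative w') (at x)"
    and vals: "A x = A0" "B x = B0" "v x = v0" "w x = w0"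
    and nz: "B0\<^sup>2 - 4 * A0 \<noteq> 0" "B0 \<noteq> 0" "v0 \<noteq> 0"
    and q: "quad A0 B0 v0 w0 = q" "q \<noteq> 0"
  shows "((\<lambda>x. conf (A x) (B x) (v x) (w x)) has_real_derivative
     conf A0 B0 v0 w0 *
       (- B0 * (v0 * w' - w0 * v') / q + 2 * expo_A A0 B0 (w0 / v0) * (A' - 2 * A0 * B' / B0)
        + v0 * w0 * B' / q)) (at x)"
proof -
  note q = q[folded vals] and d0 = nz(1)[folded vals] and B0 = nz(2)[folded vals] and v0 = nz(3)[folded vals]
  define p where "p = (w x / v x)\<^sup>2 + B x * (w x / v x) + A x"
  have pq: "p = q / (v x)\<^sup>2" unfolding p_def q(1)[symmetric] using v0 by (rule quad_div)
  then have p0: "p \<noteq> 0" using q v0 by simp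
  have "((\<lambda>x. w x / v x) has_real_derivative (w' * v x - w x * v') / (v x * v x)) (at x)"
    using v0 by (auto intro!: derivative_eq_intros v w)
  from has_real_derivative_expo[OF A B this d0 B0 p_def p0]
  have D: "((\<lambda>x. 2 * expo (A x) (B x) (w x / v x)) has_real_derivative
     2 * (- B x / (2 * p) * ((w' * v x - w x * v') / (v x * v x)) +
     expo_A (A x) (B x) (w x / v x) * (A' - 2 * A x * B' / B x) + w x / v x / (2 * p) * B')) (at x)"
    by (rule DERIV_cmult)
  have e1: "2 * (- B x / (2 * p) * ((w' * v x - w x * v') / (v x * v x))) = - B x * (v x * w' - w x * v') / q"
    unfolding pq using v0 q(2) by (simp add: power2_eq_square mult.commute)
  have e2: "2 * (w x / v x / (2 * p) * B') = v x * w x * B' / q"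
    unfolding pq using v0 q(2) by (simp add: power2_eq_square mult.commute)
  show ?thesis unfolding vals[symmetric] conf_def
    by (rule DERIV_cong[OF DERIV_fun_exp[OF D]]) (simp only: distrib_left e1 e2 mult.assoc)
qed

text \<open>The exponent is tuned for a cancellation: q times the logarithmic derivative of
  \<open>conf\<close> contributes - B (v w' - w v'), which removes B v w' from the derivative of
  \<open>quad\<close> and doubles B w v'. No quotient by \<open>q\<close> survives, and the
  derivative in \<open>w\<close> is just 2 w times \<open>conf\<close>.\<close>

lemma has_real_derivative_quad_conf:
  assumes A: "(A has_real_derivative A') (at x)" and B: "(B has_real_derivative B') (at x)"
    and v: "(v has_real_derivative v') (at x)" and w: "(w has_real_derivative w') (at x)"
    and vals: "A x = A0" "B x = B0" "v x = v0" "w x = w0"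
    and nz: "B0\<^sup>2 - 4 * A0 \<noteq> 0" "B0 \<noteq> 0" "v0 \<noteq> 0"
    and q: "quad A0 B0 v0 w0 = q" "q \<noteq> 0"
  shows "((\<lambda>x. quad (A x) (B x) (v x) (w x) * conf (A x) (B x) (v x) (w x)) has_real_derivative
     conf A0 B0 v0 w0 * (2 * w0 * w' + 2 * (B0 * w0 + A0 * v0) * v'
       + v0\<^sup>2 * A' + 2 * v0 * w0 * B'
       + 2 * q * expo_A A0 B0 (w0 / v0) * (A' - 2 * A0 * B' / B0))) (at x)"
proof -
  define e where "e = 2 * expo_A A0 B0 (w0 / v0) * (A' - 2 * A0 * B' / B0)"
  define m where "m = conf A0 B0 v0 w0"
  have "(2 * w0 * w' + B' * v0 * w0 + B0 * v' * w0 + B0 * v0 * w' + A' * v0\<^sup>2 + 2 * A0 * v0 * v') * m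
      + (m * (- B0 * (v0 * w' - w0 * v') / q + e + v0 * w0 * B' / q)) * q
    = m * (2 * w0 * w' + 2 * (B0 * w0 + A0 * v0) * v' + v0\<^sup>2 * A' + 2 * v0 * w0 * B' + q * e)"
    using q(2) by (simp add: algebra_simps diff_divide_distrib add_divide_distrib)
  then show ?thesis
    using DERIV_mult[OF has_real_derivative_quad[OF A B v w] has_real_derivative_conf[OF assms]]
    unfolding vals q(1) e_def[symmetric] m_def[symmetric]
    by (simp only: e_def mult_ac) 
qed

section \<open>Partial derivatives along coordinate lines\<close>

lemma partial_deriv_eqI:
  assumes "((\<lambda>t. f (z + t *\<^sub>R axis i 1)) has_real_derivative c) (at 0)"
  shows "partial_deriv i f z = c"
  unfolding partial_deriv_def using assms by (rule DERIV_imp_deriv)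

lemma open_line_eventually:
  fixes z :: "'a::real_normed_vector"
  assumes "open S" "z \<in> S"
  shows "\<forall>\<^sub>F t in nhds 0. z + t *\<^sub>R d \<in> S"
proof -
  have "((\<lambda>t. z + t *\<^sub>R d) \<longlongrightarrow> z + 0 *\<^sub>R d) (nhds 0)"
    by (intro tendsto_intros filterlim_ident)
  then show ?thesis using assms by (auto simp: tendsto_def)
qed

text \<open>In a nested partial derivative the inner one is known in closed form only on the domain
  of \<open>F\<close>. As that domain is open in each argument, the formula may be substituted
  before differentiating again.\<close>

lemma partial_deriv_eqI_open:
  assumes "open S" "z \<in> S" "\<And>z. z \<in> S \<Longrightarrow> f z = g z"
    and g: "((\<lambda>t. g (z + t *\<^sub>R axis i 1)) has_real_derivative c) (at 0)"
  shows "partial_deriv i f z = c"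
proof (rule partial_deriv_eqI)
  have "\<forall>\<^sub>F t in nhds 0. f (z + t *\<^sub>R axis i 1) = g (z + t *\<^sub>R axis i 1)"
    using open_line_eventually[OF assms(1,2)] by eventually_elim (rule assms(3))
  then show "((\<lambda>t. f (z + t *\<^sub>R axis i 1)) has_real_derivative c) (at 0)"
    using g by (subst DERIV_cong_ev) auto
qed

text \<open>The area of the parallelogram spanned by \<open>x\<close> and \<open>y\<close>, that is \<open>|y| sqrt (r\<^sup>2 - s\<^sup>2)\<close>.\<close>

definition area :: "'a::real_inner \<Rightarrow> 'a \<Rightarrow> real" where
  "area x y = sqrt ((x \<bullet> x) * (y \<bullet> y) - (x \<bullet> y)\<^sup>2)"

lemma area_commute: "area x y = area y x"
  by (simp add: area_def inner_commute mult.commute)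

lemma area_sq: "(area x y)\<^sup>2 = (x \<bullet> x) * (y \<bullet> y) - (x \<bullet> y)\<^sup>2"
proof -
  have "(x \<bullet> y)\<^sup>2 \<le> (x \<bullet> x) * (y \<bullet> y)" by (rule Cauchy_Schwarz_ineq)
  then show ?thesis by (simp add: area_def)
qed

lemma inner_line: "((\<lambda>t. x \<bullet> (y + t *\<^sub>R d)) has_real_derivative x \<bullet> d) (at 0)"
  by (auto intro!: derivative_eq_intros simp: inner_add_right)

lemma inner_line': "((\<lambda>t. (x + t *\<^sub>R d) \<bullet> y) has_real_derivative y \<bullet> d) (at 0)"
  unfolding inner_commute[of _ y] by (rule inner_line)

lemma inner_self_line: "((\<lambda>t. (y + t *\<^sub>R d) \<bullet> (y + t *\<^sub>R d)) has_real_derivative 2 * (y \<bullet> d)) (at 0)"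
proof -
  have e: "(\<lambda>t. (y + t *\<^sub>R d) \<bullet> (y + t *\<^sub>R d)) = (\<lambda>t. y \<bullet> y + 2 * t * (y \<bullet> d) + t * t * (d \<bullet> d))"
    by (auto simp: inner_add_left inner_add_right inner_commute algebra_simps)
  show ?thesis unfolding e by (auto intro!: derivative_eq_intros)
qed

lemma area_line:
  assumes "area x y > 0"
  shows "((\<lambda>t. area x (y + t *\<^sub>R d)) has_real_derivative ((x \<bullet> x) *\<^sub>R y - (x \<bullet> y) *\<^sub>R x) \<bullet> d / area x y) (at 0)"
proof -
  have pos: "(x \<bullet> x) * (y \<bullet> y) - (x \<bullet> y)\<^sup>2 > 0" using assms by (simp add: area_def)
  have "((\<lambda>t. (x \<bullet> x) * ((y + t *\<^sub>R d) \<bullet> (y + t *\<^sub>R d)) - (x \<bullet> (y + t *\<^sub>R d))\<^sup>2) has_real_derivative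
     (x \<bullet> x) * (2 * (y \<bullet> d)) - 2 * (x \<bullet> y) * (x \<bullet> d)) (at 0)"
    by (rule derivative_eq_intros inner_self_line inner_line refl)+ simp
  from DERIV_chain2[OF DERIV_real_sqrt this] pos
  have "((\<lambda>t. area x (y + t *\<^sub>R d)) has_real_derivative
     inverse (area x y) / 2 * ((x \<bullet> x) * (2 * (y \<bullet> d)) - 2 * (x \<bullet> y) * (x \<bullet> d))) (at 0)"
    unfolding area_def by simp
  moreover have "(x \<bullet> x) * (2 * (y \<bullet> d)) - 2 * (x \<bullet> y) * (x \<bullet> d) = 2 * (((x \<bullet> x) *\<^sub>R y - (x \<bullet> y) *\<^sub>R x) \<bullet> d)"
    by (simp add: inner_diff_left)
  moreover have "inverse a / 2 * (2 * c) = c / a" for a c :: real by (simp add: inverse_eq_divide)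
  ultimately show ?thesis by (simp only:)
qed

lemma area_line':
  assumes "area x y > 0"
  shows "((\<lambda>t. area (x + t *\<^sub>R d) y) has_real_derivative ((y \<bullet> y) *\<^sub>R x - (x \<bullet> y) *\<^sub>R y) \<bullet> d / area x y) (at 0)"
  using area_line[of y x d] assms by (simp add: area_commute[of _ y] inner_commute)

lemma norm_line:
  assumes "x \<noteq> 0"
  shows "((\<lambda>t. norm (x + t *\<^sub>R d)) has_real_derivative x \<bullet> d / norm x) (at 0)"
proof -
  have "((\<lambda>t. sqrt ((x + t *\<^sub>R d) \<bullet> (x + t *\<^sub>R d))) has_real_derivative
     inverse (norm x) / 2 * (2 * (x \<bullet> d))) (at 0)"
    using DERIV_chain2[OF DERIV_real_sqrt inner_self_line, of x d] assms by (simp add: norm_eq_sqrt_inner)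
  then show ?thesis unfolding norm_eq_sqrt_inner by (rule DERIV_cong) (simp add: inverse_eq_divide)
qed

section \<open>First derivatives of the metric in y and in x\<close>

locale spherical =
  fixes J :: "real set" and A B A' B' :: "real \<Rightarrow> real"
  assumes open_J: "open J" and J_pos: "J \<subseteq> {0<..}"
    and A_deriv: "r \<in> J \<Longrightarrow> (A has_real_derivative A' r) (at r)"
    and B_deriv: "r \<in> J \<Longrightarrow> (B has_real_derivative B' r) (at r)"
    and A_nz: "r \<in> J \<Longrightarrow> A r \<noteq> 0" and B_nz: "r \<in> J \<Longrightarrow> B r \<noteq> 0"
    and disc_nz: "r \<in> J \<Longrightarrow> (B r)\<^sup>2 - 4 * A r \<noteq> 0"
begin

text \<open>On the domain \<open>F\<^sup>2 = qq * mm\<close>, and \<open>2 mm x y *\<^sub>R ll x y\<close> is its gradient in \<open>y\<close>. The parameters \<open>A\<close> and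
  \<open>B\<close> stand for \<open>c1 + 1\<close> and \<open>c2\<close>.\<close>

definition qq :: "'a::euclidean_space \<Rightarrow> 'a \<Rightarrow> real" where
  "qq x y = quad (A (norm x)) (B (norm x)) (x \<bullet> y) (area x y)"

definition mm :: "'a::euclidean_space \<Rightarrow> 'a \<Rightarrow> real" where
  "mm x y = conf (A (norm x)) (B (norm x)) (x \<bullet> y) (area x y)"

definition kk :: "'a::euclidean_space \<Rightarrow> 'a \<Rightarrow> real" where
  "kk x y = B (norm x) * area x y + (A (norm x) - 1) * (x \<bullet> y)"

definition ll :: "'a::euclidean_space \<Rightarrow> 'a \<Rightarrow> 'a" where
  "ll x y = (x \<bullet> x) *\<^sub>R y + kk x y *\<^sub>R x"

definition ss :: "'a::euclidean_space \<Rightarrow> 'a \<Rightarrow> real" where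
  "ss x y = expo_A (A (norm x)) (B (norm x)) (area x y / (x \<bullet> y))"

text \<open>\<open>defect\<close> is \<open>B\<^sup>2\<close> times the derivative of \<open>A / B\<^sup>2\<close>.\<close>

definition defect :: "real \<Rightarrow> real" where
  "defect r = A' r - 2 * A r * B' r / B r"

text \<open>The conditions avoid division by \<open>norm y\<close>. \<open>area x y > 0\<close> is
  linear independence of \<open>x\<close> and \<open>y\<close> and thus excludes zero
  vectors.\<close>

definition dom :: "('a::euclidean_space \<times> 'a) set" where
  "dom = {(x, y). norm x \<in> J \<and> x \<bullet> y \<noteq> 0 \<and> area x y > 0 \<and> qq x y > 0}"

lemma domD:
  assumes "(x, y) \<in> dom"
  shows "norm x \<in> J" "x \<bullet> y \<noteq> 0" "area x y > 0" "qq x y > 0" "x \<noteq> 0" "y \<noteq> 0" "norm x > 0"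
    "A (norm x) \<noteq> 0" "B (norm x) \<noteq> 0" "mm x y > 0" 
  using assms J_pos A_nz B_nz by (auto simp: dom_def mm_def conf_def)

text \<open>Openness is needed slice by slice, in \<open>y\<close> and in \<open>x\<close>, because
  every partial derivative moves only one of the two arguments.\<close>

lemma open_dom_y: "open {y. (x, y) \<in> dom}"
proof (cases "norm x \<in> J")
  case True
  then have "{y. (x, y) \<in> dom} = {y. x \<bullet> y \<noteq> 0 \<and> area x y > 0 \<and> qq x y > 0}" by (simp add: dom_def)
  then show ?thesis unfolding qq_def quad_def area_def
    by (simp only:) (intro open_Collect_conj open_Collect_neq open_Collect_less continuous_intros)
qed (simp add: dom_def)

lemma open_dom_x: "open {x. (x, y) \<in> dom}"
proof -
  have A: "continuous_on J A" and B: "continuous_on J B"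
    using A_deriv B_deriv by (meson DERIV_isCont continuous_at_imp_continuous_on)+
  have T: "open {x::'a. norm x \<in> J}" 
    using open_vimage[OF open_J, of norm] by (simp add: vimage_def continuous_on_norm_id)
  have "continuous_on {x. norm x \<in> J} (\<lambda>x. qq x y)"
    unfolding qq_def quad_def area_def
    by (auto intro!: continuous_intros continuous_on_compose2[OF A] continuous_on_compose2[OF B])
  then have "open ((\<lambda>x. qq x y) -` {0<..} \<inter> {x. norm x \<in> J})"
    using T by (simp add: continuous_on_open_vimage)
  moreover have "open {x. x \<bullet> y \<noteq> 0 \<and> area x y > 0}" unfolding area_def
    by (intro open_Collect_conj open_Collect_neq open_Collect_less continuous_intros)
  ultimately have "open (((\<lambda>x. qq x y) -` {0<..} \<inter> {x. norm x \<in> J}) \<inter> {x. x \<bullet> y \<noteq> 0 \<and> area x y > 0})"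
    by (rule open_Int)
  moreover have "((\<lambda>x. qq x y) -` {0<..} \<inter> {x. norm x \<in> J}) \<inter> {x. x \<bullet> y \<noteq> 0 \<and> area x y > 0} = {x. (x, y) \<in> dom}"
    by (auto simp: dom_def)
  ultimately show ?thesis by simp
qed

lemma q_eq: "qq x y = (area x y)\<^sup>2 + B (norm x) * (x \<bullet> y) * area x y + A (norm x) * (x \<bullet> y)\<^sup>2"
  by (simp add: qq_def quad_def)

text \<open>\<open>mm\<close> is homogeneous of degree 0 in \<open>y\<close>, so its gradient is
  orthogonal to \<open>y\<close>. The gradient also lies in the span of \<open>x\<close> and
  \<open>y\<close>, which leaves only multiples of (x . y) y - |y|^2 x.\<close>

lemma mm_line_y:
  assumes "(x, y) \<in> dom"
  shows "((\<lambda>t. mm x (y + t *\<^sub>R d)) has_real_derivative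
    mm x y * (- (B (norm x) * (x \<bullet> x) / (area x y * qq x y)) * ((x \<bullet> y) * (y \<bullet> d) - (y \<bullet> y) * (x \<bullet> d)))) (at 0)"
proof -
  note D = domD[OF assms]
  let ?w' = "((x \<bullet> x) *\<^sub>R y - (x \<bullet> y) *\<^sub>R x) \<bullet> d / area x y"
  have raw: "((\<lambda>t. mm x (y + t *\<^sub>R d)) has_real_derivative
    mm x y * (- B (norm x) * ((x \<bullet> y) * ?w' - area x y * (x \<bullet> d)) / qq x y
     + 2 * ss x y * (0 - 2 * A (norm x) * 0 / B (norm x)) + (x \<bullet> y) * area x y * 0 / qq x y)) (at 0)"
    unfolding mm_def ss_def
    by (rule has_real_derivative_conf[OF DERIV_const DERIV_const inner_line area_line[OF D(3)]])
      (use D disc_nz in \<open>auto simp: qq_def[symmetric]\<close>)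
  have "(x \<bullet> y) * ?w' - area x y * (x \<bullet> d) = (x \<bullet> x) / area x y * ((x \<bullet> y) * (y \<bullet> d) - (y \<bullet> y) * (x \<bullet> d))"
  proof -
    have "area x y * area x y = (x \<bullet> x) * (y \<bullet> y) - (x \<bullet> y) * (x \<bullet> y)"
      using area_sq[of x y] by (simp add: power2_eq_square)
    then have "(x \<bullet> y) * (((x \<bullet> x) *\<^sub>R y - (x \<bullet> y) *\<^sub>R x) \<bullet> d) - (area x y * area x y) * (x \<bullet> d)
      = (x \<bullet> x) * ((x \<bullet> y) * (y \<bullet> d) - (y \<bullet> y) * (x \<bullet> d))"
      unfolding inner_diff_left inner_scaleR_left by algebra
    moreover have "c * (e / a) - a * f = (c * e - (a * a) * f) / a" if "a \<noteq> 0" for a c e f :: real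
      using that by (simp add: diff_divide_distrib)
    ultimately show ?thesis using D(3) by simp
  qed
  note eq = this
  have "- b * (k / w * e) / q + 2 * s * (0 - 2 * a * 0 / b) + vw * 0 / q = - (b * k / (w * q)) * e"
    for b k w e q s a vw :: real by simp
  from raw[unfolded eq this] show ?thesis .
qed

lemma quad_conf_line_y:
  assumes "(x, y) \<in> dom"
  shows "((\<lambda>t. qq x (y + t *\<^sub>R d) * mm x (y + t *\<^sub>R d)) has_real_derivative 2 * mm x y * (ll x y \<bullet> d)) (at 0)"
proof -
  note D = domD[OF assms]
  let ?w' = "((x \<bullet> x) *\<^sub>R y - (x \<bullet> y) *\<^sub>R x) \<bullet> d / area x y"
  have raw: "((\<lambda>t. qq x (y + t *\<^sub>R d) * mm x (y + t *\<^sub>R d)) has_real_derivative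
    mm x y * (2 * area x y * ?w' + 2 * (B (norm x) * area x y + A (norm x) * (x \<bullet> y)) * (x \<bullet> d)
       + (x \<bullet> y)\<^sup>2 * 0 + 2 * (x \<bullet> y) * area x y * 0
       + 2 * qq x y * ss x y * (0 - 2 * A (norm x) * 0 / B (norm x)))) (at 0)"
    unfolding mm_def ss_def qq_def[of x "y + _ *\<^sub>R d"]
    by (rule has_real_derivative_quad_conf[OF DERIV_const DERIV_const inner_line area_line[OF D(3)]])
      (use D disc_nz in \<open>auto simp: qq_def[symmetric]\<close>)
  have "2 * area x y * ?w' = 2 * (((x \<bullet> x) *\<^sub>R y - (x \<bullet> y) *\<^sub>R x) \<bullet> d)"
    using D(3) by simp
  from raw[unfolded this] show ?thesis
    by (rule DERIV_cong) (simp add: ll_def kk_def inner_diff_left inner_add_left algebra_simps)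
qed

lemma ll_line_y:
  assumes "(x, y) \<in> dom"
  shows "((\<lambda>t. ll x (y + t *\<^sub>R d) \<bullet> e) has_real_derivative
    (x \<bullet> x) * (d \<bullet> e) + (B (norm x) * (((x \<bullet> x) *\<^sub>R y - (x \<bullet> y) *\<^sub>R x) \<bullet> d) / area x y
      + (A (norm x) - 1) * (x \<bullet> d)) * (x \<bullet> e)) (at 0)"
proof -
  note D = domD[OF assms]
  show ?thesis unfolding ll_def kk_def inner_add_left inner_scaleR_left
    by (rule derivative_eq_intros inner_line area_line[OF D(3)] refl)+ (simp add: algebra_simps)
qed

lemma A_line:
  assumes "(x, y) \<in> dom"
  shows "((\<lambda>t. A (norm (x + t *\<^sub>R d))) has_real_derivative A' (norm x) * (x \<bullet> d / norm x)) (at 0)"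
  by (rule DERIV_chain2[OF _ norm_line[OF domD(5)[OF assms]]]) (use A_deriv domD(1)[OF assms] in simp)

lemma B_line:
  assumes "(x, y) \<in> dom"
  shows "((\<lambda>t. B (norm (x + t *\<^sub>R d))) has_real_derivative B' (norm x) * (x \<bullet> d / norm x)) (at 0)"
  by (rule DERIV_chain2[OF _ norm_line[OF domD(5)[OF assms]]]) (use B_deriv domD(1)[OF assms] in simp)

lemma defect_line:
  assumes "(x, y) \<in> dom"
  shows "A' (norm x) * (x \<bullet> d / norm x) - 2 * A (norm x) * (B' (norm x) * (x \<bullet> d / norm x)) / B (norm x)
     = defect (norm x) / norm x * (x \<bullet> d)"
  using domD(9)[OF assms] by (simp add: defect_def divide_simps) (simp add: algebra_simps)

lemma mm_line_x:
  assumes "(x, y) \<in> dom"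
  shows "((\<lambda>t. mm (x + t *\<^sub>R d) y) has_real_derivative
    mm x y * ((- B (norm x) * (x \<bullet> y) * (y \<bullet> y) / (area x y * qq x y)
        + (2 * ss x y * defect (norm x) + B' (norm x) * (x \<bullet> y) * area x y / qq x y) / norm x) * (x \<bullet> d)
      + B (norm x) * (x \<bullet> x) * (y \<bullet> y) / (area x y * qq x y) * (y \<bullet> d))) (at 0)"
proof -
  note D = domD[OF assms]
  note Ad = A_line[OF assms] and Bd = B_line[OF assms]
  have w2: "area x y * area x y = (x \<bullet> x) * (y \<bullet> y) - (x \<bullet> y) * (x \<bullet> y)"
    using area_sq[of x y] by (simp add: power2_eq_square)
  have 1: "- B (norm x) * ((x \<bullet> y) * (((y \<bullet> y) *\<^sub>R x - (x \<bullet> y) *\<^sub>R y) \<bullet> d / area x y) - area x y * (y \<bullet> d)) / qq x y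
    = - B (norm x) * (x \<bullet> y) * (y \<bullet> y) / (area x y * qq x y) * (x \<bullet> d) + B (norm x) * (x \<bullet> x) * (y \<bullet> y) / (area x y * qq x y) * (y \<bullet> d)"
  proof -
    have r: "(x \<bullet> x) * (y \<bullet> y) = area x y * area x y + (x \<bullet> y) * (x \<bullet> y)" using w2 by simp
    show ?thesis unfolding mult.assoc[of _ "x \<bullet> x"] r using D(3,4)
      by (simp add: inner_diff_left divide_simps) (simp add: algebra_simps)
  qed
  note 2 = defect_line[OF assms]
  have raw: "((\<lambda>t. mm (x + t *\<^sub>R d) y) has_real_derivative
    mm x y * (- B (norm x) * ((x \<bullet> y) * (((y \<bullet> y) *\<^sub>R x - (x \<bullet> y) *\<^sub>R y) \<bullet> d / area x y) - area x y * (y \<bullet> d)) / qq x y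
     + 2 * ss x y * (A' (norm x) * (x \<bullet> d / norm x) - 2 * A (norm x) * (B' (norm x) * (x \<bullet> d / norm x)) / B (norm x))
     + (x \<bullet> y) * area x y * (B' (norm x) * (x \<bullet> d / norm x)) / qq x y)) (at 0)"
    unfolding mm_def ss_def
    by (rule has_real_derivative_conf[OF Ad Bd inner_line' area_line'[OF D(3)]])
      (use D disc_nz in \<open>auto simp: qq_def[symmetric]\<close>)
  have "a * X + b * Y + 2 * s * (e / r * X) + v * w * (B' * (X / r)) / q = (a + (2 * s * e + B' * v * w / q) / r) * X + b * Y"
    for a X b Y s e r v w B' q :: real
    by (simp add: algebra_simps add_divide_distrib)
  from raw[unfolded 1 2 this] show ?thesis .
qed

lemma quad_conf_line_x:
  assumes "(x, y) \<in> dom"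
  shows "((\<lambda>t. qq (x + t *\<^sub>R d) y * mm (x + t *\<^sub>R d) y) has_real_derivative
    mm x y * (2 * (y \<bullet> y) * (x \<bullet> d) + 2 * kk x y * (y \<bullet> d)
      + ((x \<bullet> y)\<^sup>2 * A' (norm x) + 2 * (x \<bullet> y) * area x y * B' (norm x)
         + 2 * qq x y * ss x y * defect (norm x)) / norm x * (x \<bullet> d))) (at 0)"
proof -
  note D = domD[OF assms]
  note Ad = A_line[OF assms] and Bd = B_line[OF assms]
  note 2 = defect_line[OF assms]
  have raw: "((\<lambda>t. qq (x + t *\<^sub>R d) y * mm (x + t *\<^sub>R d) y) has_real_derivative
    mm x y * (2 * area x y * (((y \<bullet> y) *\<^sub>R x - (x \<bullet> y) *\<^sub>R y) \<bullet> d / area x y)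
       + 2 * (B (norm x) * area x y + A (norm x) * (x \<bullet> y)) * (y \<bullet> d)
       + (x \<bullet> y)\<^sup>2 * (A' (norm x) * (x \<bullet> d / norm x)) + 2 * (x \<bullet> y) * area x y * (B' (norm x) * (x \<bullet> d / norm x))
       + 2 * qq x y * ss x y * (A' (norm x) * (x \<bullet> d / norm x) - 2 * A (norm x) * (B' (norm x) * (x \<bullet> d / norm x)) / B (norm x)))) (at 0)"
    unfolding mm_def ss_def qq_def[of "x + _ *\<^sub>R d" y]
    by (rule has_real_derivative_quad_conf[OF Ad Bd inner_line' area_line'[OF D(3)]])
      (use D disc_nz in \<open>auto simp: qq_def[symmetric]\<close>)
  have 3: "2 * area x y * (((y \<bullet> y) *\<^sub>R x - (x \<bullet> y) *\<^sub>R y) \<bullet> d / area x y) = 2 * (((y \<bullet> y) *\<^sub>R x - (x \<bullet> y) *\<^sub>R y) \<bullet> d)"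
    using D(3) by simp
  from raw[unfolded 2 3] show ?thesis
    by (rule DERIV_cong) (simp add: kk_def inner_diff_left algebra_simps add_divide_distrib)
qed

lemma ll_line_x:
  assumes "(x, y) \<in> dom"
  shows "((\<lambda>t. ll (x + t *\<^sub>R d) y \<bullet> e) has_real_derivative
    2 * (x \<bullet> d) * (y \<bullet> e)
    + (((B' (norm x) * area x y + A' (norm x) * (x \<bullet> y)) / norm x + B (norm x) * (y \<bullet> y) / area x y) * (x \<bullet> d)
       + (A (norm x) - 1 - B (norm x) * (x \<bullet> y) / area x y) * (y \<bullet> d)) * (x \<bullet> e)
    + kk x y * (e \<bullet> d)) (at 0)"
proof -
  note D = domD[OF assms]
  note Ad = A_line[OF assms] and Bd = B_line[OF assms]
  show ?thesis unfolding ll_def kk_def inner_add_left[of "_ *\<^sub>R _"] inner_scaleR_left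
    by (rule derivative_eq_intros Ad Bd inner_self_line inner_line' area_line'[OF D(3)] refl)+
      (simp add: inner_diff_left algebra_simps add_divide_distrib diff_divide_distrib)
qed

end

section \<open>The metric tensor and its action on the span of x and y\<close>

locale spherical_metric = spherical J A B A' B'
  for J :: "real set" and A B A' B' :: "real \<Rightarrow> real" +
  fixes F :: "real^'n \<Rightarrow> real^'n \<Rightarrow> real"
  assumes F_eq: "(x, y) \<in> dom \<Longrightarrow> F x y = sqrt (qq x y * mm x y)"
begin

lemma F_sq: "(x, y) \<in> dom \<Longrightarrow> (F x y)\<^sup>2 = qq x y * mm x y"
  using F_eq[of x y] domD(4,10)[of x y] by (simp add: order_less_imp_le)

lemma F_pos: "(x, y) \<in> dom \<Longrightarrow> F x y > 0"
  using F_eq[of x y] domD(4,10)[of x y] by simp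

lemma partial_F_sq:
  assumes "(x, y) \<in> dom"
  shows "partial_deriv j (\<lambda>y. (F x y)\<^sup>2) y = 2 * mm x y * (ll x y $ j)"
  by (rule partial_deriv_eqI_open[OF open_dom_y, of _ x _ "\<lambda>y. qq x y * mm x y"])
    (use assms quad_conf_line_y[OF assms, of "axis j 1"] in \<open>auto simp: F_sq inner_axis\<close>)

lemma partial_F:
  assumes "(x, y) \<in> dom"
  shows "partial_deriv j (F x) y = mm x y * (ll x y $ j) / F x y"
proof (rule partial_deriv_eqI_open[OF open_dom_y, of _ x _ "\<lambda>y. sqrt (qq x y * mm x y)"])
  have pos: "qq x y * mm x y > 0" using domD(4,10)[OF assms] by simp
  have "((\<lambda>t. sqrt (qq x (y + t *\<^sub>R axis j 1) * mm x (y + t *\<^sub>R axis j 1))) has_real_derivative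
      inverse (sqrt (qq x y * mm x y)) / 2 * (2 * mm x y * (ll x y \<bullet> axis j 1))) (at 0)"
    using DERIV_chain2[OF DERIV_real_sqrt quad_conf_line_y[OF assms, of "axis j 1"]] pos by simp
  then show "((\<lambda>t. sqrt (qq x (y + t *\<^sub>R axis j 1) * mm x (y + t *\<^sub>R axis j 1))) has_real_derivative
      mm x y * (ll x y $ j) / F x y) (at 0)"
    by (rule DERIV_cong) (simp add: F_eq[OF assms] inner_axis inverse_eq_divide)
qed (use assms in \<open>auto simp: F_eq\<close>)

lemma metric_tensor_nth:
  assumes "(x, y) \<in> dom"
  shows "metric_tensor F x y $ i $ j = mm x y * ((x \<bullet> x) * (axis i 1 $ j)
     + (B (norm x) / area x y * (((x \<bullet> x) *\<^sub>R y - (x \<bullet> y) *\<^sub>R x) $ i) + (A (norm x) - 1) * x $ i) * x $ j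
     - B (norm x) * (x \<bullet> x) / (area x y * qq x y) * (((x \<bullet> y) *\<^sub>R y - (y \<bullet> y) *\<^sub>R x) $ i) * ll x y $ j)"
proof -
  have "partial_deriv i (\<lambda>y'. partial_deriv j (\<lambda>y''. (F x y'')\<^sup>2) y') y
    = 2 * ((mm x y * (- (B (norm x) * (x \<bullet> x) / (area x y * qq x y)) * ((x \<bullet> y) * (y \<bullet> axis i 1) - (y \<bullet> y) * (x \<bullet> axis i 1)))) * (ll x y \<bullet> axis j 1)
       + ((x \<bullet> x) * (axis i (1::real) \<bullet> axis j 1) + (B (norm x) * (((x \<bullet> x) *\<^sub>R y - (x \<bullet> y) *\<^sub>R x) \<bullet> axis i 1) / area x y
      + (A (norm x) - 1) * (x \<bullet> axis i 1)) * (x \<bullet> axis j 1)) * mm x y)"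
  proof (rule partial_deriv_eqI_open[OF open_dom_y, of _ x _ "\<lambda>y. 2 * (mm x y * (ll x y \<bullet> axis j 1))"])
    from DERIV_cmult[OF DERIV_mult[OF mm_line_y[OF assms, of "axis i 1"] ll_line_y[OF assms, of "axis i 1" "axis j 1"]], of 2]
    show "((\<lambda>t. 2 * (mm x (y + t *\<^sub>R axis i 1) * (ll x (y + t *\<^sub>R axis i 1) \<bullet> axis j 1))) has_real_derivative
      2 * ((mm x y * (- (B (norm x) * (x \<bullet> x) / (area x y * qq x y)) * ((x \<bullet> y) * (y \<bullet> axis i 1) - (y \<bullet> y) * (x \<bullet> axis i 1)))) * (ll x y \<bullet> axis j 1)
       + ((x \<bullet> x) * (axis i (1::real) \<bullet> axis j 1) + (B (norm x) * (((x \<bullet> x) *\<^sub>R y - (x \<bullet> y) *\<^sub>R x) \<bullet> axis i 1) / area x y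
      + (A (norm x) - 1) * (x \<bullet> axis i 1)) * (x \<bullet> axis j 1)) * mm x y)) (at 0)"
      by (simp only: scaleR_zero_left add_0_right)
  qed (use assms in \<open>auto simp: partial_F_sq inner_axis\<close>)
  then show ?thesis by (simp only: metric_tensor_def vec_lambda_beta) (simp add: inner_axis algebra_simps diff_divide_distrib)
qed

text \<open>Up to the factor \<open>mm x y\<close>, this is \<open>x \<bullet> x\<close> times the
  identity plus an operator with range in the span of \<open>x\<close> and \<open>y\<close>. Hence a
  kernel vector lies in that span, and the images of \<open>x\<close> and \<open>y\<close> settle
  invertibility.\<close>

lemma metric_tensor_mult:
  assumes "(x, y) \<in> dom"
  shows "metric_tensor F x y *v z = mm x y *\<^sub>R ((x \<bullet> x) *\<^sub>R z
     + (x \<bullet> z) *\<^sub>R ((B (norm x) / area x y) *\<^sub>R ((x \<bullet> x) *\<^sub>R y - (x \<bullet> y) *\<^sub>R x) + (A (norm x) - 1) *\<^sub>R x)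
     - (B (norm x) * (x \<bullet> x) / (area x y * qq x y) * (ll x y \<bullet> z)) *\<^sub>R ((x \<bullet> y) *\<^sub>R y - (y \<bullet> y) *\<^sub>R x))"
  (is "?L = ?R")
proof (rule vec_eq_iff[THEN iffD2, rule_format])
  fix i
  define a where "a = B (norm x) / area x y * (((x \<bullet> x) *\<^sub>R y - (x \<bullet> y) *\<^sub>R x) $ i) + (A (norm x) - 1) * x $ i"
  define b where "b = B (norm x) * (x \<bullet> x) / (area x y * qq x y) * (((x \<bullet> y) *\<^sub>R y - (y \<bullet> y) *\<^sub>R x) $ i)"
  have "?L $ i = (\<Sum>j\<in>UNIV. mm x y * ((x \<bullet> x) * (axis i 1 $ j * z $ j) + a * (x $ j * z $ j) - b * (ll x y $ j * z $ j)))"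
  proof -
    have "metric_tensor F x y $ i $ j = mm x y * ((x \<bullet> x) * axis i 1 $ j + a * x $ j - b * ll x y $ j)" for j
      unfolding metric_tensor_nth[OF assms] a_def b_def ..
    then show ?thesis by (simp add: matrix_vector_mult_def del: vec_lambda_eta) (simp add: algebra_simps)
  qed
  also have "\<dots> = mm x y * ((x \<bullet> x) * (axis i 1 \<bullet> z) + a * (x \<bullet> z) - b * (ll x y \<bullet> z))"
    by (simp add: sum_distrib_left sum.distrib sum_subtractf inner_vec_def algebra_simps)
  also have "\<dots> = ?R $ i"
    by (simp add: inner_axis' a_def b_def mult_ac)
  finally show "?L $ i = ?R $ i" .
qed

text \<open>Euler's identity for F^2, which is homogeneous of degree 2 in \<open>y\<close>, with the
  common factor \<open>mm x y\<close> removed.\<close>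

lemma inner_ll_y: "ll x y \<bullet> y = qq x y"
  using area_sq[of x y] by (simp add: ll_def kk_def q_eq inner_add_left algebra_simps power2_eq_square)

lemma inner_ll_x: "ll x y \<bullet> x = (x \<bullet> x) * (B (norm x) * area x y + A (norm x) * (x \<bullet> y))"
  by (simp add: ll_def kk_def inner_add_left inner_commute algebra_simps)

lemma metric_tensor_mult_y:
  assumes "(x, y) \<in> dom"
  shows "metric_tensor F x y *v y = mm x y *\<^sub>R ll x y"
proof -
  note D = domD[OF assms]
  define w where "w = area x y"
  have w: "w > 0" using D(3) by (simp add: w_def)
  have w2: "(x \<bullet> x) * (y \<bullet> y) = w * w + (x \<bullet> y) * (x \<bullet> y)" using area_sq[of x y] by (simp add: w_def power2_eq_square)
  have e: "(x \<bullet> x) * yi + v * (b / w * ((x \<bullet> x) * yi - v * xi) + a * xi) - b * (x \<bullet> x) / w * (v * yi - U * xi)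
    = (x \<bullet> x) * yi + (b * w + a * v) * xi" if "(x \<bullet> x) * U = w * w + v * v" for yi xi v b a U
  proof -
    have "v * (b / w * ((x \<bullet> x) * yi - v * xi)) - b * (x \<bullet> x) / w * (v * yi - U * xi) = b * xi / w * ((x \<bullet> x) * U - v * v)"
      using w by (simp add: divide_simps) (simp add: algebra_simps)
    also have "\<dots> = b * w * xi" unfolding that using w by simp
    finally show ?thesis by (simp add: algebra_simps)
  qed
  have "B (norm x) * (x \<bullet> x) / (area x y * qq x y) * qq x y = B (norm x) * (x \<bullet> x) / w"
    using D(3,4) by (simp add: w_def)
  then show ?thesis unfolding metric_tensor_mult[OF assms] inner_ll_y
    using e[OF w2] by (simp add: vec_eq_iff ll_def kk_def w_def)
qed

text \<open>Expressing the image through \<open>ll\<close>, the direction of the image of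
  \<open>y\<close>, makes the action on the span of \<open>x\<close> and \<open>y\<close>
  triangular. The remaining coefficient \<open>(x \<bullet> x) * A (norm x)\<close> is nonzero
  because \<open>A\<close> has no zeros.\<close>

lemma metric_tensor_mult_x:
  assumes "(x, y) \<in> dom"
  shows "metric_tensor F x y *v x = mm x y *\<^sub>R (((x \<bullet> x) * A (norm x)) *\<^sub>R x
     + (B (norm x) * (x \<bullet> x) * area x y / qq x y) *\<^sub>R ll x y)"
proof -
  note D = domD[OF assms]
  define w where "w = area x y"
  define r where "r = x \<bullet> x"
  define v where "v = x \<bullet> y"
  define U where "U = y \<bullet> y"
  define q where "q = qq x y"
  define a where "a = A (norm x)"
  define b where "b = B (norm x)"
  have w: "w > 0" "q > 0" using D(3,4) by (simp_all add: w_def q_def)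
  have w2: "r * U = w * w + v * v" using area_sq[of x y] by (simp add: w_def r_def U_def v_def power2_eq_square)
  have q: "q = w * w + b * v * w + a * v * v" unfolding q_def q_eq by (simp add: w_def a_def b_def v_def power2_eq_square)
  have e: "r * xi + r * (b / w * (r * yi - v * xi) + (a - 1) * xi) - b * r / (w * q) * (r * (b * w + a * v)) * (v * yi - U * xi)
    = r * a * xi + b * r * w / q * (r * yi + (b * w + (a - 1) * v) * xi)" for xi yi
  proof -
    have "b / w * (r * yi - v * xi) - b / (w * q) * (r * (b * w + a * v)) * (v * yi - U * xi)
        = b / (w * q) * (q * (r * yi - v * xi) - r * (b * w + a * v) * (v * yi - U * xi))"
      using w by (simp add: right_diff_distrib)
    \<comment> \<open>After r U is replaced by w^2 + v^2, everything carries the factor w^2, which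
      cancels the denominator \<open>w\<close>; the other factor is a component of
      \<open>ll\<close>.\<close>
    also have "q * (r * yi - v * xi) - r * (b * w + a * v) * (v * yi - U * xi)
        = w * w * (r * yi + (b * w + (a - 1) * v) * xi)"
      unfolding q using w2 by algebra
    also have "b / (w * q) * (w * w * (r * yi + (b * w + (a - 1) * v) * xi)) = b * w / q * (r * yi + (b * w + (a - 1) * v) * xi)"
      using w by simp
    finally have "b / w * (r * yi - v * xi) = b / (w * q) * (r * (b * w + a * v)) * (v * yi - U * xi)
       + b * w / q * (r * yi + (b * w + (a - 1) * v) * xi)" by linarith
    moreover have "r * xi + r * (P + (a - 1) * xi) - r * Q = r * a * xi + r * R" if "P = Q + R" for P Q R
      unfolding that by (simp add: algebra_simps)
    ultimately have "r * xi + r * (b / w * (r * yi - v * xi) + (a - 1) * xi)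
         - r * (b / (w * q) * (r * (b * w + a * v)) * (v * yi - U * xi))
       = r * a * xi + r * (b * w / q * (r * yi + (b * w + (a - 1) * v) * xi))" by blast
    then show ?thesis by (simp only: times_divide_eq_right times_divide_eq_left mult_ac)
  qed
  show ?thesis unfolding metric_tensor_mult[OF assms] inner_ll_x
    using e unfolding ll_def kk_def unfolding w_def r_def U_def v_def q_def a_def b_def 
    by (simp add: vec_eq_iff)
qed

lemma dom_independent:
  assumes "(x, y) \<in> dom" "a *\<^sub>R x + b *\<^sub>R y = 0"
  shows "a = 0" "b = 0"
proof -
  note D = domD[OF assms(1)]
  have "((x \<bullet> x) *\<^sub>R y - (x \<bullet> y) *\<^sub>R x) \<bullet> (a *\<^sub>R x + b *\<^sub>R y) = b * (area x y)\<^sup>2"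
    unfolding area_sq by (simp add: inner_diff_left inner_add_right inner_commute algebra_simps power2_eq_square)
  then show "b = 0" using assms(2) D(3) by simp
  then show "a = 0" using assms(2) D(5) by simp
qed

lemma invertible_metric_tensor:
  assumes "(x, y) \<in> dom"
  shows "invertible (metric_tensor F x y)"
  unfolding invertible_left_inverse matrix_left_invertible_ker
proof (intro allI impI)
  fix z assume z: "metric_tensor F x y *v z = 0"
  note D = domD[OF assms]
  have "(x \<bullet> x) *\<^sub>R z
     + (x \<bullet> z) *\<^sub>R ((B (norm x) / area x y) *\<^sub>R ((x \<bullet> x) *\<^sub>R y - (x \<bullet> y) *\<^sub>R x) + (A (norm x) - 1) *\<^sub>R x)
     - (B (norm x) * (x \<bullet> x) / (area x y * qq x y) * (ll x y \<bullet> z)) *\<^sub>R ((x \<bullet> y) *\<^sub>R y - (y \<bullet> y) *\<^sub>R x) = 0"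
    using z D(10) unfolding metric_tensor_mult[OF assms] by simp
  then obtain a0 b0 where "(x \<bullet> x) *\<^sub>R z = a0 *\<^sub>R x + b0 *\<^sub>R y"
  proof -
    assume *: "\<And>a0 b0. (x \<bullet> x) *\<^sub>R z = a0 *\<^sub>R x + b0 *\<^sub>R y \<Longrightarrow> thesis"
    assume "(x \<bullet> x) *\<^sub>R z
     + (x \<bullet> z) *\<^sub>R ((B (norm x) / area x y) *\<^sub>R ((x \<bullet> x) *\<^sub>R y - (x \<bullet> y) *\<^sub>R x) + (A (norm x) - 1) *\<^sub>R x)
     - (B (norm x) * (x \<bullet> x) / (area x y * qq x y) * (ll x y \<bullet> z)) *\<^sub>R ((x \<bullet> y) *\<^sub>R y - (y \<bullet> y) *\<^sub>R x) = 0"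
      (is "?rz + ?c *\<^sub>R (?d *\<^sub>R (?e *\<^sub>R y - ?f *\<^sub>R x) + ?g *\<^sub>R x) - ?h *\<^sub>R (?k *\<^sub>R y - ?m *\<^sub>R x) = 0")
    then have "?rz = (?c * ?d * ?f - ?c * ?g - ?h * ?m) *\<^sub>R x + (?h * ?k - ?c * ?d * ?e) *\<^sub>R y"
      by (simp add: algebra_simps eq_neg_iff_add_eq_0)
    then show thesis by (rule *)
  qed
  then have "(1 / (x \<bullet> x)) *\<^sub>R ((x \<bullet> x) *\<^sub>R z) = (1 / (x \<bullet> x)) *\<^sub>R (a0 *\<^sub>R x + b0 *\<^sub>R y)" by simp
  then have "z = (a0 / (x \<bullet> x)) *\<^sub>R x + (b0 / (x \<bullet> x)) *\<^sub>R y"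
    using D(5) by (simp add: scaleR_add_right)
  then obtain a b where ab: "z = a *\<^sub>R x + b *\<^sub>R y" by blast
  define k where "k = a * (B (norm x) * (x \<bullet> x) * area x y / qq x y) + b"
  have "0 = mm x y *\<^sub>R ((a * ((x \<bullet> x) * A (norm x)) + k * kk x y) *\<^sub>R x + (k * (x \<bullet> x)) *\<^sub>R y)"
    using z unfolding ab matrix_vector_right_distrib matrix_vector_mult_scaleR metric_tensor_mult_x[OF assms] metric_tensor_mult_y[OF assms]
    by (simp add: ll_def k_def algebra_simps)
  then have "(a * ((x \<bullet> x) * A (norm x)) + k * kk x y) *\<^sub>R x + (k * (x \<bullet> x)) *\<^sub>R y = 0" using D(10) by simp
  from dom_independent[OF assms this] have "k = 0" "a = 0" using D(5,8) by auto
  then show "z = 0" by (simp add: ab k_def)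
qed

end

section \<open>The geodesic spray\<close>

context spherical
begin

text \<open>The coefficients of \<open>y\<close> and \<open>x\<close> in the spray solve a
  triangular system: comparing coefficients of \<open>x\<close> gives \<open>spray_Y\<close>, and
  those of \<open>ll\<close> then give \<open>spray_X\<close>. The transcendental part
  \<open>ss\<close> occurs only together with \<open>defect\<close>.\<close>

definition spray_X :: "'a::euclidean_space \<Rightarrow> 'a \<Rightarrow> real" where
  "spray_X x y = (x \<bullet> y) / (x \<bullet> x) + B (norm x) * area x y / (A (norm x) * (x \<bullet> x))
     + defect (norm x) / norm x * (ss x y * ((x \<bullet> y) + B (norm x) * area x y / (2 * A (norm x)))
        - B (norm x) * area x y * (x \<bullet> y)\<^sup>2 / (4 * A (norm x) * qq x y))"

definition spray_Y :: "'a::euclidean_space \<Rightarrow> 'a \<Rightarrow> real" where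
  "spray_Y x y = 1 / (2 * (x \<bullet> x) * A (norm x)) * (A (norm x) * (y \<bullet> y) - 2 * qq x y / (x \<bullet> x)
     + A (norm x) * B' (norm x) * (x \<bullet> y)\<^sup>2 / (B (norm x) * norm x)
     + defect (norm x) / norm x * ((x \<bullet> y)\<^sup>2 / 2 - ss x y * qq x y))"

end

text \<open>The comparison of the coefficients of \<open>x\<close>, after \<open>y\<close> has been
  replaced by (ll - k x) / R. Here R = |x|^2, U = |y|^2, S stands for \<open>ss\<close> and d for
  \<open>defect\<close>.\<close>

lemma spray_Y_identity:
  fixes R A B A' B' U v w q S d k r :: real
  assumes "R > 0" "A \<noteq> 0" "B \<noteq> 0" "r > 0"
    and w2: "w * w = R * U - v * v" and q: "q = w * w + B * v * w + A * v * v"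
    and k: "k = B * w + (A - 1) * v" and d: "d = A' - 2 * A * B' / B"
  shows "2 * ((B' * w + A' * v) * v / r + (A - 1) * U) - 2 * U
     - (v\<^sup>2 * A' + 2 * v * w * B' + 2 * q * S * d) / r - 4 * v * k / R
    = 4 * (1 / (2 * R * A) * (A * U - 2 * q / R + A * B' * v\<^sup>2 / (B * r) + d / r * (v\<^sup>2 / 2 - S * q))) * (R * A)"
proof -
  \<comment> \<open>Treating reciprocals as variables with relations such as
    \<open>R * i = 1\<close> makes the identity polynomial.\<close>
  define i where "i = 1 / R"
  define j where "j = 1 / r"
  define c where "c = B' / B"
  have i: "R * i = 1" using assms(1) by (simp add: i_def)
  have A': "A' = d + 2 * A * c" by (simp add: d c_def)
  have "2 * ((B' * w + A' * v) * v / r + (A - 1) * U) - 2 * U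
     - (v\<^sup>2 * A' + 2 * v * w * B' + 2 * q * S * d) / r - 4 * v * k / R
    = 2 * ((B' * w + A' * v) * v * j + (A - 1) * U) - 2 * U
     - (v\<^sup>2 * A' + 2 * v * w * B' + 2 * q * S * d) * j - 4 * v * k * i"
    by (simp add: i_def j_def)
  also have "\<dots> = 2 * (A * U - 2 * q * i + A * c * v\<^sup>2 * j + d * j * (v\<^sup>2 / 2 - S * q))"
    unfolding q A' k using w2 i by algebra
  also have "\<dots> = 4 * (1 / (2 * R * A) * (A * U - 2 * q / R + A * B' * v\<^sup>2 / (B * r) + d / r * (v\<^sup>2 / 2 - S * q))) * (R * A)"
    using assms(1,2) by (simp add: i_def j_def c_def)
  finally show ?thesis .
qed

text \<open>The comparison of the coefficients of \<open>ll\<close>. The factor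
  \<open>B * R * w / q\<close> on the right is the \<open>ll\<close>-coefficient in the image of
  \<open>x\<close> under the metric tensor.\<close>

lemma spray_X_identity:
  fixes R A B A' B' U v w q S d r :: real
  assumes "R > 0" "A \<noteq> 0" "B \<noteq> 0" "q \<noteq> 0" "r > 0" "w \<noteq> 0"
    and w2: "w * w = R * U - v * v" and q: "q = w * w + B * v * w + A * v * v"
    and d: "d = A' - 2 * A * B' / B"
  shows "2 * ((- B * v * U / (w * q) + (2 * S * d + B' * v * w / q) / r) * v + B * R * U / (w * q) * U) + 4 * v / R
   = 4 * (v / R + B * w / (A * R) + d / r * (S * (v + B * w / (2 * A)) - B * w * v\<^sup>2 / (4 * A * q)))
    + 4 * (1 / (2 * R * A) * (A * U - 2 * q / R + A * B' * v\<^sup>2 / (B * r) + d / r * (v\<^sup>2 / 2 - S * q))) * (B * R * w / q)"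
proof -
  define i where "i = 1 / R"
  define j where "j = 1 / r"
  define c where "c = B' / B"
  define e where "e = 1 / q"
  define a where "a = 1 / A"
  have i: "R * i = 1" "q * e = 1" "A * a = 1" using assms(1-4) by (auto simp: i_def e_def a_def)
  have B': "B' = B * c" using assms(3) by (simp add: c_def)
  have 1: "- B * v * U / (w * q) * v + B * R * U / (w * q) * U = B * U * w * e"
  proof -
    have "- B * v * U / (w * q) * v + B * R * U / (w * q) * U = B * U * (R * U - v * v) / (w * q)"
      by (simp add: algebra_simps diff_divide_distrib)
    also have "\<dots> = B * U * w * e" unfolding w2[symmetric] using assms(6) by (simp add: e_def)
    finally show ?thesis .
  qed
  have "2 * ((- B * v * U / (w * q) + (2 * S * d + B' * v * w / q) / r) * v + B * R * U / (w * q) * U) + 4 * v / R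
    = 2 * ((- B * v * U / (w * q) * v + B * R * U / (w * q) * U) + (2 * S * d + B' * v * w * e) * j * v) + 4 * v * i"
    by (simp add: i_def j_def e_def algebra_simps add_divide_distrib)
  also have "\<dots> = 2 * (B * U * w * e + (2 * S * d + B' * v * w * e) * j * v) + 4 * v * i" unfolding 1 ..
  also have "\<dots> = 4 * (v * i + B * w * a * i + d * j * (S * (v + B * w * a / 2) - B * w * v\<^sup>2 * a * e / 4))
    + 2 * (A * U - 2 * q * i + A * c * v\<^sup>2 * j + d * j * (v\<^sup>2 / 2 - S * q)) * (B * w * e) * a"
    unfolding B' using i by algebra
  also have "2 * (A * U - 2 * q * i + A * c * v\<^sup>2 * j + d * j * (v\<^sup>2 / 2 - S * q)) * (B * w * e) * a
    = 4 * (1 / (2 * R * A) * (A * U - 2 * q / R + A * B' * v\<^sup>2 / (B * r) + d / r * (v\<^sup>2 / 2 - S * q))) * (B * R * w / q)"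
  proof -
    have "2 * Z * (B * w * e) * a = 4 * (1 / (2 * R * A) * Z) * (B * R * w / q)" for Z
      using assms(1,2) by (simp add: e_def a_def mult_ac)
    moreover have "A * U - 2 * q * i + A * c * v\<^sup>2 * j + d * j * (v\<^sup>2 / 2 - S * q)
      = A * U - 2 * q / R + A * B' * v\<^sup>2 / (B * r) + d / r * (v\<^sup>2 / 2 - S * q)"
      by (simp add: i_def j_def c_def)
    ultimately show ?thesis by (simp only:)
  qed
  also have "4 * (v * i + B * w * a * i + d * j * (S * (v + B * w * a / 2) - B * w * v\<^sup>2 * a * e / 4))
    = 4 * (v / R + B * w / (A * R) + d / r * (S * (v + B * w / (2 * A)) - B * w * v\<^sup>2 / (4 * A * q)))"
    by (simp add: i_def j_def e_def a_def mult.commute)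
  finally show ?thesis .
qed

lemma matrix_inv_left_inverse:
  fixes M :: "real^'n^'m"
  assumes "invertible M"
  shows "matrix_inv M ** M = mat 1"
  using someI_ex[OF assms[unfolded invertible_def]] unfolding matrix_inv_def by blast

context spherical_metric
begin

text \<open>The metric tensor maps \<open>y\<close> and \<open>x\<close> to explicit combinations of \<open>ll x y\<close> and \<open>x\<close>, so no inverse
  matrix has to be computed.\<close>

lemma spray_coeff_eq:
  assumes "(x, y) \<in> dom"
  shows "spray_coeff F x y = spray_X x y *\<^sub>R y + spray_Y x y *\<^sub>R x"
proof -
  note D = domD[OF assms]
  define R where "R = x \<bullet> x"
  define v where "v = x \<bullet> y"
  define U where "U = y \<bullet> y"
  define w where "w = area x y"
  define q where "q = qq x y"
  define r where "r = norm x"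
  define S where "S = ss x y"
  define m where "m = mm x y"
  define k where "k = kk x y"
  \<comment> \<open>\<open>a1\<close> and \<open>a2\<close> are the coefficients of \<open>x\<close>
    and \<open>y\<close> in the \<open>x\<close>-gradient of ln \<open>mm\<close>, and
    \<open>b1\<close> and \<open>b2\<close> those in the \<open>x\<close>-gradient of
    \<open>kk\<close>. \<open>M / r\<close> collects the contribution to the
    \<open>x\<close>-gradient of F^2, divided by \<open>mm\<close>, that comes from the dependence
    of \<open>A\<close> and \<open>B\<close> on the radius.\<close>
  define a1 where "a1 = - B r * v * U / (w * q) + (2 * S * defect r + B' r * v * w / q) / r"
  define a2 where "a2 = B r * R * U / (w * q)"
  define b1 where "b1 = (B' r * w + A' r * v) / r + B r * U / w"
  define b2 where "b2 = A r - 1 - B r * v / w"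
  define M where "M = v\<^sup>2 * A' r + 2 * v * w * B' r + 2 * q * S * defect r"
  note defs = R_def v_def U_def w_def q_def r_def S_def m_def k_def
  have pos: "R > 0" "w > 0" "q > 0" "m > 0" "r > 0" "A r \<noteq> 0" "B r \<noteq> 0"
    using D by (auto simp: defs)
  have w2: "w * w = R * U - v * v" using area_sq[of x y] by (simp add: defs power2_eq_square)
  have qe: "q = w * w + B r * v * w + A r * v * v" using q_eq[of x y] by (simp add: defs power2_eq_square)
  have ke: "k = B r * w + (A r - 1) * v" by (simp add: defs kk_def)
  have le: "ll x y $ h = R * y $ h + k * x $ h" for h by (simp add: defs ll_def)
  have mixed: "partial_deriv p (\<lambda>x'. partial_deriv h (\<lambda>y'. (F x' y')\<^sup>2) y) x
     = 2 * (m * (a1 * x $ p + a2 * y $ p) * ll x y $ h + (2 * x $ p * y $ h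
       + (b1 * x $ p + b2 * y $ p) * x $ h + k * axis h 1 $ p) * m)" for p h
  proof (rule partial_deriv_eqI_open[OF open_dom_x, of _ y _ "\<lambda>x. 2 * (mm x y * (ll x y \<bullet> axis h 1))"])
    from DERIV_cmult[OF DERIV_mult[OF mm_line_x[OF assms, of "axis p 1"] ll_line_x[OF assms, of "axis p 1" "axis h 1"]], of 2]
    show "((\<lambda>t. 2 * (mm (x + t *\<^sub>R axis p 1) y * (ll (x + t *\<^sub>R axis p 1) y \<bullet> axis h 1))) has_real_derivative
       2 * (m * (a1 * x $ p + a2 * y $ p) * ll x y $ h + (2 * x $ p * y $ h
       + (b1 * x $ p + b2 * y $ p) * x $ h + k * axis h 1 $ p) * m)) (at 0)"
      by (rule DERIV_cong) (simp only: scaleR_zero_left add_0_right inner_axis inner_real_def mult_1_right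
        a1_def a2_def b1_def b2_def defs)
  qed (use assms in \<open>auto simp: partial_F_sq inner_axis\<close>)
  have sum_mixed: "(\<Sum>p\<in>UNIV. y $ p * partial_deriv p (\<lambda>x'. partial_deriv h (\<lambda>y'. (F x' y')\<^sup>2) y) x)
     = 2 * (m * (a1 * v + a2 * U) * ll x y $ h + (2 * v * y $ h + (b1 * v + b2 * U) * x $ h + k * y $ h) * m)" for h
  proof -
    have ax: "(\<Sum>p\<in>UNIV. y $ p * axis h 1 $ p) = y $ h" 
      using inner_axis[of y h "1::real"] by (simp add: inner_vec_def)
    have "(\<Sum>p\<in>UNIV. y $ p * partial_deriv p (\<lambda>x'. partial_deriv h (\<lambda>y'. (F x' y')\<^sup>2) y) x)
      = (\<Sum>p\<in>UNIV. (2 * m * a1 * ll x y $ h + 4 * m * y $ h + 2 * m * b1 * x $ h) * (x $ p * y $ p)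
          + (2 * m * a2 * ll x y $ h + 2 * m * b2 * x $ h) * (y $ p * y $ p) + 2 * m * k * (y $ p * axis h 1 $ p))"
      unfolding mixed by (rule sum.cong) (simp_all add: algebra_simps)
    also have "\<dots> = (2 * m * a1 * ll x y $ h + 4 * m * y $ h + 2 * m * b1 * x $ h) * v
          + (2 * m * a2 * ll x y $ h + 2 * m * b2 * x $ h) * U + 2 * m * k * y $ h"
      unfolding sum.distrib sum_distrib_left[symmetric] ax
      by (simp add: v_def U_def inner_vec_def)
    finally show ?thesis by (simp add: algebra_simps)
  qed
  have partial_x: "partial_deriv h (\<lambda>x'. (F x' y)\<^sup>2) x = m * (2 * U * x $ h + 2 * k * y $ h + M / r * x $ h)" for h
  proof (rule partial_deriv_eqI_open[OF open_dom_x, of _ y _ "\<lambda>x. qq x y * mm x y"])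
    show "((\<lambda>t. qq (x + t *\<^sub>R axis h 1) y * mm (x + t *\<^sub>R axis h 1) y) has_real_derivative
       m * (2 * U * x $ h + 2 * k * y $ h + M / r * x $ h)) (at 0)"
      using quad_conf_line_x[OF assms, of "axis h 1"]
      by (simp only: inner_axis inner_real_def mult_1_right M_def defs)
  qed (use assms in \<open>auto simp: F_sq\<close>)
  define X where "X = spray_X x y"
  define Y where "Y = spray_Y x y"
  have Xe: "2 * (a1 * v + a2 * U) + 4 * v / R = 4 * X + 4 * Y * (B r * R * w / q)"
    using spray_X_identity[where A' = "A' r" and B' = "B' r" and S = S, OF pos(1,6,7) _ pos(5) _ w2 qe refl] pos
    unfolding a1_def a2_def X_def Y_def spray_X_def spray_Y_def defect_def by (simp only: defs)
  have b: "b1 * v + b2 * U = (B' r * w + A' r * v) * v / r + (A r - 1) * U"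
    using pos(2) by (simp add: b1_def b2_def algebra_simps)
  have Ye: "2 * (b1 * v + b2 * U) - 2 * U - M / r - 4 * v * k / R = 4 * Y * (R * A r)"
    using spray_Y_identity[where A' = "A' r" and B' = "B' r" and S = S, OF pos(1,6,7,5) w2 qe ke refl]
    unfolding b M_def Y_def spray_Y_def defect_def by (simp only: defs)
  define rhs :: "real^'n" where "rhs = (\<chi> h. (\<Sum>p\<in>UNIV. y $ p * partial_deriv p (\<lambda>x'. partial_deriv h (\<lambda>y'. (F x' y')\<^sup>2) y) x)
         - partial_deriv h (\<lambda>x'. (F x' y)\<^sup>2) x)"
  have "rhs $ h = (metric_tensor F x y *v (4 *\<^sub>R (X *\<^sub>R y + Y *\<^sub>R x))) $ h" for h
  proof -
    define l where "l = ll x y $ h"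
    \<comment> \<open>The metric tensor maps into combinations of \<open>x\<close> and
      \<open>ll\<close> here, so \<open>y\<close> is eliminated in favour of \<open>ll\<close>
      before coefficients are compared.\<close>
    have y: "y $ h = l / R - k * x $ h / R" using pos(1) by (simp add: l_def le diff_divide_distrib[symmetric])
    have "rhs $ h = m * (2 * (a1 * v + a2 * U) * l + 4 * v * y $ h + (2 * (b1 * v + b2 * U) - 2 * U - M / r) * x $ h)"
      unfolding rhs_def by (simp add: sum_mixed partial_x l_def algebra_simps)
    also have "4 * v * y $ h = 4 * v / R * l - 4 * v * k / R * x $ h" unfolding y by (simp add: right_diff_distrib)
    also have "2 * (a1 * v + a2 * U) * l + (4 * v / R * l - 4 * v * k / R * x $ h) + (2 * (b1 * v + b2 * U) - 2 * U - M / r) * x $ h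
       = (2 * (a1 * v + a2 * U) + 4 * v / R) * l + (2 * (b1 * v + b2 * U) - 2 * U - M / r - 4 * v * k / R) * x $ h"
      by (simp add: algebra_simps)
    also have "\<dots> = (4 * X + 4 * Y * (B r * R * w / q)) * l + 4 * Y * (R * A r) * x $ h" unfolding Xe Ye ..
    also have "m * \<dots> = (metric_tensor F x y *v (4 *\<^sub>R (X *\<^sub>R y + Y *\<^sub>R x))) $ h"
      unfolding matrix_vector_mult_scaleR matrix_vector_right_distrib
        metric_tensor_mult_x[OF assms] metric_tensor_mult_y[OF assms]
      by (simp add: defs[symmetric] l_def[symmetric] algebra_simps)
    finally show ?thesis .
  qed
  then have rhs: "rhs = metric_tensor F x y *v (4 *\<^sub>R (X *\<^sub>R y + Y *\<^sub>R x))" by (simp add: vec_eq_iff)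
  have "spray_coeff F x y = (1/4) *\<^sub>R (matrix_inv (metric_tensor F x y) *v rhs)"
    by (simp add: spray_coeff_def rhs_def vec_eq_iff matrix_vector_mult_def)
  also have "matrix_inv (metric_tensor F x y) *v rhs = 4 *\<^sub>R (X *\<^sub>R y + Y *\<^sub>R x)"
    unfolding rhs matrix_vector_mul_assoc matrix_inv_left_inverse[OF invertible_metric_tensor[OF assms]]
    by (rule matrix_vector_mul_lid)
  finally show ?thesis by (simp add: X_def Y_def)
qed

end

section \<open>Third derivatives of w times the orthogonal projection\<close>

text \<open>\<open>perp x y\<close> is \<open>|x|\<^sup>2\<close> times the projection of \<open>y\<close> to the orthogonal complement of \<open>x\<close>, and
  \<open>perp_mat x\<close> is the matrix of this map.\<close>

definition perp :: "'a::real_inner \<Rightarrow> 'a \<Rightarrow> 'a" where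
  "perp x y = (x \<bullet> x) *\<^sub>R y - (x \<bullet> y) *\<^sub>R x"

definition perp_mat :: "real^'n \<Rightarrow> 'n \<Rightarrow> 'n \<Rightarrow> real" where
  "perp_mat x i j = (x \<bullet> x) * axis i 1 $ j - x $ i * x $ j"

lemma perp_mat_commute: "perp_mat x i j = perp_mat x j i"
  by (auto simp: perp_mat_def axis_def)

lemma component_line: "((\<lambda>t. (y + t *\<^sub>R axis j 1) $ i) has_real_derivative axis i 1 $ j) (at 0)"
  by (auto intro!: derivative_eq_intros simp: axis_def)

lemma perp_inner_self: "perp x y \<bullet> x = 0"
  using inner_commute[of x y] by (simp add: perp_def inner_diff_left)

lemma perp_line: "((\<lambda>t. perp x (y + t *\<^sub>R axis j 1) $ i) has_real_derivative perp_mat x i j) (at 0)"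
proof -
  have "((\<lambda>t. (x \<bullet> x) * (y + t *\<^sub>R axis j 1) $ i - x \<bullet> (y + t *\<^sub>R axis j 1) * x $ i) has_real_derivative
     (x \<bullet> x) * axis i 1 $ j - (x \<bullet> axis j 1) * x $ i) (at 0)"
    by (rule derivative_eq_intros component_line inner_line refl)+ simp
  then show ?thesis by (simp add: perp_def perp_mat_def inner_axis mult.commute)
qed

lemma area_line_axis:
  assumes "area x y > 0"
  shows "((\<lambda>t. area x (y + t *\<^sub>R axis j 1)) has_real_derivative perp x y $ j * inverse (area x y)) (at 0)"
  using area_line[OF assms, of "axis j 1"] by (simp add: perp_def inner_axis divide_inverse)

lemma inverse_area_line_axis:
  assumes "area x y > 0"
  shows "((\<lambda>t. inverse (area x (y + t *\<^sub>R axis j 1))) has_real_derivative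
    - (perp x y $ j * inverse (area x y) ^ 3)) (at 0)"
  by (rule derivative_eq_intros area_line_axis[OF assms] refl)+
    (use assms in \<open>simp_all add: power3_eq_cube\<close>)

lemma sum_perp_mat_perp: "(\<Sum>i\<in>UNIV. perp_mat x i j * perp x y $ i) = (x \<bullet> x) * perp x y $ j"
proof -
  have "(\<Sum>i\<in>UNIV. perp_mat x i j * perp x y $ i)
     = (x \<bullet> x) * (\<Sum>i\<in>UNIV. axis j 1 $ i * perp x y $ i) - x $ j * (x \<bullet> perp x y)"
    unfolding perp_mat_commute[of x _ j]
    by (simp add: perp_mat_def inner_vec_def algebra_simps sum_subtractf sum_distrib_left)
  also have "x \<bullet> perp x y = 0" using perp_inner_self[of x y] by (simp add: inner_commute)
  also have "(\<Sum>i\<in>UNIV. axis j 1 $ i * perp x y $ i) = axis j 1 \<bullet> perp x y"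
    by (simp add: inner_vec_def)
  finally show ?thesis by (simp add: inner_axis')
qed

lemma sum_perp_mat_self: "(\<Sum>i\<in>UNIV. perp_mat x i j * x $ i) = 0"
proof -
  have "(\<Sum>i\<in>UNIV. perp_mat x i j * x $ i)
     = (x \<bullet> x) * (\<Sum>i\<in>UNIV. axis j 1 $ i * x $ i) - x $ j * (x \<bullet> x)"
    unfolding perp_mat_commute[of x _ j]
    by (simp add: perp_mat_def inner_vec_def algebra_simps sum_subtractf sum_distrib_left)
  also have "(\<Sum>i\<in>UNIV. axis j 1 $ i * x $ i) = axis j 1 \<bullet> x"
    by (simp add: inner_vec_def)
  finally show ?thesis by (simp add: inner_axis')
qed

lemma perp_inner_perp: "perp x y \<bullet> perp x y = (x \<bullet> x) * (area x y)\<^sup>2"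
  unfolding perp_def area_sq
  by (simp add: inner_diff_left inner_diff_right inner_commute power2_eq_square algebra_simps)

text \<open>The third derivatives of the components of the map that sends \<open>y\<close> to \<open>area x y *\<^sub>R perp x y\<close>.\<close>

definition area_perp_third :: "real^'n \<Rightarrow> real^'n \<Rightarrow> 'n \<Rightarrow> 'n \<Rightarrow> 'n \<Rightarrow> 'n \<Rightarrow> real" where
  "area_perp_third x y i j k h = (let n = \<lambda>i. perp x y $ i; m = perp_mat x; u = inverse (area x y) in
     m i j * (m h k * u - n h * n k * u ^ 3) + m i k * (m h j * u - n h * n j * u ^ 3)
     + m i h * (m k j * u - n k * n j * u ^ 3)
     + n i * (3 * n h * n k * n j * u ^ 5 - (m h k * n j + m h j * n k + m k j * n h) * u ^ 3))"

text \<open>Terms quadratic in \<open>y\<close> vanish under three derivatives, so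
  \<open>\<alpha>\<close>, \<open>\<beta>\<close> and \<open>\<gamma>\<close> leave no trace in the
  result.\<close>

lemma partial_area_perp_quadratic:
  fixes G :: "real^'n \<Rightarrow> real"
  assumes S: "open S" "y \<in> S" "\<And>y. y \<in> S \<Longrightarrow> area x y > 0"
    and G: "\<And>y. y \<in> S \<Longrightarrow> G y = c * (area x y * perp x y $ i) + \<alpha> * (x \<bullet> y) * y $ i
      + (\<beta> * (y \<bullet> y) + \<gamma> * (x \<bullet> y)\<^sup>2) * x $ i"
  shows "partial_deriv j (\<lambda>y'. partial_deriv k (\<lambda>y''. partial_deriv h G y'') y') y
    = c * area_perp_third x y i j k h"
proof -
  define n where "n = (\<lambda>y i. perp x y $ i)"
  define m where "m = perp_mat x"
  \<comment> \<open>With the reciprocal of \<open>area\<close> as a separate function the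
    derivatives close up: those of \<open>n\<close>, \<open>area\<close> and \<open>u\<close> are
    polynomials in \<open>n\<close>, \<open>u\<close> and the constants \<open>m\<close>.\<close>
  define u where "u = (\<lambda>y. inverse (area x y))"
  have dn: "((\<lambda>t. n (y + t *\<^sub>R axis j 1) i) has_real_derivative m i j) (at 0)" for y i j
    unfolding n_def m_def by (rule perp_line)
  have dw: "((\<lambda>t. area x (y + t *\<^sub>R axis j 1)) has_real_derivative n y j * u y) (at 0)" if "y \<in> S" for y j
    unfolding n_def u_def by (rule area_line_axis) (use S(3) that in auto)
  have du: "((\<lambda>t. u (y + t *\<^sub>R axis j 1)) has_real_derivative - (n y j * u y ^ 3)) (at 0)" if "y \<in> S" for y j
    unfolding n_def u_def by (rule inverse_area_line_axis) (use S(3) that in auto)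
  have dv: "((\<lambda>t. x \<bullet> (y + t *\<^sub>R axis j 1)) has_real_derivative x $ j) (at 0)" for y j
    using inner_line[of x y "axis j 1"] by (simp add: inner_axis)
  have dU: "((\<lambda>t. (y + t *\<^sub>R axis j 1) \<bullet> (y + t *\<^sub>R axis j 1)) has_real_derivative 2 * y $ j) (at 0)" for y :: "real^'n" and j
    using inner_self_line[of y "axis j 1"] by (simp add: inner_axis)
  have G': "G y = c * (area x y * n y i) + \<alpha> * (x \<bullet> y) * y $ i + (\<beta> * (y \<bullet> y) + \<gamma> * (x \<bullet> y)\<^sup>2) * x $ i"
    if "y \<in> S" for y
    using G[OF that] by (simp add: n_def)
  have 1: "partial_deriv h G y = c * (n y h * n y i * u y + area x y * m i h)
     + \<alpha> * (x $ h * y $ i + (x \<bullet> y) * axis i 1 $ h) + (2 * \<beta> * y $ h + 2 * \<gamma> * (x \<bullet> y) * x $ h) * x $ i"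
    if y: "y \<in> S" for y
    by (rule partial_deriv_eqI_open[OF S(1) y G'], assumption,
      (rule derivative_eq_intros dn dw[OF y] dv dU component_line refl)+) (simp add: algebra_simps)
  have 2: "partial_deriv k (\<lambda>y. partial_deriv h G y) y
     = c * ((m h k * n y i + n y h * m i k + n y k * m i h) * u y - n y h * n y i * n y k * u y ^ 3)
     + \<alpha> * (x $ h * axis i 1 $ k + x $ k * axis i 1 $ h) + (2 * \<beta> * axis h 1 $ k + 2 * \<gamma> * x $ k * x $ h) * x $ i"
    if y: "y \<in> S" for y
    by (rule partial_deriv_eqI_open[OF S(1) y 1], assumption,
      (rule derivative_eq_intros dn dw[OF y] du[OF y] dv dU component_line refl)+) (simp add: algebra_simps)
  show ?thesis
    by (rule partial_deriv_eqI_open[OF S(1) S(2) 2], assumption,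
      (rule derivative_eq_intros dn du[OF S(2)] refl)+)
     (simp add: area_perp_third_def Let_def n_def m_def u_def algebra_simps flip: power_Suc)
qed

text \<open>By Euler's theorem: up to a factor, \<open>area x y *\<^sub>R perp x y\<close> is the gradient of \<open>(area x y)^3\<close>, whose
  third derivatives are homogeneous of degree 0 in \<open>y\<close> and invariant under translations by \<open>x\<close>.\<close>

lemma sum_area_perp_third:
  assumes "area x y > 0"
  shows "(\<Sum>i\<in>UNIV. area_perp_third x y i j k h * (perp x y + s *\<^sub>R x) $ i) = 0"
proof -
  define n where "n = (\<lambda>i. perp x y $ i)"
  define m where "m = perp_mat x"
  define u where "u = inverse (area x y)"
  define w where "w = area x y"
  define l where "l = (\<lambda>i. (perp x y + s *\<^sub>R x) $ i)"
  have wu: "w * u = 1" using assms by (simp add: w_def u_def)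
  have ml: "(\<Sum>i\<in>UNIV. m i j * l i) = (x \<bullet> x) * n j" for j
    using sum_perp_mat_perp[of x j y] sum_perp_mat_self[of x j]
    by (simp add: m_def l_def n_def distrib_left sum.distrib mult.left_commute[of _ s] sum_distrib_left[symmetric])
  have nl: "(\<Sum>i\<in>UNIV. n i * l i) = (x \<bullet> x) * w\<^sup>2"
  proof -
    have "(\<Sum>i\<in>UNIV. n i * l i) = perp x y \<bullet> (perp x y + s *\<^sub>R x)"
      by (simp add: inner_vec_def n_def l_def)
    then show ?thesis by (simp add: inner_add_right perp_inner_perp perp_inner_self w_def)
  qed
  have "(\<Sum>i\<in>UNIV. area_perp_third x y i j k h * l i)
     = (m h k * u - n h * n k * u ^ 3) * (\<Sum>i\<in>UNIV. m i j * l i)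
     + (m h j * u - n h * n j * u ^ 3) * (\<Sum>i\<in>UNIV. m i k * l i)
     + (m k j * u - n k * n j * u ^ 3) * (\<Sum>i\<in>UNIV. m i h * l i)
     + (3 * n h * n k * n j * u ^ 5 - (m h k * n j + m h j * n k + m k j * n h) * u ^ 3) * (\<Sum>i\<in>UNIV. n i * l i)"
    unfolding area_perp_third_def Let_def n_def[symmetric] m_def[symmetric] u_def[symmetric] sum_distrib_left
      sum.distrib[symmetric]
    by (rule sum.cong) (simp_all add: algebra_simps)
  also have "\<dots> = 0" unfolding ml nl using wu by algebra
  finally show ?thesis by (simp add: l_def)
qed

section \<open>The case of vanishing defect\<close>

context spherical_metric
begin

text \<open>Without the defect terms, the square root w enters through B w / (A |x|^2) in
  \<open>spray_X\<close> and through B v w in \<open>qq\<close>. These two contributions combine to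
  a multiple of w times \<open>perp x y\<close>; all the rest is quadratic in \<open>y\<close>,
  since w^2 is a quadratic form.\<close>

lemma spray_coeff_defect_0:
  assumes "(x, y) \<in> dom" "defect (norm x) = 0"
  shows "spray_coeff F x y $ i = B (norm x) / (A (norm x) * (x \<bullet> x)\<^sup>2) * (area x y * perp x y $ i)
     + 1 / (x \<bullet> x) * (x \<bullet> y) * y $ i
     + ((1 / (2 * (x \<bullet> x)) - 1 / (A (norm x) * (x \<bullet> x))) * (y \<bullet> y)
       + (1 / (A (norm x) * (x \<bullet> x)\<^sup>2) - 1 / (x \<bullet> x)\<^sup>2 + B' (norm x) / (2 * (x \<bullet> x) * B (norm x) * norm x)) * (x \<bullet> y)\<^sup>2) * x $ i"
proof -
  note D = domD[OF assms(1)]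
  define a where "a = 1 / A (norm x)"
  define i where "i = 1 / (x \<bullet> x)"
  define c where "c = B' (norm x) / (B (norm x) * norm x)"
  have ai: "A (norm x) * a = 1" "(x \<bullet> x) * i = 1" using D(5,8) by (simp_all add: a_def i_def)
  have q: "qq x y = (x \<bullet> x) * (y \<bullet> y) - (x \<bullet> y)\<^sup>2 + B (norm x) * (x \<bullet> y) * area x y + A (norm x) * (x \<bullet> y)\<^sup>2"
    unfolding q_eq area_sq ..
  have X: "spray_X x y = (x \<bullet> y) * i + B (norm x) * area x y * a * i"
    by (simp add: spray_X_def assms(2) a_def i_def)
  have Y: "spray_Y x y = i * a / 2 * (A (norm x) * (y \<bullet> y) - 2 * qq x y * i + A (norm x) * (x \<bullet> y)\<^sup>2 * c)"
    by (simp add: spray_Y_def assms(2) a_def i_def c_def mult_ac)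
  have "(spray_X x y *\<^sub>R y + spray_Y x y *\<^sub>R x) $ j
    = B (norm x) * a * i\<^sup>2 * (area x y * perp x y $ j) + i * (x \<bullet> y) * y $ j
     + ((i / 2 - a * i) * (y \<bullet> y) + (a * i\<^sup>2 - i\<^sup>2 + i * c / 2) * (x \<bullet> y)\<^sup>2) * x $ j" for j
    unfolding perp_def vector_add_component vector_minus_component vector_scaleR_component real_scaleR_def X Y q
    using ai by algebra
  then show ?thesis unfolding spray_coeff_eq[OF assms(1)]
    by (simp add: a_def i_def c_def power_divide mult_ac)
qed

lemma berwald_curvature_defect_0:
  assumes "(x, y) \<in> dom" "defect (norm x) = 0"
  shows "berwald_curvature F x y i j k h = B (norm x) / (A (norm x) * (x \<bullet> x)\<^sup>2) * area_perp_third x y i j k h"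
  unfolding berwald_curvature_def
proof (rule partial_area_perp_quadratic[OF open_dom_y])
  show "spray_coeff F x y $ i = B (norm x) / (A (norm x) * (x \<bullet> x)\<^sup>2) * (area x y * perp x y $ i)
     + 1 / (x \<bullet> x) * (x \<bullet> y) * y $ i
     + ((1 / (2 * (x \<bullet> x)) - 1 / (A (norm x) * (x \<bullet> x))) * (y \<bullet> y)
       + (1 / (A (norm x) * (x \<bullet> x)\<^sup>2) - 1 / (x \<bullet> x)\<^sup>2 + B' (norm x) / (2 * (x \<bullet> x) * B (norm x) * norm x)) * (x \<bullet> y)\<^sup>2) * x $ i"
    if "y \<in> {y. (x, y) \<in> dom}" for y
    using that assms(2) by (intro spray_coeff_defect_0) simp_all
qed (use assms domD(3) in auto)

text \<open>Brings the gradient of \<open>F\<close>, a multiple of \<open>ll\<close>, into the form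
  that \<open>sum_area_perp_third\<close> annihilates.\<close>

lemma ll_perp: "ll x y = perp x y + (x \<bullet> y + kk x y) *\<^sub>R x"
  by (simp add: ll_def perp_def algebra_simps)

lemma landsberg_defect_0:
  assumes "(x, y) \<in> dom" "defect (norm x) = 0"
  shows "landsberg_tensor F x y j k h = 0"
proof -
  define c where "c = B (norm x) / (A (norm x) * (x \<bullet> x)\<^sup>2)"
  have "(\<Sum>i\<in>UNIV. berwald_curvature F x y i j k h * partial_deriv i (F x) y)
    = c * (mm x y / F x y) * (\<Sum>i\<in>UNIV. area_perp_third x y i j k h * ll x y $ i)"
    unfolding berwald_curvature_defect_0[OF assms] partial_F[OF assms(1)] c_def[symmetric] sum_distrib_left
    by (rule sum.cong) simp_all
  also have "\<dots> = 0"
    unfolding ll_perp sum_area_perp_third[OF domD(3)[OF assms(1)]] by simp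
  finally show ?thesis by (simp add: landsberg_tensor_def)
qed

text \<open>Test points with prescribed r and v: \<open>x\<close> lies on one axis, and the part of
  \<open>y\<close> orthogonal to it has the coordinates \<open>\<eta>\<close> and
  \<open>\<tau>\<close>. Since \<open>area\<close> depends only on the length of that part, w acts
  as a radius in their plane.\<close>

lemma plane_dom:
  fixes a b c :: 'n
  assumes "a \<noteq> b" "a \<noteq> c" "b \<noteq> c" and x: "x = r *\<^sub>R axis a 1" and y: "y = (v / r) *\<^sub>R axis a 1 + \<eta> *\<^sub>R axis b 1 + \<tau> *\<^sub>R axis c 1"
    and r: "r > 0"
  shows "x \<bullet> y = v" "x \<bullet> x = r\<^sup>2" "y \<bullet> y = (v / r)\<^sup>2 + \<eta>\<^sup>2 + \<tau>\<^sup>2" "area x y = r * sqrt (\<eta>\<^sup>2 + \<tau>\<^sup>2)" "norm x = r"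
    "y $ a = v / r" "y $ b = \<eta>" "y $ c = \<tau>" "x $ a = r" "x $ b = 0" "x $ c = 0"
proof -
  show *: "x \<bullet> y = v" "x \<bullet> x = r\<^sup>2" "y \<bullet> y = (v / r)\<^sup>2 + \<eta>\<^sup>2 + \<tau>\<^sup>2"
    using assms by (auto simp: inner_add_left inner_add_right inner_axis_axis power2_eq_square)
  have "r\<^sup>2 * ((v / r)\<^sup>2 + \<eta>\<^sup>2 + \<tau>\<^sup>2) - v\<^sup>2 = r\<^sup>2 * (\<eta>\<^sup>2 + \<tau>\<^sup>2)"
    using r by (simp add: power_divide algebra_simps)
  then show "area x y = r * sqrt (\<eta>\<^sup>2 + \<tau>\<^sup>2)"
    unfolding area_def * using r by (simp add: real_sqrt_mult)
  show "norm x = r" using x r by simp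
  show "y $ a = v / r" "y $ b = \<eta>" "y $ c = \<tau>" "x $ a = r" "x $ b = 0" "x $ c = 0"
    using assms by (auto simp: axis_def)
qed

text \<open>The axis \<open>c\<close> is orthogonal to both \<open>x\<close> and \<open>y\<close>,
  so the \<open>c\<close>-component of \<open>perp x y\<close> is 0. Only the three equal products
  of entries of \<open>perp_mat\<close> survive, and they add up to 3 r^4 / w.\<close>

lemma berwald_curvature_plane:
  fixes a b c :: 'n
  assumes "a \<noteq> b" "a \<noteq> c" "b \<noteq> c" and x: "x = r *\<^sub>R axis a 1" and y: "y = (v / r) *\<^sub>R axis a 1 + \<eta> *\<^sub>R axis b 1 + 0 *\<^sub>R axis c 1"
    and r: "r > 0" and D: "(x, y) \<in> dom" "defect r = 0"
  shows "berwald_curvature F x y c c c c \<noteq> 0"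
proof -
  note pl = plane_dom[OF assms(1-6)]
  have "perp x y $ c = 0" by (simp add: perp_def pl)
  moreover have "perp_mat x c c = r\<^sup>2" by (simp add: perp_mat_def pl)
  ultimately have "area_perp_third x y c c c c = 3 * r\<^sup>2 * r\<^sup>2 * inverse (area x y)"
    by (simp add: area_perp_third_def Let_def)
  then show ?thesis
    using D(2) domD(3,8,9)[OF D(1)] r by (simp add: berwald_curvature_defect_0[OF D(1)] pl(2,5))
qed

end

section \<open>A Landsberg component that detects the defect\<close>

lemma partial_deriv_eqI_eventually:
  assumes "\<forall>\<^sub>F t in nhds 0. f (z + t *\<^sub>R axis i 1) = g t" "(g has_real_derivative c) (at 0)"
  shows "partial_deriv i f z = c"
  by (rule partial_deriv_eqI) (use assms in \<open>subst DERIV_cong_ev; auto\<close>)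

text \<open>The derivative of w in \<open>\<tau>\<close> is r^2 \<open>\<tau>\<close> / w. Writing
  the derivative of \<open>H\<close> as w times \<open>K\<close> cancels this denominator, so the
  first derivative is r^2 \<open>\<tau>\<close> P K, and at \<open>\<tau>\<close> = 0 the second is
  r^2 P K. Only the last derivative, in \<open>\<eta>\<close>, has to differentiate
  \<open>K\<close>.\<close>

lemma partial_plane:
  fixes f :: "real^'n \<Rightarrow> real"
  assumes pt: "pt = (\<lambda>\<eta> \<tau>. z + \<eta> *\<^sub>R axis b 1 + \<tau> *\<^sub>R axis c 1)"
    and S: "open S" "pt \<eta>0 0 \<in> S" and \<eta>0: "\<eta>0 > 0" and r: "r > 0"
    and nz: "\<And>\<eta> \<tau>. pt \<eta> \<tau> \<in> S \<Longrightarrow> \<eta>\<^sup>2 + \<tau>\<^sup>2 > 0"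
    and f: "\<And>\<eta> \<tau>. pt \<eta> \<tau> \<in> S \<Longrightarrow> f (pt \<eta> \<tau>) = P \<eta> * H (r * sqrt (\<eta>\<^sup>2 + \<tau>\<^sup>2))"
    and P: "(P has_real_derivative p') (at \<eta>0)"
    and H: "\<And>\<eta> \<tau> w. pt \<eta> \<tau> \<in> S \<Longrightarrow> w = r * sqrt (\<eta>\<^sup>2 + \<tau>\<^sup>2) \<Longrightarrow> (H has_real_derivative w * K w) (at w)"
    and K: "\<And>\<eta> \<tau> w. pt \<eta> \<tau> \<in> S \<Longrightarrow> w = r * sqrt (\<eta>\<^sup>2 + \<tau>\<^sup>2) \<Longrightarrow> (K has_real_derivative K' w) (at w)"
  shows "partial_deriv b (\<lambda>y'. partial_deriv c (\<lambda>y''. partial_deriv c f y'') y') (pt \<eta>0 0)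
    = p' * r\<^sup>2 * K (r * \<eta>0) + P \<eta>0 * r ^ 3 * K' (r * \<eta>0)"
proof -
  define W where "W = (\<lambda>\<eta> \<tau>. r * sqrt (\<eta>\<^sup>2 + \<tau>\<^sup>2))"
  have lc: "pt \<eta> \<tau> + t *\<^sub>R axis c 1 = pt \<eta> (\<tau> + t)" for \<eta> \<tau> t by (simp add: pt algebra_simps)
  have lb: "pt \<eta> \<tau> + t *\<^sub>R axis b 1 = pt (\<eta> + t) \<tau>" for \<eta> \<tau> t by (simp add: pt algebra_simps)
  have evc: "\<forall>\<^sub>F t in nhds 0. pt \<eta> (\<tau> + t) \<in> S" if "pt \<eta> \<tau> \<in> S" for \<eta> \<tau>
    using open_line_eventually[OF S(1) that, of "axis c 1"] by (simp add: lc)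
  have evb: "\<forall>\<^sub>F t in nhds 0. pt (\<eta> + t) \<tau> \<in> S" if "pt \<eta> \<tau> \<in> S" for \<eta> \<tau>
    using open_line_eventually[OF S(1) that, of "axis b 1"] by (simp add: lb)
  have W: "((\<lambda>t. W \<eta> (\<tau> + t)) has_real_derivative r\<^sup>2 * \<tau> / W \<eta> \<tau>) (at 0)" if "pt \<eta> \<tau> \<in> S" for \<eta> \<tau>
  proof -
    have "((\<lambda>t. \<eta>\<^sup>2 + (\<tau> + t)\<^sup>2) has_real_derivative 2 * \<tau>) (at 0)"
      by (auto intro!: derivative_eq_intros)
    from DERIV_cmult[OF DERIV_chain2[OF DERIV_real_sqrt this], of r] nz[OF that]
    have "((\<lambda>t. W \<eta> (\<tau> + t)) has_real_derivative r * (inverse (sqrt (\<eta>\<^sup>2 + \<tau>\<^sup>2)) / 2 * (2 * \<tau>))) (at 0)"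
      by (simp add: W_def)
    then show ?thesis by (rule DERIV_cong) (use r in \<open>simp add: W_def power2_eq_square inverse_eq_divide\<close>)
  qed
  have Wpos: "W \<eta> \<tau> > 0" if "pt \<eta> \<tau> \<in> S" for \<eta> \<tau> using nz[OF that] r by (simp add: W_def)
  have 1: "partial_deriv c f (pt \<eta> \<tau>) = P \<eta> * (r\<^sup>2 * \<tau> * K (W \<eta> \<tau>))" if S': "pt \<eta> \<tau> \<in> S" for \<eta> \<tau>
  proof (rule partial_deriv_eqI_eventually[where g = "\<lambda>t. P \<eta> * H (W \<eta> (\<tau> + t))"])
    show "\<forall>\<^sub>F t in nhds 0. f (pt \<eta> \<tau> + t *\<^sub>R axis c 1) = P \<eta> * H (W \<eta> (\<tau> + t))"
      unfolding lc using evc[OF S'] by eventually_elim (simp add: f W_def)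
    have "(H has_real_derivative W \<eta> \<tau> * K (W \<eta> \<tau>)) (at (W \<eta> (\<tau> + 0)))"
      using H[OF S'] by (simp add: W_def)
    from DERIV_cmult[OF DERIV_chain2[OF this W[OF S']], of "P \<eta>"] Wpos[OF S']
    show "((\<lambda>t. P \<eta> * H (W \<eta> (\<tau> + t))) has_real_derivative P \<eta> * (r\<^sup>2 * \<tau> * K (W \<eta> \<tau>))) (at 0)"
      by (simp add: mult_ac)
  qed
  have 2: "partial_deriv c (\<lambda>y. partial_deriv c f y) (pt \<eta> 0) = P \<eta> * (r\<^sup>2 * K (W \<eta> 0))" if S': "pt \<eta> 0 \<in> S" for \<eta>
  proof (rule partial_deriv_eqI_eventually[where g = "\<lambda>t. P \<eta> * (r\<^sup>2 * (0 + t) * K (W \<eta> (0 + t)))"])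
    show "\<forall>\<^sub>F t in nhds 0. partial_deriv c f (pt \<eta> 0 + t *\<^sub>R axis c 1) = P \<eta> * (r\<^sup>2 * (0 + t) * K (W \<eta> (0 + t)))"
      unfolding lc using evc[OF S'] by eventually_elim (simp add: 1)
    have "(K has_real_derivative K' (W \<eta> 0)) (at (W \<eta> (0 + 0)))" using K[OF S'] by (simp add: W_def)
    note DK = DERIV_chain2[OF this W[OF S']]
    have "((\<lambda>t. r\<^sup>2 * (0 + t)) has_real_derivative r\<^sup>2) (at 0)" by (auto intro!: derivative_eq_intros)
    from DERIV_cmult[OF DERIV_mult[OF this DK], of "P \<eta>"]
    show "((\<lambda>t. P \<eta> * (r\<^sup>2 * (0 + t) * K (W \<eta> (0 + t)))) has_real_derivative P \<eta> * (r\<^sup>2 * K (W \<eta> 0))) (at 0)"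
      by simp
  qed
  show ?thesis
  proof (rule partial_deriv_eqI_eventually[where g = "\<lambda>t. P (\<eta>0 + t) * (r\<^sup>2 * K (r * (\<eta>0 + t)))"])
    have "\<forall>\<^sub>F t in nhds 0. \<eta>0 + t > 0"
      using open_line_eventually[of "{0<..}" \<eta>0 1] \<eta>0 by simp
    with evb[OF S(2)] show "\<forall>\<^sub>F t in nhds 0. partial_deriv c (\<lambda>y. partial_deriv c f y) (pt \<eta>0 0 + t *\<^sub>R axis b 1)
        = P (\<eta>0 + t) * (r\<^sup>2 * K (r * (\<eta>0 + t)))"
      unfolding lb by eventually_elim (simp add: 2 W_def)
    have DK: "(K has_real_derivative K' (r * \<eta>0)) (at (r * (\<eta>0 + 0)))" using K[OF S(2) refl] \<eta>0 by simp
    have "((\<lambda>t. r * (\<eta>0 + t)) has_real_derivative r) (at 0)" by (auto intro!: derivative_eq_intros)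
    note DK = DERIV_chain2[OF DK this]
    have DP: "(P has_real_derivative p') (at (\<eta>0 + 0))" using P by simp
    have "((\<lambda>t. \<eta>0 + t) has_real_derivative 1) (at 0)" by (auto intro!: derivative_eq_intros)
    note DP = DERIV_chain2[OF DP this]
    show "((\<lambda>t. P (\<eta>0 + t) * (r\<^sup>2 * K (r * (\<eta>0 + t)))) has_real_derivative
       p' * r\<^sup>2 * K (r * \<eta>0) + P \<eta>0 * r ^ 3 * K' (r * \<eta>0)) (at 0)"
      by (rule DERIV_cong[OF DERIV_mult[OF DP DERIV_cmult[OF DK, of "r\<^sup>2"]]])
        (simp add: power2_eq_square power3_eq_cube algebra_simps)
  qed
qed

text \<open>With r and v fixed, |y|^2 = (w^2 + v^2) / r^2 makes the spray coefficients
  \<open>X\<close> and \<open>Y\<close> functions of w alone. The last function is the spray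
  component along the axis of \<open>x\<close>; its derivative is displayed with the factor w that
  \<open>partial_plane\<close> asks for.\<close>

lemma spray_radial_derivs:
  fixes A B B' d v r :: real
  defines "S \<equiv> (\<lambda>w. expo_A A B (w / v))"
  defines "X \<equiv> (\<lambda>w. v / r\<^sup>2 + B * w / (A * r\<^sup>2)
       + d / r * (S w * (v + B * w / (2 * A)) - B * w * v\<^sup>2 / (4 * A * quad A B v w)))"
    and "Y \<equiv> (\<lambda>w. 1 / (2 * r\<^sup>2 * A) * (A * ((w\<^sup>2 + v\<^sup>2) / r\<^sup>2) - 2 * quad A B v w / r\<^sup>2
       + A * B' * v\<^sup>2 / (B * r) + d / r * (v\<^sup>2 / 2 - S w * quad A B v w)))"
    and "X1 \<equiv> (\<lambda>w. B / (A * r\<^sup>2) + d / r * (B / (2 * A)) * (v\<^sup>2 / (2 * quad A B v w) + S w))"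
  assumes nz: "r > 0" "A \<noteq> 0" "B \<noteq> 0" "B\<^sup>2 - 4 * A \<noteq> 0" "v \<noteq> 0" and q: "quad A B v w > 0" 
  shows "(S has_real_derivative B * v ^ 3 / (2 * (quad A B v w)\<^sup>2)) (at w)"
    and "(X has_real_derivative X1 w) (at w)"
    and "(X1 has_real_derivative - (d / r * (B / (2 * A)) * v\<^sup>2 * w / (quad A B v w)\<^sup>2)) (at w)"
    and "((\<lambda>w. X w * (v / r) + Y w * r) has_real_derivative
      w * (1 / r * (1 / r\<^sup>2 - 2 / (A * r\<^sup>2) - d / (A * r) * S w))) (at w)"
proof -
  define Q where "Q = quad A B v"
  define e where "e = (\<lambda>w. 1 / Q w)"
  define a where "a = 1 / A"
  define i where "i = 1 / r"
  define c where "c = B' / B"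
  have ia: "r * i = 1" "A * a = 1" "Q w * e w = 1" using nz q by (auto simp: i_def a_def e_def Q_def)
  have dQ: "(Q has_real_derivative 2 * w + B * v) (at w)"
    unfolding Q_def quad_def by (auto intro!: derivative_eq_intros)
  have de: "(e has_real_derivative - ((2 * w + B * v) * (e w)\<^sup>2)) (at w)"
  proof -
    have "(0 * b - 1 * c) / (b * b) = - (c * (1 / b)\<^sup>2)" for b c :: real by (simp add: power2_eq_square)
    from DERIV_divide[OF DERIV_const dQ, of 1, unfolded this] q show ?thesis by (simp only: e_def Q_def)
  qed
  show dS0: "(S has_real_derivative B * v ^ 3 / (2 * (quad A B v w)\<^sup>2)) (at w)"
  proof -
    have "((\<lambda>w. w / v) has_real_derivative 1 / v) (at w)" using nz by (auto intro!: derivative_eq_intros)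
    from has_real_derivative_expo_A[OF this nz(4,3) quad_div[OF nz(5), symmetric]] q nz
    have "(S has_real_derivative B / (2 * (quad A B v w / v\<^sup>2)\<^sup>2) * (1 / v)) (at w)"
      by (simp add: S_def)
    moreover have "B / (2 * (quad A B v w / v\<^sup>2)\<^sup>2) * (1 / v) = B * v ^ 3 / (2 * (quad A B v w)\<^sup>2)"
      using nz by (simp add: power2_eq_square power3_eq_cube)
    ultimately show ?thesis by simp
  qed
  have dS: "(S has_real_derivative B * v ^ 3 * (e w)\<^sup>2 / 2) (at w)"
    by (rule DERIV_cong[OF dS0]) (simp add: e_def Q_def power_divide)
  have Xe: "X = (\<lambda>w. v * i\<^sup>2 + B * w * a * i\<^sup>2 + d * i * (S w * (v + B * w * a / 2) - B * a * v\<^sup>2 / 4 * (w * e w)))"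
    unfolding X_def i_def a_def e_def Q_def by (simp add: fun_eq_iff power_divide mult_ac)
  have X1e: "X1 = (\<lambda>w. B * a * i\<^sup>2 + d * i * (B * a / 2) * (v\<^sup>2 / 2 * e w + S w))"
    unfolding X1_def i_def a_def e_def Q_def by (simp add: fun_eq_iff power_divide mult_ac)
  have Ye: "Y = (\<lambda>w. a * i\<^sup>2 / 2 * (A * ((w\<^sup>2 + v\<^sup>2) * i\<^sup>2) - 2 * Q w * i\<^sup>2
       + A * c * v\<^sup>2 * i + d * i * (v\<^sup>2 / 2 - S w * Q w)))"
    unfolding Y_def i_def a_def c_def Q_def by (simp add: fun_eq_iff power_divide mult_ac)
  have dX0: "(X has_real_derivative B * a * i\<^sup>2 + d * i * (B * v ^ 3 * (e w)\<^sup>2 / 2 * (v + B * w * a / 2) + S w * (B * a / 2)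
      - B * a * v\<^sup>2 / 4 * (e w - w * ((2 * w + B * v) * (e w)\<^sup>2)))) (at w)"
  proof -
    define k1 where "k1 = B * a / 2"
    define k2 where "k2 = B * a * v\<^sup>2 / 4"
    have "X = (\<lambda>w. v * i\<^sup>2 + B * a * i\<^sup>2 * w + d * i * (S w * (v + k1 * w) - k2 * (w * e w)))"
      unfolding Xe by (simp add: k1_def k2_def fun_eq_iff mult_ac)
    moreover have "((\<lambda>w. v * i\<^sup>2 + B * a * i\<^sup>2 * w + d * i * (S w * (v + k1 * w) - k2 * (w * e w))) has_real_derivative
       B * a * i\<^sup>2 + d * i * (B * v ^ 3 * (e w)\<^sup>2 / 2 * (v + k1 * w) + S w * k1
         - k2 * (e w - w * ((2 * w + B * v) * (e w)\<^sup>2)))) (at w)"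
      by (rule derivative_eq_intros dS de refl)+ (simp add: algebra_simps)
    ultimately show ?thesis by (simp add: k1_def k2_def mult_ac)
  qed
  show dX: "(X has_real_derivative X1 w) (at w)"
  proof (rule DERIV_cong[OF dX0])
    have "B * v ^ 3 * (e w)\<^sup>2 / 2 * (v + B * w * a / 2) - B * a * v\<^sup>2 / 4 * (e w - w * ((2 * w + B * v) * (e w)\<^sup>2))
      = B * a / 2 * (v\<^sup>2 / 2 * e w)"
    proof -
      have "a * e w = a * e w * ((w\<^sup>2 + B * v * w + A * v\<^sup>2) * e w)" using ia(3) by (simp add: Q_def quad_def)
      also have "\<dots> = (a * (w\<^sup>2 + B * v * w) + (A * a) * v\<^sup>2) * (e w)\<^sup>2" by (simp add: algebra_simps power2_eq_square)
      finally have "a * e w = (a * (w\<^sup>2 + B * v * w) + v\<^sup>2) * (e w)\<^sup>2" by (simp add: ia(2))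
      then have "2 * (v * (v + B * w * a / 2)) * (e w)\<^sup>2 - a * (e w - w * ((2 * w + B * v) * (e w)\<^sup>2)) = a * e w"
        by (simp add: algebra_simps power2_eq_square)
      then have "B * v\<^sup>2 / 4 * (2 * (v * (v + B * w * a / 2)) * (e w)\<^sup>2 - a * (e w - w * ((2 * w + B * v) * (e w)\<^sup>2)))
         = B * v\<^sup>2 / 4 * (a * e w)" by simp
      then show ?thesis by (simp add: algebra_simps power2_eq_square power3_eq_cube add_divide_distrib)
    qed
    then have "B * a * i\<^sup>2 + d * i * ((B * v ^ 3 * (e w)\<^sup>2 / 2 * (v + B * w * a / 2) - B * a * v\<^sup>2 / 4 * (e w - w * ((2 * w + B * v) * (e w)\<^sup>2)))
       + S w * (B * a / 2)) = X1 w"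
      unfolding X1e by (simp only:) (simp add: algebra_simps)
    then show "B * a * i\<^sup>2 + d * i * (B * v ^ 3 * (e w)\<^sup>2 / 2 * (v + B * w * a / 2) + S w * (B * a / 2)
      - B * a * v\<^sup>2 / 4 * (e w - w * ((2 * w + B * v) * (e w)\<^sup>2))) = X1 w"
      by (simp add: algebra_simps)
  qed
  show "(X1 has_real_derivative - (d / r * (B / (2 * A)) * v\<^sup>2 * w / (quad A B v w)\<^sup>2)) (at w)"
  proof -
    have "(X1 has_real_derivative d * i * (B * a / 2) * (v\<^sup>2 / 2 * (- ((2 * w + B * v) * (e w)\<^sup>2)) + B * v ^ 3 * (e w)\<^sup>2 / 2)) (at w)"
      unfolding X1e by (rule derivative_eq_intros dS de refl)+ (simp add: algebra_simps)
    moreover have "v\<^sup>2 / 2 * (- ((2 * w + B * v) * (e w)\<^sup>2)) + B * v ^ 3 * (e w)\<^sup>2 / 2 = - (v\<^sup>2 * w * (e w)\<^sup>2)"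
      by (simp add: algebra_simps power2_eq_square power3_eq_cube diff_divide_distrib)
    ultimately show ?thesis
      by (simp add: i_def a_def e_def Q_def power_divide mult_ac)
  qed
  have dY: "(Y has_real_derivative a * i\<^sup>2 / 2 * (2 * A * w * i\<^sup>2 - 2 * (2 * w + B * v) * i\<^sup>2
      - d * i * (B * v ^ 3 * (e w)\<^sup>2 / 2 * Q w + S w * (2 * w + B * v)))) (at w)"
    unfolding Ye by (rule derivative_eq_intros dS dQ refl)+ (simp add: algebra_simps)
  have "((\<lambda>w. X w * (v * i) + Y w * r) has_real_derivative
      X1 w * (v * i) + a * i\<^sup>2 / 2 * (2 * A * w * i\<^sup>2 - 2 * (2 * w + B * v) * i\<^sup>2
      - d * i * (B * v ^ 3 * (e w)\<^sup>2 / 2 * Q w + S w * (2 * w + B * v))) * r) (at w)"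
    by (rule derivative_eq_intros dX dY refl)+ simp
  moreover have "X1 w * (v * i) + a * i\<^sup>2 / 2 * (2 * A * w * i\<^sup>2 - 2 * (2 * w + B * v) * i\<^sup>2
      - d * i * (B * v ^ 3 * (e w)\<^sup>2 / 2 * Q w + S w * (2 * w + B * v))) * r
     = w * (i * (i\<^sup>2 - 2 * a * i\<^sup>2 - d * a * i * S w))"
  proof -
    have "Q w * (e w)\<^sup>2 = (Q w * e w) * e w" by (simp only: power2_eq_square mult.assoc)
    then have "Q w * (e w)\<^sup>2 = e w" by (simp only: ia(3) mult_1_left)
    then have 1: "B * v ^ 3 * (e w)\<^sup>2 / 2 * Q w = B * v ^ 3 / 2 * e w" by (simp add: mult_ac)
    have 2: "a * i\<^sup>2 / 2 * Z * r = a * i / 2 * Z" for Z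
    proof -
      have "a * i\<^sup>2 / 2 * Z * r = a * (i * (r * i)) / 2 * Z" by (simp only: power2_eq_square) simp
      then show ?thesis by (simp only: ia(1) mult_1_right)
    qed
    have 3: "a * i / 2 * (2 * A * w * i\<^sup>2 + Z) = (A * a) * (w * i ^ 3) + a * i / 2 * Z" for Z
      by (simp add: algebra_simps power2_eq_square power3_eq_cube)
    have 4: "2 * A * w * i\<^sup>2 - Z1 - Z2 = 2 * A * w * i\<^sup>2 + (- Z1 - Z2)" for Z1 Z2 by simp
    show ?thesis unfolding X1e 1 2 4 3 ia(2)
      by (simp add: algebra_simps power2_eq_square power3_eq_cube add_divide_distrib diff_divide_distrib)
  qed
  ultimately show "((\<lambda>w. X w * (v / r) + Y w * r) has_real_derivative
      w * (1 / r * (1 / r\<^sup>2 - 2 / (A * r\<^sup>2) - d / (A * r) * S w))) (at w)"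
    by (simp add: i_def a_def power_divide)
qed

context spherical_metric
begin

text \<open>A component of the Landsberg tensor that detects \<open>defect\<close>. The directions of differentiation lie in
  a plane orthogonal to \<open>x\<close>, so \<open>v\<close> stays fixed and \<open>w\<close> is the only variable.\<close>

lemma landsberg_plane:
  fixes a b c :: 'n
  assumes dist: "a \<noteq> b" "a \<noteq> c" "b \<noteq> c" and x: "x = r *\<^sub>R axis a 1"
    and y: "y = (v / r) *\<^sub>R axis a 1 + \<eta> *\<^sub>R axis b 1 + 0 *\<^sub>R axis c 1"
    and r: "r > 0" and D: "(x, y) \<in> dom" and \<eta>: "\<eta> > 0"
  shows "landsberg_tensor F x y b c c = mm x y * defect r * r\<^sup>2 * B r * v\<^sup>2 / (4 * A r * qq x y)"
proof -
  define S where "S = {y. (x, y) \<in> dom}"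
  define pt where "pt = (\<lambda>\<eta> \<tau>. (v / r) *\<^sub>R axis a (1::real) + \<eta> *\<^sub>R axis b 1 + \<tau> *\<^sub>R axis c 1)"
  note pl = plane_dom[OF dist x refl r]
  have y_pt: "y = pt \<eta> 0" by (simp add: y pt_def)
  have S: "open S" "pt \<eta> 0 \<in> S" using D open_dom_y[of x] by (auto simp: S_def y_pt)
  define Ss where "Ss = (\<lambda>w. expo_A (A r) (B r) (w / v))"
  define X where "X = (\<lambda>w. v / r\<^sup>2 + B r * w / (A r * r\<^sup>2)
       + defect r / r * (Ss w * (v + B r * w / (2 * A r)) - B r * w * v\<^sup>2 / (4 * A r * quad (A r) (B r) v w)))"
  define Y where "Y = (\<lambda>w. 1 / (2 * r\<^sup>2 * A r) * (A r * ((w\<^sup>2 + v\<^sup>2) / r\<^sup>2) - 2 * quad (A r) (B r) v w / r\<^sup>2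
       + A r * B' r * v\<^sup>2 / (B r * r) + defect r / r * (v\<^sup>2 / 2 - Ss w * quad (A r) (B r) v w)))"
  define X1 where "X1 = (\<lambda>w. B r / (A r * r\<^sup>2) + defect r / r * (B r / (2 * A r)) * (v\<^sup>2 / (2 * quad (A r) (B r) v w) + Ss w))"
  define X2 where "X2 = (\<lambda>w. - (defect r / r * (B r / (2 * A r)) * v\<^sup>2 * w / (quad (A r) (B r) v w)\<^sup>2))"
  have inS: "r \<in> J" "v \<noteq> 0" "\<eta>\<^sup>2 + \<tau>\<^sup>2 > 0" "quad (A r) (B r) v (r * sqrt (\<eta>\<^sup>2 + \<tau>\<^sup>2)) > 0"
    if "pt \<eta> \<tau> \<in> S" for \<eta> \<tau>
  proof -
    have "(x, pt \<eta> \<tau>) \<in> dom" using that by (simp add: S_def)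
    note Dt = domD(1-4)[OF this]
    show "r \<in> J" "v \<noteq> 0" "quad (A r) (B r) v (r * sqrt (\<eta>\<^sup>2 + \<tau>\<^sup>2)) > 0" "\<eta>\<^sup>2 + \<tau>\<^sup>2 > 0"
      using Dt r unfolding pt_def qq_def pl by (simp_all add: zero_less_mult_iff)
  qed
  note nz = A_nz[OF inS(1)[OF S(2)]] B_nz[OF inS(1)[OF S(2)]] disc_nz[OF inS(1)[OF S(2)]]
  note nz' = r nz inS(2)[OF S(2)]
  have deriv: "(Ss has_real_derivative B r * v ^ 3 / (2 * (quad (A r) (B r) v w)\<^sup>2)) (at w)"
    "(X has_real_derivative X1 w) (at w)" "(X1 has_real_derivative X2 w) (at w)"
    "((\<lambda>w. X w * (v / r) + Y w * r) has_real_derivative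
         w * (1 / r * (1 / r\<^sup>2 - 2 / (A r * r\<^sup>2) - defect r / (A r * r) * Ss w))) (at w)"
    if "quad (A r) (B r) v w > 0" for w
    unfolding Ss_def X_def X1_def X2_def Y_def
    using that by (fact spray_radial_derivs[OF nz'])+
  have spray: "spray_X x (pt \<eta> \<tau>) = X (r * sqrt (\<eta>\<^sup>2 + \<tau>\<^sup>2))" "spray_Y x (pt \<eta> \<tau>) = Y (r * sqrt (\<eta>\<^sup>2 + \<tau>\<^sup>2))"
    for \<eta> \<tau>
  proof -
    have "(v / r)\<^sup>2 + \<eta>\<^sup>2 + \<tau>\<^sup>2 = ((r * sqrt (\<eta>\<^sup>2 + \<tau>\<^sup>2))\<^sup>2 + v\<^sup>2) / r\<^sup>2"
      using r by (simp add: power_mult_distrib power_divide add_divide_distrib)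
    then show "spray_X x (pt \<eta> \<tau>) = X (r * sqrt (\<eta>\<^sup>2 + \<tau>\<^sup>2))" "spray_Y x (pt \<eta> \<tau>) = Y (r * sqrt (\<eta>\<^sup>2 + \<tau>\<^sup>2))"
      unfolding pt_def spray_X_def spray_Y_def qq_def ss_def X_def Y_def Ss_def pl by (simp_all only:)
  qed
  have G: "spray_coeff F x (pt \<eta> \<tau>) $ a = 1 * (X (r * sqrt (\<eta>\<^sup>2 + \<tau>\<^sup>2)) * (v / r) + Y (r * sqrt (\<eta>\<^sup>2 + \<tau>\<^sup>2)) * r)"
    "spray_coeff F x (pt \<eta> \<tau>) $ b = \<eta> * X (r * sqrt (\<eta>\<^sup>2 + \<tau>\<^sup>2))" if "pt \<eta> \<tau> \<in> S" for \<eta> \<tau>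
  proof -
    have "(x, pt \<eta> \<tau>) \<in> dom" using that by (simp add: S_def)
    note eq = spray_coeff_eq[OF this, unfolded spray]
    show "spray_coeff F x (pt \<eta> \<tau>) $ a = 1 * (X (r * sqrt (\<eta>\<^sup>2 + \<tau>\<^sup>2)) * (v / r) + Y (r * sqrt (\<eta>\<^sup>2 + \<tau>\<^sup>2)) * r)"
      "spray_coeff F x (pt \<eta> \<tau>) $ b = \<eta> * X (r * sqrt (\<eta>\<^sup>2 + \<tau>\<^sup>2))"
      unfolding eq vector_add_component vector_scaleR_component real_scaleR_def
      unfolding pt_def pl by simp_all
  qed
  define q where "q = quad (A r) (B r) v (r * \<eta>)"
  have q: "q > 0" "qq x y = q"
    using inS(4)[OF S(2)] \<eta> unfolding q_def qq_def y pl by simp_all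
  have Wp: "w > 0" if "pt \<eta> \<tau> \<in> S" "w = r * sqrt (\<eta>\<^sup>2 + \<tau>\<^sup>2)" for \<eta> \<tau> w using inS(3)[OF that(1)] that(2) r by simp
  \<comment> \<open>The \<open>a\<close>-component of the spray depends on the orthogonal part of
    \<open>y\<close> only through w, hence the prefactor 1.\<close>
  have Ba: "berwald_curvature F x y a b c c = 0 * r\<^sup>2 * (1 / r * (1 / r\<^sup>2 - 2 / (A r * r\<^sup>2) - defect r / (A r * r) * Ss (r * \<eta>)))
     + 1 * r ^ 3 * (1 / r * (- (defect r / (A r * r) * (B r * v ^ 3 / (2 * (quad (A r) (B r) v (r * \<eta>))\<^sup>2)))))"
    unfolding berwald_curvature_def y_pt
  proof (rule partial_plane[where S = S and P = "\<lambda>_. 1" and H = "\<lambda>w. X w * (v / r) + Y w * r"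
        and K = "\<lambda>w. 1 / r * (1 / r\<^sup>2 - 2 / (A r * r\<^sup>2) - defect r / (A r * r) * Ss w)"
        and K' = "\<lambda>w. 1 / r * (- (defect r / (A r * r) * (B r * v ^ 3 / (2 * (quad (A r) (B r) v w)\<^sup>2))))",
        OF pt_def S \<eta> r inS(3) G(1)])
    fix \<eta> \<tau> w assume A: "pt \<eta> \<tau> \<in> S" "w = r * sqrt (\<eta>\<^sup>2 + \<tau>\<^sup>2)"
    show "((\<lambda>w. X w * (v / r) + Y w * r) has_real_derivative
         w * (1 / r * (1 / r\<^sup>2 - 2 / (A r * r\<^sup>2) - defect r / (A r * r) * Ss w))) (at w)"
      using inS(4)[OF A(1), folded A(2)] by (rule deriv(4))
    show "((\<lambda>w. 1 / r * (1 / r\<^sup>2 - 2 / (A r * r\<^sup>2) - defect r / (A r * r) * Ss w)) has_real_derivative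
         1 / r * (- (defect r / (A r * r) * (B r * v ^ 3 / (2 * (quad (A r) (B r) v w)\<^sup>2))))) (at w)"
      using DERIV_cmult[OF DERIV_diff[OF DERIV_const DERIV_cmult[OF deriv(1)[OF inS(4)[OF A(1), folded A(2)]]]],
          of "1 / r" "1 / r\<^sup>2 - 2 / (A r * r\<^sup>2)" "defect r / (A r * r)"]
      by (simp only: diff_0)
  qed (auto intro!: derivative_eq_intros)
  \<comment> \<open>As \<open>x\<close> has no \<open>b\<close>-component, the
    \<open>b\<close>-component of the spray is \<open>\<eta>\<close> times \<open>X\<close>, hence
    the prefactor \<open>\<eta>\<close>.\<close>
  have Bb: "berwald_curvature F x y b b c c = 1 * r\<^sup>2 * (X1 (r * \<eta>) / (r * \<eta>))
     + \<eta> * r ^ 3 * ((X2 (r * \<eta>) * (r * \<eta>) - X1 (r * \<eta>) * 1) / ((r * \<eta>) * (r * \<eta>)))"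
    unfolding berwald_curvature_def y_pt
  proof (rule partial_plane[where S = S and P = "\<lambda>\<eta>. \<eta>" and H = X
        and K = "\<lambda>w. X1 w / w" and K' = "\<lambda>w. (X2 w * w - X1 w * 1) / (w * w)",
        OF pt_def S \<eta> r inS(3) G(2)])
    fix \<eta> \<tau> w assume A: "pt \<eta> \<tau> \<in> S" "w = r * sqrt (\<eta>\<^sup>2 + \<tau>\<^sup>2)"
    show "(X has_real_derivative w * (X1 w / w)) (at w)"
      using deriv(2)[OF inS(4)[OF A(1), folded A(2)]] Wp[OF A] by simp
    show "((\<lambda>w. X1 w / w) has_real_derivative (X2 w * w - X1 w * 1) / (w * w)) (at w)"
      using DERIV_divide[OF deriv(3)[OF inS(4)[OF A(1), folded A(2)]] DERIV_ident] Wp[OF A] by simp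
  qed (auto intro!: derivative_eq_intros)
  have Ba': "berwald_curvature F x y a b c c = - (defect r * r * B r * v ^ 3 / (2 * A r * q\<^sup>2))"
    unfolding Ba q_def[symmetric] using r by (simp add: power3_eq_cube mult_ac)
  have Bb': "berwald_curvature F x y b b c c = - (defect r * r * B r * v\<^sup>2 * (r * \<eta>) / (2 * A r * q\<^sup>2))"
  proof -
    have "1 * r\<^sup>2 * (t1 / (r * \<eta>)) + \<eta> * r ^ 3 * ((t2 * (r * \<eta>) - t1 * 1) / ((r * \<eta>) * (r * \<eta>))) = r\<^sup>2 * t2" for t1 t2
      using r \<eta> by (simp add: diff_divide_distrib power2_eq_square power3_eq_cube algebra_simps)
    then have "berwald_curvature F x y b b c c = r\<^sup>2 * X2 (r * \<eta>)" unfolding Bb by (simp only:)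
    then show ?thesis unfolding X2_def q_def[symmetric] using r by (simp add: power2_eq_square mult_ac)
  qed
  have l: "ll x y $ a = r * (B r * (r * \<eta>) + A r * v)" "ll x y $ b = r * (r * \<eta>)"
    unfolding ll_def kk_def vector_add_component vector_scaleR_component y pl
    using r \<eta> dist by (simp_all add: axis_def power2_eq_square algebra_simps)
  \<comment> \<open>The gradient of \<open>F\<close> lies in the span of \<open>x\<close> and
    \<open>y\<close>, so only the indices \<open>a\<close> and \<open>b\<close> contribute to the
    contraction.\<close>
  have l0: "ll x y $ i = 0" if "i \<noteq> a" "i \<noteq> b" for i
  proof -
    have "x $ i = 0" "y $ i = 0" using that by (auto simp: x y axis_def)
    then show ?thesis by (simp add: ll_def)
  qed
  have "(\<Sum>i\<in>UNIV. berwald_curvature F x y i b c c * partial_deriv i (F x) y)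
     = (\<Sum>i\<in>{a, b}. berwald_curvature F x y i b c c * partial_deriv i (F x) y)"
    by (rule sum.mono_neutral_right) (auto simp: partial_F[OF D] l0)
  also have "\<dots> = mm x y / F x y * (berwald_curvature F x y a b c c * ll x y $ a + berwald_curvature F x y b b c c * ll x y $ b)"
    using dist(1) by (simp add: partial_F[OF D] algebra_simps add_divide_distrib)
  also have "berwald_curvature F x y a b c c * ll x y $ a + berwald_curvature F x y b b c c * ll x y $ b
     = - (defect r * r\<^sup>2 * B r * v\<^sup>2 / (2 * A r * q))"
  proof -
    have "berwald_curvature F x y a b c c * ll x y $ a + berwald_curvature F x y b b c c * ll x y $ b
      = - (defect r * r\<^sup>2 * B r * v\<^sup>2 / (2 * A r * q\<^sup>2)) * (v * (B r * (r * \<eta>) + A r * v) + (r * \<eta>) * (r * \<eta>))"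
      unfolding Ba' Bb' l(1,2) by (simp add: power2_eq_square power3_eq_cube algebra_simps add_divide_distrib)
    \<comment> \<open>The weights recombine exactly to the radicand, which is positive on the
      domain, so no zero other than that of \<open>defect\<close> is introduced.\<close>
    also have "v * (B r * (r * \<eta>) + A r * v) + (r * \<eta>) * (r * \<eta>) = q"
      by (simp add: q_def quad_def power2_eq_square algebra_simps)
    finally show ?thesis using q(1) by (simp add: power2_eq_square)
  qed
  finally have "landsberg_tensor F x y b c c = - 1/2 * F x y * (mm x y / F x y * - (defect r * r\<^sup>2 * B r * v\<^sup>2 / (2 * A r * q)))"
    by (simp only: landsberg_tensor_def)
  then show ?thesis using F_pos[OF D] q(2) by simp
qed

end

section \<open>Landsberg and Berwald conditions in terms of the defect\<close>

text \<open>The square dominates beyond this bound. This provides a test point of the domain with v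
  = 1 over every radius in \<open>J\<close>.\<close>

lemma quad_pos_large:
  assumes "w \<ge> 1 + \<bar>B\<bar> + \<bar>A\<bar>"
  shows "quad A B 1 w > 0"
proof -
  have "w * w \<ge> (1 + \<bar>B\<bar> + \<bar>A\<bar>) * w" using assms by (intro mult_right_mono) auto
  moreover have "\<bar>A\<bar> * w \<ge> \<bar>A\<bar> * 1" using assms by (intro mult_left_mono) auto
  moreover have "\<bar>B * w\<bar> = \<bar>B\<bar> * w" using assms by (simp add: abs_mult)
  moreover have "w > 0" using assms by simp
  ultimately have "w * w + B * w + A > 0" by (simp add: algebra_simps abs_le_iff) linarith
  then show ?thesis by (simp add: quad_def power2_eq_square)
qed

context spherical_metric
begin

lemma plane_point:
  fixes a b c :: 'n
  assumes dist: "a \<noteq> b" "a \<noteq> c" "b \<noteq> c" and r: "r \<in> J"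
  obtains \<eta> where "\<eta> > 0" "(r *\<^sub>R axis a (1::real), (1 / r) *\<^sub>R axis a (1::real) + \<eta> *\<^sub>R axis b 1 + 0 *\<^sub>R axis c 1) \<in> dom"
proof -
  have r0: "r > 0" using r J_pos by auto
  define w where "w = 1 + \<bar>B r\<bar> + \<bar>A r\<bar>"
  have w: "w > 0" "quad (A r) (B r) 1 w > 0" using quad_pos_large[of "B r" "A r" w] by (simp_all add: w_def)
  have pos: "w / r > 0" using w r0 by simp
  define y where "y = (1 / r) *\<^sub>R axis a (1::real) + (w / r) *\<^sub>R axis b 1 + 0 *\<^sub>R axis c 1"
  note pl = plane_dom[OF dist refl y_def r0]
  have "area (r *\<^sub>R axis a (1::real)) y = w"
    unfolding pl(4) using pos r0 w(1) by simp
  then have "(r *\<^sub>R axis a (1::real), y) \<in> dom"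
    using w r unfolding dom_def mem_Collect_eq prod.case qq_def pl(1,5) by simp
  with pos show thesis unfolding y_def by (rule that)
qed

lemma exists_axes:
  assumes "CARD('n) \<ge> 3"
  obtains a b c :: 'n where "a \<noteq> b" "a \<noteq> c" "b \<noteq> c"
proof -
  obtain T :: "'n set" where "card T = 3" using obtain_subset_with_card_n[OF assms] by blast
  then show thesis using that by (auto simp: card_3_iff)
qed

lemma landsberg_iff_defect_0:
  assumes "CARD('n) \<ge> 3"
  shows "landsberg_on dom F \<longleftrightarrow> (\<forall>r\<in>J. defect r = 0)"
proof
  assume L: "landsberg_on dom F"
  show "\<forall>r\<in>J. defect r = 0"
  proof
    fix r assume r: "r \<in> J"
    obtain a b c :: 'n where dist: "a \<noteq> b" "a \<noteq> c" "b \<noteq> c" using exists_axes[OF assms] .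
    obtain \<eta> where \<eta>: "\<eta> > 0" "(r *\<^sub>R axis a (1::real), (1 / r) *\<^sub>R axis a (1::real) + \<eta> *\<^sub>R axis b 1 + 0 *\<^sub>R axis c 1) \<in> dom"
      using plane_point[OF dist r] .
    have r0: "r > 0" using r J_pos by auto
    show "defect r = 0"
      using landsberg_plane[OF dist refl refl r0 \<eta>(2,1)] L \<eta>(2) domD(4,10)[OF \<eta>(2)] A_nz[OF r] B_nz[OF r] r0
      by (fastforce simp: landsberg_on_def)
  qed
next
  assume "\<forall>r\<in>J. defect r = 0"
  then show "landsberg_on dom F" by (auto simp: landsberg_on_def intro!: landsberg_defect_0 dest: domD(1))
qed

lemma not_berwaldian_defect_0:
  assumes "CARD('n) \<ge> 3" "r \<in> J" "defect r = 0"
  shows "\<not> berwaldian_on dom F"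
proof -
  obtain a b c :: 'n where dist: "a \<noteq> b" "a \<noteq> c" "b \<noteq> c" using exists_axes[OF assms(1)] .
  obtain \<eta> where \<eta>: "\<eta> > 0" "(r *\<^sub>R axis a (1::real), (1 / r) *\<^sub>R axis a (1::real) + \<eta> *\<^sub>R axis b 1 + 0 *\<^sub>R axis c 1) \<in> dom"
    using plane_point[OF dist assms(2)] .
  have r0: "r > 0" using assms(2) J_pos by auto
  show ?thesis
    using berwald_curvature_plane[OF dist refl refl r0 \<eta>(2) assms(3)] \<eta>(2)
    by (fastforce simp: berwaldian_on_def)
qed

end

section \<open>Agreement with the stated formulas\<close>

lemma arctanh_minus: "arctanh (- z) = - arctanh z"
proof -
  have "(1 - z) / (1 + z) = inverse ((1 + z) / (1 - z))" by simp
  then have "\<bar>(1 - z) / (1 + z)\<bar> = inverse \<bar>(1 + z) / (1 - z)\<bar>" by (simp only: abs_inverse)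
  then show ?thesis by (simp add: arctanh_def ln_inverse del: abs_divide inverse_divide)
qed

lemma arctanh_nonneg:
  assumes "z > 1"
  shows "arctanh z \<ge> 0"
proof -
  have "1 \<le> (z + 1) / (z - 1)" using assms by (simp add: field_simps)
  moreover have "\<bar>(1 + z) / (1 - z)\<bar> = (z + 1) / (z - 1)" using assms by (simp add: abs_divide)
  ultimately show ?thesis unfolding arctanh_def by simp
qed

lemma phi_exponent_eq:
  assumes "s \<noteq> 0"
  shows "phi_exponent a1 a2 r s = expo (a1 + 1) a2 (sqrt (r\<^sup>2 - s\<^sup>2) / s)"
proof -
  have 1: "(a2 * s + 2 * k) / (s * e) = (a2 + 2 * (k / s)) / e" for k e
    using assms by (simp add: field_simps)
  have 2: "a2\<^sup>2 - 4 * (a1 + 1) = a2\<^sup>2 - 4 * a1 - 4" "4 * a1 + 4 - a2\<^sup>2 = - (a2\<^sup>2 - 4 * a1 - 4)" by simp_all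
  show ?thesis
    unfolding phi_exponent_def expo_def arc_quot_def 1 2 by simp
qed

text \<open>The discriminant becomes a2^2 (1 - 4 b), whose root contributes |a2|. The sign of
  \<open>a2\<close> is absorbed by the oddness of \<open>arctan\<close> and
  \<open>arctanh\<close>.\<close>

lemma phi_eq_phi_special:
  assumes "a2 \<noteq> 0" and "a1 = b * a2\<^sup>2 - 1"
  shows "phi a1 a2 r s = phi_special b a2 r s"
proof -
  define k where "k = a2 * s + 2 * sqrt (r\<^sup>2 - s\<^sup>2)"
  have d: "a2\<^sup>2 - 4 * a1 - 4 = a2\<^sup>2 * (1 - 4 * b)" "4 * a1 + 4 - a2\<^sup>2 = a2\<^sup>2 * (4 * b - 1)"
    by (simp_all add: assms(2) algebra_simps)
  have sg: "a2\<^sup>2 * (1 - 4 * b) < 0 \<longleftrightarrow> 1 - 4 * b < 0"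
    using assms(1) by (simp add: mult_less_0_iff)
  have odd: "a2 / (\<bar>a2\<bar> * e) * f (k / (s * (\<bar>a2\<bar> * e))) = 1 / e * f (k / (a2 * s * e))"
    if "\<And>z. f (- z) = - f z" for f :: "real \<Rightarrow> real" and e
  proof (cases "a2 > 0")
    case True
    then show ?thesis by (simp add: mult_ac)
  next
    case False
    then have "k / (s * (\<bar>a2\<bar> * e)) = - (k / (a2 * s * e))" "a2 / (\<bar>a2\<bar> * e) = - (1 / e)"
      using assms(1) by (simp_all add: mult_ac)
    then show ?thesis using that by simp
  qed
  have "phi_exponent a1 a2 r s = (if 1 - 4 * b < 0
          then - (1 / sqrt (4 * b - 1)) * arctan (k / (a2 * s * sqrt (4 * b - 1)))
          else 1 / sqrt (1 - 4 * b) * arctanh (k / (a2 * s * sqrt (1 - 4 * b))))"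
    unfolding phi_exponent_def d sg real_sqrt_mult real_sqrt_abs k_def[symmetric]
    using odd[of arctan "sqrt (4 * b - 1)"] odd[of arctanh "sqrt (1 - 4 * b)"]
    by (simp add: arctan_minus arctanh_minus)
  then show ?thesis unfolding phi_def phi_special_def phi_radicand_def assms(2) k_def by simp
qed

context spherical
begin

lemma F_domain_eq_dom:
  assumes "\<And>r. r \<in> J \<Longrightarrow> A r = c1 r + 1" "\<And>r. r \<in> J \<Longrightarrow> B r = c2 r"
  shows "F_domain J c1 c2 = dom"
    and "(x, y) \<in> dom \<Longrightarrow> F_metric c1 c2 x y = sqrt (qq x y * mm x y)"
proof -
  \<comment> \<open>Multiplication by u = |y| turns s and sqrt (r^2 - s^2) into v and w. The shift A
    = c1 + 1 comes from r^2 u^2 = w^2 + v^2.\<close>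
  have sq: "norm y * sqrt ((norm x)\<^sup>2 - (s_var x y)\<^sup>2) = area x y" "(norm y)\<^sup>2 * phi_radicand (c1 (norm x)) (c2 (norm x)) (norm x) (s_var x y) = qq x y"
    if y: "y \<noteq> 0" and J: "norm x \<in> J" for x y :: "real^'n"
  proof -
    have 1: "norm y * s_var x y = x \<bullet> y" using y by (simp add: s_var_def)
    have "norm y * sqrt ((norm x)\<^sup>2 - (s_var x y)\<^sup>2) = sqrt ((norm y)\<^sup>2 * ((norm x)\<^sup>2 - (s_var x y)\<^sup>2))"
      by (simp add: real_sqrt_mult)
    also have "(norm y)\<^sup>2 * ((norm x)\<^sup>2 - (s_var x y)\<^sup>2) = (norm x)\<^sup>2 * (norm y)\<^sup>2 - (norm y * s_var x y)\<^sup>2"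
      by (simp add: power_mult_distrib algebra_simps)
    finally show 2: "norm y * sqrt ((norm x)\<^sup>2 - (s_var x y)\<^sup>2) = area x y"
      by (simp add: area_def 1 power2_norm_eq_inner)
    have "(norm y)\<^sup>2 * phi_radicand (c1 (norm x)) (c2 (norm x)) (norm x) (s_var x y)
      = (norm x)\<^sup>2 * (norm y)\<^sup>2 + c1 (norm x) * (norm y * s_var x y)\<^sup>2
        + c2 (norm x) * (norm y * s_var x y) * (norm y * sqrt ((norm x)\<^sup>2 - (s_var x y)\<^sup>2))"
      by (simp add: phi_radicand_def power2_eq_square algebra_simps)
    also have "\<dots> = qq x y" unfolding 1 2 unfolding q_eq area_sq power2_norm_eq_inner
      using assms[OF J] by (simp add: algebra_simps)
    finally show "(norm y)\<^sup>2 * phi_radicand (c1 (norm x)) (c2 (norm x)) (norm x) (s_var x y) = qq x y" .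
  qed
  have iff: "y \<noteq> 0 \<and> admissible_rs J c1 c2 (norm x) (s_var x y) \<longleftrightarrow> (x, y) \<in> dom" for x y :: "real^'n"
  proof (cases "y \<noteq> 0 \<and> norm x \<in> J")
    case True
    then have y: "norm y > 0" "y \<noteq> 0" and J: "norm x \<in> J" by auto
    note sq = sq[OF y(2) J]
    have "\<bar>s_var x y\<bar> < norm x \<longleftrightarrow> (norm x)\<^sup>2 - (s_var x y)\<^sup>2 > 0"
      using abs_le_square_iff[of "norm x" "s_var x y"] by (cases "norm x \<le> \<bar>s_var x y\<bar>") auto
    also have "\<dots> \<longleftrightarrow> area x y > 0" unfolding sq(1)[symmetric] using y(1) by (simp add: zero_less_mult_iff)
    finally have 1: "\<bar>s_var x y\<bar> < norm x \<longleftrightarrow> area x y > 0" .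
    have 2: "phi_radicand (c1 (norm x)) (c2 (norm x)) (norm x) (s_var x y) > 0 \<longleftrightarrow> qq x y > 0"
      unfolding sq(2)[symmetric] using y by (simp add: zero_less_mult_iff)
    have 3: "0 < \<bar>s_var x y\<bar> \<longleftrightarrow> x \<bullet> y \<noteq> 0" using y by (simp add: s_var_def zero_less_divide_iff)
    show ?thesis unfolding admissible_rs_def dom_def using 1 2 3 y J by simp
  next
    case False
    then show ?thesis by (auto simp: dom_def admissible_rs_def)
  qed
  then show "F_domain J c1 c2 = dom" by (auto simp: F_domain_def)
  assume D: "(x, y) \<in> dom"
  note d = domD[OF D]
  have y: "norm y > 0" using d(6) by simp
  have s: "s_var x y \<noteq> 0" using d(2) y by (simp add: s_var_def)
  have t: "sqrt ((norm x)\<^sup>2 - (s_var x y)\<^sup>2) / s_var x y = area x y / (x \<bullet> y)"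
    unfolding sq(1)[OF d(6,1), symmetric] using y by (simp add: s_var_def)
  have "sqrt (qq x y * mm x y) = sqrt (qq x y) * sqrt ((exp (expo (A (norm x)) (B (norm x)) (area x y / (x \<bullet> y))))\<^sup>2)"
    by (simp add: real_sqrt_mult mm_def conf_def exp_double)
  also have "sqrt (qq x y) = norm y * sqrt (phi_radicand (c1 (norm x)) (c2 (norm x)) (norm x) (s_var x y))"
    unfolding sq(2)[OF d(6,1), symmetric] by (simp add: real_sqrt_mult)
  finally show "F_metric c1 c2 x y = sqrt (qq x y * mm x y)"
    using assms[OF d(1)] by (simp add: F_metric_def phi_def phi_exponent_eq[OF s] t)
qed

text \<open>Connectedness of \<open>J\<close> turns the vanishing derivative of A / B^2 into
  constancy. Conversely, the relation holds near each point of the open set \<open>J\<close> and can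
  be differentiated there.\<close>

lemma defect_0_iff:
  assumes "is_interval J"
  shows "(\<forall>r\<in>J. defect r = 0) \<longleftrightarrow> (\<exists>b. \<forall>r\<in>J. A r = b * (B r)\<^sup>2)"
proof
  assume *: "\<forall>r\<in>J. defect r = 0"
  have "((\<lambda>r. A r / (B r)\<^sup>2) has_real_derivative 0) (at r within J)" if r: "r \<in> J" for r
  proof -
    have B: "B r \<noteq> 0" using B_nz[OF r] .
    have "((\<lambda>r. A r / (B r)\<^sup>2) has_real_derivative
       (A' r * (B r)\<^sup>2 - A r * (2 * B r * B' r)) / ((B r)\<^sup>2 * (B r)\<^sup>2)) (at r)"
      using B by (auto intro!: derivative_eq_intros A_deriv[OF r] B_deriv[OF r])
    moreover have "A' r * (B r)\<^sup>2 - A r * (2 * B r * B' r) = defect r * (B r)\<^sup>2"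
      using B by (simp add: defect_def power2_eq_square algebra_simps)
    ultimately show ?thesis using * r by (simp add: has_field_derivative_at_within)
  qed
  then obtain b where "\<forall>r\<in>J. A r / (B r)\<^sup>2 = b"
    using has_field_derivative_zero_constant[of J "\<lambda>r. A r / (B r)\<^sup>2"] is_interval_convex[OF assms] by blast
  then have "\<forall>r\<in>J. A r = b * (B r)\<^sup>2" using B_nz by (auto simp: field_simps)
  then show "\<exists>b. \<forall>r\<in>J. A r = b * (B r)\<^sup>2" ..
next
  assume "\<exists>b. \<forall>r\<in>J. A r = b * (B r)\<^sup>2"
  then obtain b where b: "\<And>r. r \<in> J \<Longrightarrow> A r = b * (B r)\<^sup>2" by blast
  show "\<forall>r\<in>J. defect r = 0"
  proof
    fix r assume r: "r \<in> J"
    have "((\<lambda>r. b * (B r)\<^sup>2) has_real_derivative b * (2 * B r * B' r)) (at r)"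
      by (auto intro!: derivative_eq_intros B_deriv[OF r])
    then have "(A has_real_derivative b * (2 * B r * B' r)) (at r)"
      by (rule has_field_derivative_transform_within_open[OF _ open_J r]) (simp add: b)
    then have "A' r = b * (2 * B r * B' r)" using A_deriv[OF r] by (rule DERIV_unique[rotated])
    then show "defect r = 0" using B_nz[OF r] b[OF r] by (simp add: defect_def power2_eq_square)
  qed
qed

lemma spray_P_Q:
  assumes "(x, y) \<in> dom" "defect (norm x) = 0" "A (norm x) = b * (B (norm x))\<^sup>2"
    and c2: "c2 (norm x) = B (norm x)" "deriv c2 (norm x) = B' (norm x)"
  shows "norm y * spray_P b c2 (norm x) (s_var x y) = spray_X x y"
    and "(norm y)\<^sup>2 * spray_Q b c2 (norm x) (s_var x y) = spray_Y x y"
proof -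
  note D = domD[OF assms(1)]
  define u where "u = norm y"
  define s where "s = s_var x y"
  define r where "r = norm x"
  define k where "k = sqrt (r\<^sup>2 - s\<^sup>2)"
  define B0 where "B0 = B (norm x)"
  \<comment> \<open>\<open>b\<close> is nonzero because \<open>A\<close> is.\<close>
  have pos: "u > 0" "r > 0" "b \<noteq> 0" "B0 \<noteq> 0" using D assms(3) by (auto simp: u_def r_def B0_def)
  have v: "x \<bullet> y = u * s" using pos by (simp add: u_def s_def s_var_def)
  have R: "x \<bullet> x = r\<^sup>2" "y \<bullet> y = u\<^sup>2" by (simp_all add: r_def u_def power2_norm_eq_inner)
  have w: "area x y = u * k"
  proof -
    have "r\<^sup>2 * u\<^sup>2 - (u * s)\<^sup>2 = u\<^sup>2 * (r\<^sup>2 - s\<^sup>2)" by (simp add: power_mult_distrib algebra_simps)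
    then show ?thesis unfolding area_def R v using pos by (simp add: real_sqrt_mult k_def)
  qed
  have k2: "k\<^sup>2 = r\<^sup>2 - s\<^sup>2"
  proof -
    have "u\<^sup>2 * k\<^sup>2 = u\<^sup>2 * (r\<^sup>2 - s\<^sup>2)" using area_sq[of x y] unfolding w R v by (simp add: power_mult_distrib algebra_simps)
    then show ?thesis using pos by simp
  qed
  have q: "qq x y = u\<^sup>2 * (r\<^sup>2 - s\<^sup>2 + B0 * s * k + b * B0\<^sup>2 * s\<^sup>2)"
  proof -
    have "(u * k)\<^sup>2 = u\<^sup>2 * (r\<^sup>2 - s\<^sup>2)" by (simp add: power_mult_distrib k2)
    then show ?thesis unfolding q_eq w v assms(3) by (simp add: B0_def power2_eq_square algebra_simps)
  qed
  show "norm y * spray_P b c2 (norm x) (s_var x y) = spray_X x y"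
    unfolding spray_P_def spray_X_def assms(2,3) c2 w R v
    unfolding B0_def[symmetric] unfolding r_def[symmetric] s_def[symmetric] u_def[symmetric] k_def[symmetric]
    using pos by (simp add: distrib_left power2_eq_square mult_ac)
  show "(norm y)\<^sup>2 * spray_Q b c2 (norm x) (s_var x y) = spray_Y x y"
  proof -
    define i where "i = 1 / r"
    define j where "j = 1 / B0"
    define h where "h = 1 / b"
    define c where "c = B' (norm x)"
    have ij: "r * i = 1" "B0 * j = 1" "b * h = 1" using pos by (auto simp: i_def j_def h_def)
    have 1: "spray_Y x y = i\<^sup>2 * h * j\<^sup>2 / 2 * (b * B0\<^sup>2 * u\<^sup>2 - 2 * (u\<^sup>2 * (r\<^sup>2 - s\<^sup>2 + B0 * s * k + b * B0\<^sup>2 * s\<^sup>2)) * i\<^sup>2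
        + b * B0\<^sup>2 * c * (u * s)\<^sup>2 * j * i)"
      unfolding spray_Y_def assms(2,3) R v q unfolding B0_def[symmetric] c_def[symmetric] unfolding r_def[symmetric]
      by (simp add: i_def j_def h_def power_divide mult_ac)
    have 2: "spray_Q b c2 (norm x) (s_var x y) = (b * r * B0 * c - 2 * b * B0\<^sup>2 + 2) * s\<^sup>2 * h * i ^ 4 * j\<^sup>2 / 2
       - s * k * h * i ^ 4 * j + (b * B0\<^sup>2 - 2) * h * i\<^sup>2 * j\<^sup>2 / 2"
      unfolding spray_Q_def c2 unfolding B0_def[symmetric] c_def[symmetric] unfolding r_def[symmetric] s_def[symmetric] k_def[symmetric]
      by (simp add: i_def j_def h_def power_divide mult_ac)
    show ?thesis unfolding 1 2 u_def[symmetric] using ij by algebra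
  qed
qed

end

section \<open>Non-regularity\<close>

lemma regular_finsler_continuous:
  assumes "regular_finsler_on U F'" "x \<in> U"
  shows "continuous_on (UNIV - {0}) (F' x)"
proof -
  have "Ck_on 0 (\<lambda>(x, y). F' x y) (U \<times> (UNIV - {0}))"
    using assms(1) unfolding regular_finsler_on_def smooth_on_def by blast
  then have "continuous_on (U \<times> (UNIV - {0})) (\<lambda>(x, y). F' x y)" by simp
  then have "continuous_on (UNIV - {0}) (\<lambda>y. case (x, y) of (x, y) \<Rightarrow> F' x y)"
    by (rule continuous_on_compose2) (use assms(2) in \<open>auto intro!: continuous_intros\<close>)
  then show ?thesis by simp
qed

text \<open>For negative discriminant, \<open>F\<close> jumps across \<open>s = 0\<close>.\<close>

lemma expo_neg_disc_limits:
  assumes "B\<^sup>2 - 4 * A < 0" "r > 0"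
  defines "e \<equiv> sqrt (4 * A - B\<^sup>2)"
  shows "((\<lambda>\<sigma>. expo A B (r / \<sigma>)) \<longlongrightarrow> - (B / e) * (pi / 2)) (at_right 0)"
    and "((\<lambda>\<sigma>. expo A B (r / \<sigma>)) \<longlongrightarrow> - (B / e) * (- (pi / 2))) (at_left 0)"
proof -
  have e: "e > 0" using assms(1) by (simp add: e_def)
  have eq: "expo A B (r / \<sigma>) = - (B / e) * arctan (B / e + (2 * r / e) * inverse \<sigma>)" for \<sigma>
  proof -
    have "(B + 2 * (r / \<sigma>)) / e = B / e + (2 * r / e) * inverse \<sigma>"
      by (simp add: add_divide_distrib inverse_eq_divide mult_ac)
    then show ?thesis using assms(1) by (simp add: expo_def arc_quot_def e_def)
  qed
  have c: "2 * r / e > 0" using e assms(2) by simp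
  have "filterlim (\<lambda>\<sigma>. B / e + (2 * r / e) * inverse \<sigma>) at_top (at_right 0)"
    by (intro filterlim_tendsto_add_at_top[OF tendsto_const] filterlim_tendsto_pos_mult_at_top[OF tendsto_const c]
        filterlim_inverse_at_top_right)
  from filterlim_compose[OF tendsto_arctan_at_top this]
  show "((\<lambda>\<sigma>. expo A B (r / \<sigma>)) \<longlongrightarrow> - (B / e) * (pi / 2)) (at_right 0)"
    unfolding eq by (rule tendsto_mult[OF tendsto_const])
  have "filterlim (\<lambda>\<sigma>. B / e + (2 * r / e) * inverse \<sigma>) at_bot (at_left 0)"
    by (intro filterlim_tendsto_add_at_bot_iff[OF tendsto_const, THEN iffD2] filterlim_tendsto_pos_mult_at_bot[OF tendsto_const c]
        filterlim_inverse_at_bot_neg)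
  from filterlim_compose[OF tendsto_arctan_at_bot this]
  show "((\<lambda>\<sigma>. expo A B (r / \<sigma>)) \<longlongrightarrow> - (B / e) * (- (pi / 2))) (at_left 0)"
    unfolding eq by (rule tendsto_mult[OF tendsto_const])
qed

context spherical_metric
begin

text \<open>At \<open>\<sigma>\<close> = 0 the curve \<open>p\<close> passes through a nonzero
  vector orthogonal to \<open>x\<close>, where a regular extension would be continuous. The
  one-sided limits of \<open>F\<close> there are r exp (- B pi / (2 e)) and r exp (B pi / (2 e)),
  which differ because \<open>B\<close> does not vanish.\<close>

lemma non_regular_neg_disc:
  assumes n: "CARD('n) \<ge> 3" and r: "r \<in> J" and d: "(B r)\<^sup>2 - 4 * A r < 0"
  shows "non_regular_over {x. norm x \<in> J} dom F"
  unfolding non_regular_over_def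
proof
  assume "\<exists>F'. regular_finsler_on {x. norm x \<in> J} F' \<and> (\<forall>(x, y)\<in>dom. F' x y = F x y)"
  then obtain F' where F': "regular_finsler_on {x. norm x \<in> J} F'" "\<And>x y. (x, y) \<in> dom \<Longrightarrow> F' x y = F x y" by blast
  obtain a b c :: 'n where dist: "a \<noteq> b" "a \<noteq> c" "b \<noteq> c" using exists_axes[OF n] .
  have r0: "r > 0" using r J_pos by auto
  define x where "x = r *\<^sub>R axis a (1::real)"
  define p where "p = (\<lambda>\<sigma>. (\<sigma> / r) *\<^sub>R axis a (1::real) + 1 *\<^sub>R axis b 1 + 0 *\<^sub>R axis c 1)"
  note pl = plane_dom[OF dist x_def refl r0]
  have p0: "p \<sigma> \<noteq> 0" for \<sigma>
  proof
    assume "p \<sigma> = 0"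
    then have "p \<sigma> $ b = 0" by simp
    then show False using dist by (simp add: p_def axis_def)
  qed
  have "continuous_on UNIV (\<lambda>\<sigma>. F' x (p \<sigma>))"
    by (rule continuous_on_compose2[OF regular_finsler_continuous[OF F'(1)]])
      (use p0 r r0 in \<open>auto simp: p_def x_def intro!: continuous_intros\<close>)
  then have "((\<lambda>\<sigma>. F' x (p \<sigma>)) \<longlongrightarrow> F' x (p 0)) (at 0)"
    by (simp add: continuous_on_eq_continuous_at isCont_def)
  then have lim: "((\<lambda>\<sigma>. F' x (p \<sigma>)) \<longlongrightarrow> F' x (p 0)) (at_right 0)" "((\<lambda>\<sigma>. F' x (p \<sigma>)) \<longlongrightarrow> F' x (p 0)) (at_left 0)"
    by (auto simp: filterlim_at_split)
  have val: "F' x (p \<sigma>) = sqrt (quad (A r) (B r) \<sigma> r) * exp (expo (A r) (B r) (r / \<sigma>))" if "\<sigma> \<noteq> 0" for \<sigma>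
  proof -
    have pv: "x \<bullet> p \<sigma> = \<sigma>" "area x (p \<sigma>) = r" "norm x = r" using r0 unfolding p_def pl by simp_all
    \<comment> \<open>Completing the square makes the radicand positive for every nonzero
      \<open>\<sigma>\<close>, so the domain contains the curve on both sides of 0.\<close>
    have "4 * quad (A r) (B r) \<sigma> r = (2 * r + B r * \<sigma>)\<^sup>2 + (4 * A r - (B r)\<^sup>2) * \<sigma>\<^sup>2"
      by (simp add: quad_def power2_eq_square algebra_simps)
    also have "\<dots> > 0" using d that by (intro add_nonneg_pos mult_pos_pos) auto
    finally have "quad (A r) (B r) \<sigma> r > 0" by simp
    then have D: "(x, p \<sigma>) \<in> dom" using that r r0 by (simp add: dom_def qq_def pv)
    show ?thesis unfolding F'(2)[OF D] F_eq[OF D]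
      by (simp add: qq_def mm_def conf_def pv real_sqrt_mult exp_double)
  qed
  define e where "e = sqrt (4 * A r - (B r)\<^sup>2)"
  have e: "e > 0" using d by (simp add: e_def)
  have q: "((\<lambda>\<sigma>. sqrt (quad (A r) (B r) \<sigma> r)) \<longlongrightarrow> sqrt (quad (A r) (B r) 0 r)) (at 0)"
    unfolding quad_def by (intro tendsto_intros)
  then have q': "((\<lambda>\<sigma>. sqrt (quad (A r) (B r) \<sigma> r)) \<longlongrightarrow> r) (at_right 0)" "((\<lambda>\<sigma>. sqrt (quad (A r) (B r) \<sigma> r)) \<longlongrightarrow> r) (at_left 0)"
    using r0 by (auto simp: filterlim_at_split quad_def)
  have evr: "\<forall>\<^sub>F \<sigma> in at_right 0. F' x (p \<sigma>) = sqrt (quad (A r) (B r) \<sigma> r) * exp (expo (A r) (B r) (r / \<sigma>))"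
    using val by (auto simp: eventually_at_filter)
  have evl: "\<forall>\<^sub>F \<sigma> in at_left 0. F' x (p \<sigma>) = sqrt (quad (A r) (B r) \<sigma> r) * exp (expo (A r) (B r) (r / \<sigma>))"
    using val by (auto simp: eventually_at_filter)
  note E = expo_neg_disc_limits[OF d r0, folded e_def]
  have "F' x (p 0) = r * exp (- (B r / e) * (pi / 2))"
    by (rule tendsto_unique[OF _ lim(1)], simp, subst tendsto_cong[OF evr],
        intro tendsto_mult q'(1) tendsto_exp E(1))
  moreover have "F' x (p 0) = r * exp (- (B r / e) * (- (pi / 2)))"
    by (rule tendsto_unique[OF _ lim(2)], simp, subst tendsto_cong[OF evl],
        intro tendsto_mult q'(2) tendsto_exp E(2))
  ultimately have "- (B r / e) * (pi / 2) = - (B r / e) * (- (pi / 2))"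
    using r0 by simp
  then show False using e B_nz[OF r] pi_gt_zero by simp
qed

text \<open>For positive discriminant, \<open>F\<close> tends to 0 at the zero \<open>w0\<close> of the radicand at which the
  exponent stays bounded above.\<close>

lemma non_regular_pos_disc:
  assumes n: "CARD('n) \<ge> 3" and r: "r \<in> J" and d: "(B r)\<^sup>2 - 4 * A r > 0"
  shows "non_regular_over {x. norm x \<in> J} dom F"
  unfolding non_regular_over_def
proof
  assume "\<exists>F'. regular_finsler_on {x. norm x \<in> J} F' \<and> (\<forall>(x, y)\<in>dom. F' x y = F x y)"
  then obtain F' where F': "regular_finsler_on {x. norm x \<in> J} F'" "\<And>x y. (x, y) \<in> dom \<Longrightarrow> F' x y = F x y" by blast
  obtain a b c :: 'n where dist: "a \<noteq> b" "a \<noteq> c" "b \<noteq> c" using exists_axes[OF n] .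
  have r0: "r > 0" using r J_pos by auto
  define e where "e = sqrt ((B r)\<^sup>2 - 4 * A r)"
  have e: "e > 0" "e\<^sup>2 = (B r)\<^sup>2 - 4 * A r" using d by (simp_all add: e_def)
  \<comment> \<open>Taking v = \<open>k\<close>, with sign opposite to \<open>B r\<close>, turns the
    radicand into w^2 - |B| w + A.\<close>
  define k where "k = - sgn (B r)"
  have k: "B r * k = - \<bar>B r\<bar>" "k * k = 1" "k \<noteq> 0" using B_nz[OF r] by (auto simp: k_def sgn_if)
  \<comment> \<open>The larger root of this polynomial, positive whatever the sign of
    \<open>A r\<close>. The radicand is positive to its right, so the root is approached from there
    inside the domain.\<close>
  define w0 where "w0 = (\<bar>B r\<bar> + e) / 2"
  have w0: "w0 > 0" using e(1) by (simp add: w0_def add_nonneg_pos)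
  define x where "x = r *\<^sub>R axis a (1::real)"
  define p where "p = (\<lambda>w. (k / r) *\<^sub>R axis a (1::real) + (w / r) *\<^sub>R axis b 1 + 0 *\<^sub>R axis c 1)"
  note pl = plane_dom[OF dist x_def refl r0]
  have p0: "p w \<noteq> 0" if "w > 0" for w
  proof
    assume "p w = 0"
    then have "p w $ b = 0" by simp
    then show False using dist that r0 by (simp add: p_def axis_def)
  qed
  have "continuous_on {0<..} (\<lambda>w. F' x (p w))"
    by (rule continuous_on_compose2[OF regular_finsler_continuous[OF F'(1)]])
      (use p0 r r0 in \<open>auto simp: p_def x_def intro!: continuous_intros\<close>)
  then have "((\<lambda>w. F' x (p w)) \<longlongrightarrow> F' x (p w0)) (at w0)"
    using w0 by (simp add: continuous_on_eq_continuous_at isCont_def)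
  then have lim: "((\<lambda>w. F' x (p w)) \<longlongrightarrow> F' x (p w0)) (at_right w0)"
    by (simp add: filterlim_at_split)
  have "F' x (p w) \<le> sqrt (quad (A r) (B r) k w)" if w: "w > w0" for w
  proof -
    have wp: "w > 0" using w w0 by simp
    have pv: "x \<bullet> p w = k" "area x (p w) = w" "norm x = r" using r0 wp unfolding p_def pl by simp_all
    define z where "z = 2 * w - \<bar>B r\<bar>"
    have z: "z > e" using w by (simp add: z_def w0_def)
    have "4 * quad (A r) (B r) k w = z\<^sup>2 - e\<^sup>2"
    proof -
      have "quad (A r) (B r) k w = w\<^sup>2 + (B r * k) * w + A r * (k * k)" by (simp add: quad_def power2_eq_square)
      then show ?thesis unfolding k e(2) by (simp add: z_def power2_diff power_mult_distrib)
    qed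
    also have "\<dots> > 0" using z e(1) by (simp add: power_strict_mono)
    finally have q: "quad (A r) (B r) k w > 0" by simp
    then have D: "(x, p w) \<in> dom" using k wp r r0 by (simp add: dom_def qq_def pv)
    have kw: "w / k = k * w" using k(2,3) by (simp add: field_simps)
    \<comment> \<open>By the choice of \<open>k\<close> the exponent equals - |B| / e times arctanh
      (z / e). As z > e it is not positive, so \<open>F\<close> is bounded by the square root of the
      radicand, which tends to 0 at \<open>w0\<close>, against the positivity of a regular
      extension.\<close>
    have "B r * arc_quot ((B r)\<^sup>2 - 4 * A r) (B r + 2 * (w / k)) \<le> 0"
    proof -
      have Bk: "B r = - (k * \<bar>B r\<bar>)" using k by (metis minus_mult_commute mult.assoc mult.commute mult_1 mult_minus_right minus_minus)
      have "(B r + 2 * (w / k)) / e = k * (z / e)"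
        unfolding kw by (subst Bk) (simp add: z_def algebra_simps diff_divide_distrib)
      moreover have "arctanh (k * (z / e)) = k * arctanh (z / e)"
        using k(2,3) arctanh_minus[of "z / e"] by (auto simp: square_eq_1_iff)
      ultimately have "B r * arc_quot ((B r)\<^sup>2 - 4 * A r) (B r + 2 * (w / k)) = (B r * k) * (arctanh (z / e) / e)"
        using d by (simp add: arc_quot_def e_def)
      also have "\<dots> \<le> 0" unfolding k(1) using arctanh_nonneg[of "z / e"] z e(1) by (simp add: mult_nonneg_nonneg)
      finally show ?thesis .
    qed
    then have "exp (expo (A r) (B r) (w / k)) \<le> 1" by (simp add: expo_def)
    moreover have "F' x (p w) = sqrt (quad (A r) (B r) k w) * exp (expo (A r) (B r) (w / k))"
      unfolding F'(2)[OF D] F_eq[OF D]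
      by (simp add: qq_def mm_def conf_def pv real_sqrt_mult exp_double)
    ultimately show ?thesis using q by (simp add: mult_left_le)
  qed
  then have ev: "\<forall>\<^sub>F w in at_right w0. F' x (p w) \<le> sqrt (quad (A r) (B r) k w)"
    by (auto simp: eventually_at_filter)
  have q0: "quad (A r) (B r) k w0 = 0"
  proof -
    have "quad (A r) (B r) k w0 = w0\<^sup>2 + (B r * k) * w0 + A r * (k * k)" by (simp add: quad_def power2_eq_square)
    also have "\<dots> = (e\<^sup>2 - \<bar>B r\<bar>\<^sup>2 + 4 * A r) / 4" unfolding k by (simp add: w0_def power2_eq_square field_simps)
    finally show ?thesis unfolding e(2) by simp
  qed
  have "((\<lambda>w. sqrt (quad (A r) (B r) k w)) \<longlongrightarrow> sqrt (quad (A r) (B r) k w0)) (at_right w0)"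
    unfolding quad_def by (intro tendsto_intros)
  from tendsto_le[OF _ this lim ev] have "F' x (p w0) \<le> 0" by (simp add: q0)
  moreover have "F' x (p w0) > 0"
    using F'(1) p0[OF w0] r r0 by (auto simp: regular_finsler_on_def x_def)
  ultimately show False by simp
qed

lemma non_regular:
  assumes "CARD('n) \<ge> 3" "J \<noteq> {}"
  shows "non_regular_over {x. norm x \<in> J} dom F"
proof -
  obtain r where r: "r \<in> J" using assms(2) by blast
  then show ?thesis
    using non_regular_neg_disc[OF assms(1) r] non_regular_pos_disc[OF assms(1) r] disc_nz[OF r] by linarith
qed

end

theorem theorem4p2:
  fixes J :: "real set" and c1 c2 :: "real \<Rightarrow> real"
    and F :: "real^'n \<Rightarrow> real^'n \<Rightarrow> real" and D :: "((real^'n) \<times> (real^'n)) set"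
  assumes n: "CARD('n) \<ge> 3"
    and J: "open J" "is_interval J" "J \<noteq> {}" "J \<subseteq> {0<..}"
    and smooth: "smooth_on c1 J" "smooth_on c2 J"
    and c1: "\<forall>r\<in>J. c1 r \<noteq> -1"
    and c2: "\<forall>r\<in>J. c2 r \<noteq> 0"
    and disc: "\<forall>r\<in>J. (c2 r)\<^sup>2 - 4 * c1 r - 4 \<noteq> 0"
    and F: "F = F_metric c1 c2"
    and D: "D = F_domain J c1 c2"
  shows "(non_regular_over {x. norm x \<in> J} D F \<and> landsberg_on D F \<longleftrightarrow>
            (c1 constant_on J \<and> c2 constant_on J) \<or>
            (\<exists>b. \<forall>r\<in>J. c1 r = b * (c2 r)\<^sup>2 - 1)) \<and>
         (\<forall>b. (\<forall>r\<in>J. c1 r = b * (c2 r)\<^sup>2 - 1) \<longrightarrow>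
            (\<forall>r s. admissible_rs J c1 c2 r s \<longrightarrow>
               phi (c1 r) (c2 r) r s = phi_special b (c2 r) r s) \<and>
            (\<forall>(x, y)\<in>D. spray_coeff F x y =
               (norm y * spray_P b c2 (norm x) (s_var x y)) *\<^sub>R y +
               ((norm y)\<^sup>2 * spray_Q b c2 (norm x) (s_var x y)) *\<^sub>R x) \<and>
            landsberg_on D F \<and> \<not> berwaldian_on D F)"
proof -
  have deriv: "(f has_real_derivative deriv f r) (at r)" if "smooth_on f J" "r \<in> J" for f :: "real \<Rightarrow> real" and r
  proof -
    have "Ck_on (Suc 0) f J" using that(1) unfolding smooth_on_def by blast
    then show ?thesis using that(2) by (simp add: DERIV_deriv_iff_real_differentiable)
  qed
  interpret spherical J "\<lambda>r. c1 r + 1" c2 "deriv c1" "deriv c2"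
  proof
    fix r assume r: "r \<in> J"
    show "((\<lambda>r. c1 r + 1) has_real_derivative deriv c1 r) (at r)"
      using DERIV_add[OF deriv[OF smooth(1) r] DERIV_const] by simp
    show "(c2 has_real_derivative deriv c2 r) (at r)" by (rule deriv[OF smooth(2) r])
    show "c1 r + 1 \<noteq> 0" using c1 r by (simp add: eq_neg_iff_add_eq_0)
    show "c2 r \<noteq> 0" using c2 r by simp
    show "(c2 r)\<^sup>2 - 4 * (c1 r + 1) \<noteq> 0" using disc r by (simp add: algebra_simps)
  qed (use J in auto)
  have D': "D = dom" unfolding D by (rule F_domain_eq_dom(1)) simp_all
  interpret spherical_metric J "\<lambda>r. c1 r + 1" c2 "deriv c1" "deriv c2" F
    by unfold_locales (use F_domain_eq_dom(2)[of c1 c2] in \<open>simp add: F\<close>)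
  have nonreg: "non_regular_over {x. norm x \<in> J} D F" unfolding D' by (rule non_regular[OF n J(3)])
  have L: "landsberg_on D F \<longleftrightarrow> (\<exists>b. \<forall>r\<in>J. c1 r = b * (c2 r)\<^sup>2 - 1)"
    unfolding D' landsberg_iff_defect_0[OF n] defect_0_iff[OF J(2)] by (simp add: eq_diff_eq)
  have const: "\<exists>b. \<forall>r\<in>J. c1 r = b * (c2 r)\<^sup>2 - 1" if cc: "c1 constant_on J" "c2 constant_on J"
  proof -
    obtain k1 where "\<forall>r\<in>J. c1 r = k1" using cc(1) unfolding constant_on_def by blast
    moreover obtain k2 where "\<forall>r\<in>J. c2 r = k2" using cc(2) unfolding constant_on_def by blast
    ultimately have k: "\<And>r. r \<in> J \<Longrightarrow> c1 r = k1" "\<And>r. r \<in> J \<Longrightarrow> c2 r = k2" by auto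
    have "k2 \<noteq> 0" using J(3) c2 k(2) by auto
    \<comment> \<open>The coefficient is the constant value of A / B^2.\<close>
    then have "\<forall>r\<in>J. c1 r = (k1 + 1) / k2\<^sup>2 * (c2 r)\<^sup>2 - 1" using k by simp
    then show ?thesis ..
  qed
  have "(\<forall>r s. admissible_rs J c1 c2 r s \<longrightarrow> phi (c1 r) (c2 r) r s = phi_special b (c2 r) r s) \<and>
      (\<forall>(x, y)\<in>D. spray_coeff F x y =
         (norm y * spray_P b c2 (norm x) (s_var x y)) *\<^sub>R y +
         ((norm y)\<^sup>2 * spray_Q b c2 (norm x) (s_var x y)) *\<^sub>R x) \<and>
      landsberg_on D F \<and> \<not> berwaldian_on D F"
    if b: "\<forall>r\<in>J. c1 r = b * (c2 r)\<^sup>2 - 1" for b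
  proof (intro conjI)
    show "\<forall>r s. admissible_rs J c1 c2 r s \<longrightarrow> phi (c1 r) (c2 r) r s = phi_special b (c2 r) r s"
      using b c2 phi_eq_phi_special by (auto simp: admissible_rs_def)
    show l: "landsberg_on D F" using L b by blast
    then have defect: "\<forall>r\<in>J. defect r = 0" unfolding D' using landsberg_iff_defect_0[OF n] by blast
    obtain r where "r \<in> J" using J(3) by blast
    then show "\<not> berwaldian_on D F" unfolding D' using not_berwaldian_defect_0[OF n] defect by blast
    show "\<forall>(x, y)\<in>D. spray_coeff F x y =
         (norm y * spray_P b c2 (norm x) (s_var x y)) *\<^sub>R y +
         ((norm y)\<^sup>2 * spray_Q b c2 (norm x) (s_var x y)) *\<^sub>R x"
    proof (clarify)
      fix x y :: "real^'n" assume xy: "(x, y) \<in> D"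
      then have xy: "(x, y) \<in> dom" by (simp add: D')
      note J = domD(1)[OF xy]
      have A: "c1 (norm x) + 1 = b * (c2 (norm x))\<^sup>2" using b J by simp
      show "spray_coeff F x y =
         (norm y * spray_P b c2 (norm x) (s_var x y)) *\<^sub>R y +
         ((norm y)\<^sup>2 * spray_Q b c2 (norm x) (s_var x y)) *\<^sub>R x"
        unfolding spray_coeff_eq[OF xy] using spray_P_Q[OF xy _ A refl refl] defect J by simp
    qed
  qed
  then show ?thesis using nonreg L const by blast
qed

end
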